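(* Given a bipartite graph $G=(S,T;E)$, a weight function $w:E\to\mathbb R_+$ and a positive integer $d$, one can find in polynomial time a permutation $s_1,\dots,s_n$ of $S$ together with a $d$-distance matching $M$ with respect to this ordering such that $w(M)$ is the largest weight of a $d$-distance matching over all permutations of $S$.
   Context: For an ordering $s_1,\dots,s_n$ of $S$, a $d$-distance matching is an edge set $M\subseteq E$ such that every node of $S$ has degree at most $1$ in $M$ (nodes of $T$ have no degree bound) and whenever $s_it,s_jt\in M$ with $i\ne j$, $|i-j|\ge d$. $w(M)=\sum_{e\in M}w(e)$. *)

theory Defs
  imports
    "HOL-Combinatorics.Multiset_Permutations"
    "HOL-Computational_Algebra.Polynomial"
    Complex_Main
begin

section \<open>Distance matchings in bipartite graphs\<close>

text \<open>
  An edge is a pair whose first component lies in \<open>S\<close> and whose second component lies in \<open>T\<close>,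
  so the two sides are kept apart even if they share labels.
\<close>

definition bipartite_graph :: "'a set \<Rightarrow> 'b set \<Rightarrow> ('a \<times> 'b) set \<Rightarrow> bool" where
  "bipartite_graph S T E \<longleftrightarrow> finite S \<and> finite T \<and> E \<subseteq> S \<times> T"

text \<open>
  An ordering of \<open>S\<close> is a list in \<^term>\<open>permutations_of_set S\<close>; the list index \<open>i\<close> (from 0) corresponds to
  position \<open>i + 1\<close>, which does not affect index differences.
\<close>

definition distance_matching ::
    "nat \<Rightarrow> ('a \<times> 'b) set \<Rightarrow> 'a list \<Rightarrow> ('a \<times> 'b) set \<Rightarrow> bool" where
  "distance_matching d E ss M \<longleftrightarrow>
     M \<subseteq> E \<and>
     (\<forall>s\<in>set ss. card {e \<in> M. fst e = s} \<le> 1) \<and>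
     (\<forall>t. \<forall>i<length ss. \<forall>j<length ss.
        (ss ! i, t) \<in> M \<and> (ss ! j, t) \<in> M \<and> i \<noteq> j \<longrightarrow> int d \<le> \<bar>int i - int j\<bar>)"


section \<open>A random access machine over the naturals and the reals\<close>

text \<open>
  Since edge weights are real numbers, running time is measured on a random access machine with
  exact real cells. Memory consists of arrays of naturals and arrays of reals; array names are
  fixed in the program text, indices are computed. Arithmetic is restricted to addition and
  subtraction (truncated on the naturals). Without multiplication, the bit length of the largest
  number grows by only a constant per step, so the unit-cost measure below is not more permissive
  than polynomial time in the bit model when the weights are rational. The only real constants a
  program may contain are integers, so no information can be hidden in them, and reals can
  influence control flow and addresses only through comparisons.
\<close>

record memory =
  nat_arr :: "nat \<Rightarrow> nat \<Rightarrow> nat"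
  real_arr :: "nat \<Rightarrow> nat \<Rightarrow> real"

datatype nexp = NConst nat | NCell nat nexp | NAdd nexp nexp | NSub nexp nexp

datatype rexp = RConst int | RCell nat nexp | RAdd rexp rexp | RSub rexp rexp

datatype bexp = NLess nexp nexp | RLess rexp rexp | BNot bexp | BAnd bexp bexp

datatype com =
    Skip
  | NStore nat nexp nexp
  | RStore nat nexp rexp
  | Seq com com
  | Cond bexp com com
  | While bexp com

primrec nval :: "nexp \<Rightarrow> memory \<Rightarrow> nat" where
  "nval (NConst k) \<sigma> = k"
| "nval (NCell a i) \<sigma> = nat_arr \<sigma> a (nval i \<sigma>)"
| "nval (NAdd x y) \<sigma> = nval x \<sigma> + nval y \<sigma>"
| "nval (NSub x y) \<sigma> = nval x \<sigma> - nval y \<sigma>"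

primrec rval :: "rexp \<Rightarrow> memory \<Rightarrow> real" where
  "rval (RConst k) \<sigma> = of_int k"
| "rval (RCell a i) \<sigma> = real_arr \<sigma> a (nval i \<sigma>)"
| "rval (RAdd x y) \<sigma> = rval x \<sigma> + rval y \<sigma>"
| "rval (RSub x y) \<sigma> = rval x \<sigma> - rval y \<sigma>"

primrec bval :: "bexp \<Rightarrow> memory \<Rightarrow> bool" where
  "bval (NLess x y) \<sigma> \<longleftrightarrow> nval x \<sigma> < nval y \<sigma>"
| "bval (RLess x y) \<sigma> \<longleftrightarrow> rval x \<sigma> < rval y \<sigma>"
| "bval (BNot b) \<sigma> \<longleftrightarrow> \<not> bval b \<sigma>"
| "bval (BAnd b c) \<sigma> \<longleftrightarrow> bval b \<sigma> \<and> bval c \<sigma>"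

text \<open>
  \<open>run c \<sigma> k \<tau>\<close>: started in memory \<open>\<sigma>\<close>, the program \<open>c\<close> halts after \<open>k\<close> steps in memory \<open>\<tau>\<close>.
  Every store and every evaluation of a test is one step. The expressions in a fixed program have
  bounded size, so counting the individual operations inside them would change the running
  time by a constant factor only.
\<close>

inductive run :: "com \<Rightarrow> memory \<Rightarrow> nat \<Rightarrow> memory \<Rightarrow> bool" where
  Skip: "run Skip \<sigma> 1 \<sigma>"
| NStore: "run (NStore a i x) \<sigma> 1
    (\<sigma>\<lparr>nat_arr := (nat_arr \<sigma>)(a := (nat_arr \<sigma> a)(nval i \<sigma> := nval x \<sigma>))\<rparr>)"
| RStore: "run (RStore a i x) \<sigma> 1
    (\<sigma>\<lparr>real_arr := (real_arr \<sigma>)(a := (real_arr \<sigma> a)(nval i \<sigma> := rval x \<sigma>))\<rparr>)"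
| Seq: "run c \<sigma> k \<sigma>' \<Longrightarrow> run c' \<sigma>' l \<tau> \<Longrightarrow> run (Seq c c') \<sigma> (k + l) \<tau>"
| CondTrue: "bval b \<sigma> \<Longrightarrow> run c \<sigma> k \<tau> \<Longrightarrow> run (Cond b c c') \<sigma> (1 + k) \<tau>"
| CondFalse: "\<not> bval b \<sigma> \<Longrightarrow> run c' \<sigma> k \<tau> \<Longrightarrow> run (Cond b c c') \<sigma> (1 + k) \<tau>"
| WhileFalse: "\<not> bval b \<sigma> \<Longrightarrow> run (While b c) \<sigma> 1 \<sigma>"
| WhileTrue: "bval b \<sigma> \<Longrightarrow> run c \<sigma> k \<sigma>' \<Longrightarrow> run (While b c) \<sigma>' l \<tau> \<Longrightarrow>
    run (While b c) \<sigma> (1 + k + l) \<tau>"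

inductive_cases SkipE: "run Skip \<sigma> k \<tau>"
inductive_cases NStoreE: "run (NStore a i x) \<sigma> k \<tau>"
inductive_cases RStoreE: "run (RStore a i x) \<sigma> k \<tau>"
inductive_cases SeqE: "run (Seq c c') \<sigma> k \<tau>"
inductive_cases CondE: "run (Cond b c c') \<sigma> k \<tau>"
inductive_cases WhileE: "run (While b c) \<sigma> k \<tau>"

lemma run_deterministic:
  "run c \<sigma> k \<tau> \<Longrightarrow> run c \<sigma> k' \<tau>' \<Longrightarrow> k' = k \<and> \<tau>' = \<tau>"
proof (induction arbitrary: k' \<tau>' rule: run.induct)
  case (Seq c \<sigma> k \<sigma>' c' l \<tau>)
  from Seq.prems obtain k1 \<sigma>1 l1 where
    "run c \<sigma> k1 \<sigma>1" "run c' \<sigma>1 l1 \<tau>'" "k' = k1 + l1"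
    by (auto elim: SeqE)
  with Seq.IH show ?case by blast
next
  case (WhileTrue b \<sigma> c k \<sigma>' l \<tau>)
  from WhileTrue.prems WhileTrue.hyps(1) obtain k1 \<sigma>1 l1 where
    "run c \<sigma> k1 \<sigma>1" "run (While b c) \<sigma>1 l1 \<tau>'" "k' = 1 + k1 + l1"
    by (auto elim: WhileE)
  with WhileTrue.IH show ?case by blast
next
  case Skip
  then show ?case by (rule SkipE) simp
next
  case NStore
  then show ?case by (rule NStoreE) simp
next
  case RStore
  then show ?case by (rule RStoreE) simp
next
  case (CondTrue b \<sigma> c k \<tau> c')
  from CondTrue.prems CondTrue.hyps(1) obtain k1 where "run c \<sigma> k1 \<tau>'" "k' = 1 + k1"
    by (auto elim: CondE)
  with CondTrue.IH show ?case by blast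
next
  case (CondFalse b \<sigma> c' k \<tau> c)
  from CondFalse.prems CondFalse.hyps(1) obtain k1 where "run c' \<sigma> k1 \<tau>'" "k' = 1 + k1"
    by (auto elim: CondE)
  with CondFalse.IH show ?case by blast
next
  case (WhileFalse b \<sigma> c)
  from WhileFalse.prems WhileFalse.hyps(1) show ?case
    by (auto elim: WhileE)
qed


section \<open>Encoding of instances and solutions\<close>

text \<open>
  The graph has sides \<open>{..<n}\<close> and \<open>{..<m}\<close> and is given by a duplicate-free list \<open>es\<close> of its edges,
  in any order. Memory initially holds \<open>n\<close>, \<open>m\<close>, the number of edges and \<open>d\<close> in
  natural array 0, the endpoints of the edges in natural arrays 1 and 2, the weights in
  real array 0, and zero everywhere else.
\<close>

definition cells :: "'a::zero list \<Rightarrow> nat \<Rightarrow> 'a" where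
  "cells xs i = (if i < length xs then xs ! i else 0)"

definition input_memory ::
    "nat \<Rightarrow> nat \<Rightarrow> (nat \<times> nat) list \<Rightarrow> (nat \<times> nat \<Rightarrow> real) \<Rightarrow> nat \<Rightarrow> memory" where
  "input_memory n m es w d =
     \<lparr>nat_arr = (\<lambda>_ _. 0)(0 := cells [n, m, length es, d],
                           1 := cells (map fst es),
                           2 := cells (map snd es)),
      real_arr = (\<lambda>_ _. 0)(0 := cells (map w es))\<rparr>"

text \<open>
  On termination, the first \<open>n\<close> cells of natural array 3 list the ordering, and natural array 4
  marks the chosen edges by nonzero entries at their positions in the input list.
\<close>

definition output_ordering :: "nat \<Rightarrow> memory \<Rightarrow> nat list" where
  "output_ordering n \<tau> = map (nat_arr \<tau> 3) [0..<n]"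

definition output_edges :: "(nat \<times> nat) list \<Rightarrow> memory \<Rightarrow> (nat \<times> nat) set" where
  "output_edges es \<tau> = {es ! k | k. k < length es \<and> nat_arr \<tau> 4 k \<noteq> 0}"

end

theory Submission
  imports Defs
begin

text \<open>
  Write \<open>n = h * d + r\<close> with \<open>0 < r \<le> d\<close> (for \<open>n > 0\<close>). The positions of the neighbours of a node of
  \<open>T\<close> are at pairwise distance at least \<open>d\<close>, so there are at most \<open>h + 1\<close> of them, and if there are
  \<open>h + 1\<close>, then the first one is among the first \<open>r\<close> positions, so at most \<open>r\<close> nodes of \<open>T\<close> have
  degree \<open>h + 1\<close>. Conversely, every edge set with degrees at most 1 in \<open>S\<close> that satisfies
  these two conditions is a distance matching for a suitable ordering: read the positions residue
  class by residue class modulo \<open>d\<close>, each class from its largest element down, and place the nodes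
  of \<open>S\<close> in this order, grouped by their partners, partners of degree \<open>h + 1\<close> first. It remains to
  maximise the weight under degree constraints, which is a minimum cost flow problem; it is solved by
  the primal-dual method, whose node potentials certify optimality by complementary slackness.
\<close>

section \<open>Weakest preconditions with a uniform bound on loop iterations\<close>

text \<open>Reading each class downwards is what makes any \<open>h\<close> consecutive places safe.
  Two positions closer than \<open>d\<close> lie in the same row (the value of
  \<open>p div d\<close>), or the later one lies in the next row and in an earlier class. In the
  second case the downward reading adds 1 to the difference of their places, which is at least
  \<open>h\<close> anyway; an upward reading would subtract 1 and could leave \<open>h - 1\<close>.
  The weights are arbitrary reals, so neither scaling nor integrality of the potentials can bound
  the work. The flow itself stays integral: each augmentation sends one unit, and the arcs out of
  the source have total capacity \<open>n\<close>, so there are at most \<open>n\<close>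
  augmentations, whatever the weights are. Time is not counted stage by stage. One number
  \<open>B\<close>, linear in the size of the graph, bounds the rounds of every execution of a loop,
  and the total is then a polynomial in \<open>B\<close> that is read off the program text.\<close>

definition nset :: "nat \<Rightarrow> nat \<Rightarrow> nat \<Rightarrow> memory \<Rightarrow> memory" where
  "nset a i x \<sigma> = \<sigma>\<lparr>nat_arr := (nat_arr \<sigma>)(a := (nat_arr \<sigma> a)(i := x))\<rparr>"

definition rset :: "nat \<Rightarrow> nat \<Rightarrow> real \<Rightarrow> memory \<Rightarrow> memory" where
  "rset a i x \<sigma> = \<sigma>\<lparr>real_arr := (real_arr \<sigma>)(a := (real_arr \<sigma> a)(i := x))\<rparr>"

lemma nset_rset_simps [simp]:
  "nat_arr (nset a i x \<sigma>) b = (if b = a then (nat_arr \<sigma> a)(i := x) else nat_arr \<sigma> b)"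
  "real_arr (nset a i x \<sigma>) = real_arr \<sigma>"
  "real_arr (rset a i y \<sigma>) b = (if b = a then (real_arr \<sigma> a)(i := y) else real_arr \<sigma> b)"
  "nat_arr (rset a i y \<sigma>) = nat_arr \<sigma>"
  by (simp_all add: nset_def rset_def)

text \<open>A step bound if every execution of a loop takes at most \<open>B\<close> rounds. Adding
  the two branches of \<open>Cond\<close>, instead of taking the larger one, keeps it a polynomial
  in \<open>B\<close>.\<close>

primrec tm :: "com \<Rightarrow> nat \<Rightarrow> nat" where
  "tm Skip B = 1"
| "tm (NStore a i x) B = 1"
| "tm (RStore a i x) B = 1"
| "tm (Seq c c') B = tm c B + tm c' B"
| "tm (Cond b c c') B = 1 + tm c B + tm c' B"
| "tm (While b c) B = 1 + B * (1 + tm c B)"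

text \<open>Only loops mention time: code without loops is bounded by \<open>tm\<close> whatever it
  does, so there \<open>wp\<close> is symbolic execution, which the simplifier carries out.
  Reasoning about a particular loop goes through \<open>wp_While_inv\<close>.\<close>

primrec wp :: "nat \<Rightarrow> com \<Rightarrow> (memory \<Rightarrow> bool) \<Rightarrow> memory \<Rightarrow> bool" where
  "wp B Skip Q \<sigma> = Q \<sigma>"
| "wp B (NStore a i x) Q \<sigma> = Q (nset a (nval i \<sigma>) (nval x \<sigma>) \<sigma>)"
| "wp B (RStore a i x) Q \<sigma> = Q (rset a (nval i \<sigma>) (rval x \<sigma>) \<sigma>)"
| "wp B (Seq c c') Q \<sigma> = wp B c (wp B c' Q) \<sigma>"
| "wp B (Cond b c c') Q \<sigma> = (if bval b \<sigma> then wp B c Q \<sigma> else wp B c' Q \<sigma>)"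
| wp_While: "wp B (While b c) Q \<sigma> =
    (\<exists>k \<tau>. run (While b c) \<sigma> k \<tau> \<and> k \<le> tm (While b c) B \<and> Q \<tau>)"

declare wp_While [simp del]

text \<open>Point-free variants, since intermediate postconditions \<open>wp B c Q\<close> occur unapplied.\<close>
lemma wp_fun [simp]:
  "wp B Skip Q = Q"
  "wp B (NStore a i x) Q = (\<lambda>\<sigma>. Q (nset a (nval i \<sigma>) (nval x \<sigma>) \<sigma>))"
  "wp B (RStore a i y) Q = (\<lambda>\<sigma>. Q (rset a (nval i \<sigma>) (rval y \<sigma>) \<sigma>))"
  "wp B (Seq c c') Q = wp B c (wp B c' Q)"
  "wp B (Cond b c c') Q = (\<lambda>\<sigma>. if bval b \<sigma> then wp B c Q \<sigma> else wp B c' Q \<sigma>)"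
  by (simp_all add: fun_eq_iff)

lemma wp_run:
  "wp B c Q \<sigma> \<Longrightarrow> \<exists>k \<tau>. run c \<sigma> k \<tau> \<and> k \<le> tm c B \<and> Q \<tau>"
proof (induction c arbitrary: Q \<sigma>)
  case Skip
  then show ?case using run.Skip[of \<sigma>] by (intro exI[of _ 1] exI[of _ \<sigma>]) simp
next
  case (NStore a i x)
  then show ?case using run.NStore[of a i x \<sigma>] by (auto simp: nset_def)
next
  case (RStore a i x)
  then show ?case using run.RStore[of a i x \<sigma>] by (auto simp: rset_def)
next
  case (Seq c c')
  from Seq.prems have "wp B c (wp B c' Q) \<sigma>" by simp
  from Seq.IH(1)[OF this] obtain k \<sigma>' where 1: "run c \<sigma> k \<sigma>'" "k \<le> tm c B" "wp B c' Q \<sigma>'"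
    by blast
  from Seq.IH(2)[OF 1(3)] obtain l \<tau> where 2: "run c' \<sigma>' l \<tau>" "l \<le> tm c' B" "Q \<tau>" by blast
  have "run (Seq c c') \<sigma> (k + l) \<tau>" using 1 2 by (blast intro: run.Seq)
  moreover have "k + l \<le> tm (Seq c c') B" using 1 2 by simp
  ultimately show ?case using 2 by blast
next
  case (Cond b c c')
  show ?case
  proof (cases "bval b \<sigma>")
    case True
    with Cond.prems have "wp B c Q \<sigma>" by simp
    from Cond.IH(1)[OF this] obtain k \<tau> where 1: "run c \<sigma> k \<tau>" "k \<le> tm c B" "Q \<tau>" by blast
    have "run (Cond b c c') \<sigma> (1 + k) \<tau>" using 1 True by (blast intro: run.CondTrue)
    moreover have "1 + k \<le> tm (Cond b c c') B" using 1 by simp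
    ultimately show ?thesis using 1 by blast
  next
    case False
    with Cond.prems have "wp B c' Q \<sigma>" by simp
    from Cond.IH(2)[OF this] obtain k \<tau> where 1: "run c' \<sigma> k \<tau>" "k \<le> tm c' B" "Q \<tau>" by blast
    have "run (Cond b c c') \<sigma> (1 + k) \<tau>" using 1 False by (blast intro: run.CondFalse)
    moreover have "1 + k \<le> tm (Cond b c c') B" using 1 by simp
    ultimately show ?thesis using 1 by blast
  qed
next
  case (While b c)
  then show ?case by (simp add: wp_While)
qed

lemma wp_mono:
  "wp B c Q \<sigma> \<Longrightarrow> (\<And>\<tau>. Q \<tau> \<Longrightarrow> Q' \<tau>) \<Longrightarrow> wp B c Q' \<sigma>"
proof (induction c arbitrary: Q Q' \<sigma>)
  case (Seq c c')
  show ?case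
    using Seq.IH(1)[of "wp B c' Q" \<sigma> "wp B c' Q'"] Seq.IH(2) Seq.prems by simp
next
  case (Cond b c c')
  then show ?case by (auto split: if_splits)
next
  case (While b c)
  then show ?case unfolding wp_While by blast
qed simp_all

text \<open>The measure serves twice: its decrease gives termination, and its initial value bounds
  the number of rounds.\<close>

lemma wp_While_inv:
  fixes \<mu> :: "memory \<Rightarrow> nat"
  assumes "I \<sigma>" and "\<mu> \<sigma> \<le> B"
    and step: "\<And>\<sigma>. I \<sigma> \<Longrightarrow> bval b \<sigma> \<Longrightarrow> wp B c (\<lambda>\<tau>. I \<tau> \<and> \<mu> \<tau> < \<mu> \<sigma>) \<sigma>"
    and final: "\<And>\<sigma>. I \<sigma> \<Longrightarrow> \<not> bval b \<sigma> \<Longrightarrow> Q \<sigma>"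
  shows "wp B (While b c) Q \<sigma>"
proof -
  \<comment> \<open>The claim has \<open>\<mu> \<sigma>\<close> where \<open>tm\<close> has
    \<open>B\<close>: to be inductive, the bound must shrink with each round.\<close>
  have "\<exists>k \<tau>. run (While b c) \<sigma> k \<tau> \<and> k \<le> 1 + \<mu> \<sigma> * (1 + tm c B) \<and> Q \<tau>" if "I \<sigma>" for \<sigma>
    using that
  proof (induction "\<mu> \<sigma>" arbitrary: \<sigma> rule: less_induct)
    case less
    show ?case
    proof (cases "bval b \<sigma>")
      case False
      then show ?thesis
        using final[OF less.prems] run.WhileFalse by (intro exI[of _ 1] exI[of _ \<sigma>]) auto
    next
      case True
      from wp_run[OF step[OF less.prems True]] obtain k \<sigma>' where
        1: "run c \<sigma> k \<sigma>'" "k \<le> tm c B" "I \<sigma>'" "\<mu> \<sigma>' < \<mu> \<sigma>" by blast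
      from less.hyps[OF 1(4,3)] obtain l \<tau> where
        2: "run (While b c) \<sigma>' l \<tau>" "l \<le> 1 + \<mu> \<sigma>' * (1 + tm c B)" "Q \<tau>" by blast
      have "run (While b c) \<sigma> (1 + k + l) \<tau>" using True 1(1) 2(1) by (rule run.WhileTrue)
      moreover have "1 + k + l \<le> 1 + \<mu> \<sigma> * (1 + tm c B)"
      proof -
        have "Suc (\<mu> \<sigma>') * (1 + tm c B) \<le> \<mu> \<sigma> * (1 + tm c B)"
          using 1(4) by (intro mult_le_mono1) simp
        then show ?thesis using 1(2) 2(2) by simp
      qed
      ultimately show ?thesis using 2(3) by blast
    qed
  qed
  from this[OF assms(1)] obtain k \<tau> where
    *: "run (While b c) \<sigma> k \<tau>" "k \<le> 1 + \<mu> \<sigma> * (1 + tm c B)" "Q \<tau>" by blast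
  have "\<mu> \<sigma> * (1 + tm c B) \<le> B * (1 + tm c B)"
    using assms(2) by (rule mult_le_mono1)
  with * show ?thesis unfolding wp_While by fastforce
qed

section \<open>Frame conditions from the arrays that a program writes\<close>

primrec nwrites :: "com \<Rightarrow> nat set" where
  "nwrites Skip = {}"
| "nwrites (NStore a i x) = {a}"
| "nwrites (RStore a i x) = {}"
| "nwrites (Seq c c') = nwrites c \<union> nwrites c'"
| "nwrites (Cond b c c') = nwrites c \<union> nwrites c'"
| "nwrites (While b c) = nwrites c"

primrec rwrites :: "com \<Rightarrow> nat set" where
  "rwrites Skip = {}"
| "rwrites (NStore a i x) = {}"
| "rwrites (RStore a i x) = {a}"
| "rwrites (Seq c c') = rwrites c \<union> rwrites c'"
| "rwrites (Cond b c c') = rwrites c \<union> rwrites c'"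
| "rwrites (While b c) = rwrites c"

definition eqoff :: "nat set \<Rightarrow> nat set \<Rightarrow> memory \<Rightarrow> memory \<Rightarrow> bool" where
  "eqoff X Y \<sigma> \<tau> \<longleftrightarrow>
     (\<forall>a. a \<notin> X \<longrightarrow> nat_arr \<tau> a = nat_arr \<sigma> a) \<and> (\<forall>a. a \<notin> Y \<longrightarrow> real_arr \<tau> a = real_arr \<sigma> a)"

lemma eqoff_refl [simp]: "eqoff X Y \<sigma> \<sigma>"
  by (simp add: eqoff_def)

lemma eqoff_trans: "eqoff X Y \<sigma> \<sigma>' \<Longrightarrow> eqoff X Y \<sigma>' \<tau> \<Longrightarrow> eqoff X Y \<sigma> \<tau>"
  by (simp add: eqoff_def)

lemma eqoff_mono: "eqoff X Y \<sigma> \<tau> \<Longrightarrow> X \<subseteq> X' \<Longrightarrow> Y \<subseteq> Y' \<Longrightarrow> eqoff X' Y' \<sigma> \<tau>"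
  by (auto simp: eqoff_def)

lemma run_eqoff: "run c \<sigma> k \<tau> \<Longrightarrow> eqoff (nwrites c) (rwrites c) \<sigma> \<tau>"
  by (induction rule: run.induct) (auto simp: eqoff_def)

text \<open>Yields from the program text that all other arrays are unchanged, so that the
  specification of a stage only has to describe what the stage computes.\<close>

lemma wp_frame:
  "wp B c Q \<sigma> \<Longrightarrow> wp B c (\<lambda>\<tau>. Q \<tau> \<and> eqoff (nwrites c) (rwrites c) \<sigma> \<tau>) \<sigma>"
proof (induction c arbitrary: Q \<sigma>)
  case (Seq c c')
  have "wp B c (\<lambda>\<tau>. wp B c' Q \<tau> \<and> eqoff (nwrites c) (rwrites c) \<sigma> \<tau>) \<sigma>"
    using Seq.IH(1) Seq.prems by simp
  then have "wp B c (wp B c' (\<lambda>\<tau>. Q \<tau> \<and> eqoff (nwrites (Seq c c')) (rwrites (Seq c c')) \<sigma> \<tau>)) \<sigma>"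
  proof (rule wp_mono)
    fix \<tau> assume *: "wp B c' Q \<tau> \<and> eqoff (nwrites c) (rwrites c) \<sigma> \<tau>"
    then have "wp B c' (\<lambda>\<tau>'. Q \<tau>' \<and> eqoff (nwrites c') (rwrites c') \<tau> \<tau>') \<tau>"
      using Seq.IH(2) by blast
    then show "wp B c' (\<lambda>\<tau>. Q \<tau> \<and> eqoff (nwrites (Seq c c')) (rwrites (Seq c c')) \<sigma> \<tau>) \<tau>"
      by (rule wp_mono) (use * in \<open>auto simp: eqoff_def\<close>)
  qed
  then show ?case by simp
next
  case (Cond b c c')
  have "wp B c (\<lambda>\<tau>. Q \<tau> \<and> eqoff (nwrites c) (rwrites c) \<sigma> \<tau>) \<sigma>" if "bval b \<sigma>"
    using Cond.IH(1) Cond.prems that by simp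
  moreover have "wp B c' (\<lambda>\<tau>. Q \<tau> \<and> eqoff (nwrites c') (rwrites c') \<sigma> \<tau>) \<sigma>" if "\<not> bval b \<sigma>"
    using Cond.IH(2) Cond.prems that by simp
  ultimately show ?case
    by (auto elim!: wp_mono intro: eqoff_mono)
next
  case (While b c)
  then show ?case unfolding wp_While using run_eqoff by blast
qed (auto simp: eqoff_def)

abbreviation "var a \<equiv> NCell a (NConst 0)"
abbreviation "setv a x \<equiv> NStore a (NConst 0) x"

definition For :: "nat \<Rightarrow> nexp \<Rightarrow> com \<Rightarrow> com" where
  "For i e c = Seq (setv i (NConst 0))
     (While (NLess (var i) e) (Seq c (setv i (NAdd (var i) (NConst 1)))))"

lemma writes_For [simp]:
  "nwrites (For i e c) = insert i (nwrites c)" "rwrites (For i e c) = rwrites c"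
  by (auto simp: For_def)

text \<open>\<open>I j\<close> holds before round \<open>j\<close>, with the counter already equal
  to \<open>j\<close>; the update \<open>nset i 0 (Suc j)\<close> in the step accounts for the
  increment after the body. As \<open>e\<close> has the value \<open>N\<close> in every state that
  agrees with \<open>\<sigma>\<close> off \<open>X\<close> and \<open>Y\<close>, the number of
  rounds is fixed in advance.\<close>

lemma wp_For:
  assumes "N \<le> B" and "i \<notin> nwrites c"
    and X: "insert i (nwrites c) \<subseteq> X" and Y: "rwrites c \<subseteq> Y"
    and bound: "\<And>\<tau>. eqoff X Y \<sigma> \<tau> \<Longrightarrow> nval e \<tau> = N"
    and init: "I 0 (nset i 0 0 \<sigma>)"
    and step: "\<And>j \<tau>. j < N \<Longrightarrow> I j \<tau> \<Longrightarrow> nat_arr \<tau> i 0 = j \<Longrightarrow> eqoff X Y \<sigma> \<tau> \<Longrightarrow>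
      wp B c (\<lambda>\<tau>. I (Suc j) (nset i 0 (Suc j) \<tau>)) \<tau>"
    and final: "\<And>\<tau>. I N \<tau> \<Longrightarrow> eqoff X Y \<sigma> \<tau> \<Longrightarrow> Q \<tau>"
  shows "wp B (For i e c) Q \<sigma>"
proof -
  define J where "J \<tau> \<longleftrightarrow> I (nat_arr \<tau> i 0) \<tau> \<and> nat_arr \<tau> i 0 \<le> N \<and> eqoff X Y \<sigma> \<tau>" for \<tau>
  have "wp B (While (NLess (var i) e) (Seq c (setv i (NAdd (var i) (NConst 1))))) Q (nset i 0 0 \<sigma>)"
  proof (rule wp_While_inv[where I = J and \<mu> = "\<lambda>\<tau>. N - nat_arr \<tau> i 0"])
    show "J (nset i 0 0 \<sigma>)" using init X by (auto simp: J_def eqoff_def)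
    show "N - nat_arr (nset i 0 0 \<sigma>) i 0 \<le> B" using assms(1) by simp
  next
    fix \<tau> assume J: "J \<tau>" and b: "bval (NLess (var i) e) \<tau>"
    let ?j = "nat_arr \<tau> i 0"
    have lt: "?j < N" using J b bound by (auto simp: J_def)
    have "wp B c (\<lambda>\<tau>. I (Suc ?j) (nset i 0 (Suc ?j) \<tau>)) \<tau>"
      using step[OF lt] J by (auto simp: J_def)
    then have "wp B c (\<lambda>\<tau>'. J (nset i 0 (Suc (nat_arr \<tau>' i 0)) \<tau>') \<and>
        N - Suc (nat_arr \<tau>' i 0) < N - ?j) \<tau>"
    proof (rule wp_mono[OF wp_frame])
      fix \<tau>' assume *: "I (Suc ?j) (nset i 0 (Suc ?j) \<tau>') \<and> eqoff (nwrites c) (rwrites c) \<tau> \<tau>'"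
      then have eq: "nat_arr \<tau>' i = nat_arr \<tau> i" using assms(2) by (simp add: eqoff_def)
      have "eqoff X Y \<tau> \<tau>'" using * X Y by (auto intro: eqoff_mono)
      then have "eqoff X Y \<sigma> \<tau>'" using J by (auto simp: J_def intro: eqoff_trans)
      then have "eqoff X Y \<sigma> (nset i 0 (Suc ?j) \<tau>')" using X by (auto simp: eqoff_def)
      then show "J (nset i 0 (Suc (nat_arr \<tau>' i 0)) \<tau>') \<and> N - Suc (nat_arr \<tau>' i 0) < N - ?j"
        using * eq lt by (auto simp: J_def)
    qed
    then show "wp B (Seq c (setv i (NAdd (var i) (NConst 1))))
        (\<lambda>\<tau>'. J \<tau>' \<and> N - nat_arr \<tau>' i 0 < N - ?j) \<tau>" by simp
  next
    fix \<tau> assume J: "J \<tau>" and b: "\<not> bval (NLess (var i) e) \<tau>"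
    then have "nat_arr \<tau> i 0 = N" using bound by (auto simp: J_def)
    then show "Q \<tau>" using J final by (auto simp: J_def)
  qed
  then show ?thesis by (simp add: For_def)
qed

text \<open>Nesting of loops becomes multiplication of polynomials, so for a fixed program a
  polynomial bound on the rounds gives a polynomial bound on the steps.\<close>

lemma tm_poly: "\<exists>p :: nat poly. \<forall>x. tm c (poly q x) = poly p x"
proof (induction c)
  case (Seq c c')
  then obtain p p' where "\<forall>x. tm c (poly q x) = poly p x" "\<forall>x. tm c' (poly q x) = poly p' x" by blast
  then show ?case by (intro exI[of _ "p + p'"]) simp
next
  case (Cond b c c')
  then obtain p p' where "\<forall>x. tm c (poly q x) = poly p x" "\<forall>x. tm c' (poly q x) = poly p' x" by blast
  then show ?case by (intro exI[of _ "1 + p + p'"]) simp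
next
  case (While b c)
  then obtain p where "\<forall>x. tm c (poly q x) = poly p x" by blast
  then show ?case by (intro exI[of _ "1 + q * (1 + p)"]) simp
qed (auto intro!: exI[of _ "1"])

section \<open>Residual networks and potentials\<close>

text \<open>Arcs \<open>a < A\<close> are the arcs of the network, and \<open>A + a\<close> is the reverse of \<open>a\<close>. A flow is
  represented by its residual capacities \<open>R\<close>, so that the flow on \<open>a\<close> is \<open>R (A + a)\<close>.\<close>

locale residual_network =
  fixes U V :: "nat \<Rightarrow> nat" and C :: "nat \<Rightarrow> real" and A N src snk :: nat
  assumes rev: "a < A \<Longrightarrow> U (A + a) = V a" "a < A \<Longrightarrow> V (A + a) = U a" "a < A \<Longrightarrow> C (A + a) = - C a"
    and nodes: "a < A \<Longrightarrow> U a < N" "a < A \<Longrightarrow> V a < N" "src < N" "snk < N"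
    and src_neq_snk: "src \<noteq> snk"
begin

lemma arc_cases:
  assumes "a < A + A"
  obtains "a < A" | b where "b < A" "a = A + b"
proof (cases "a < A")
  case False
  then show ?thesis using that(2)[of "a - A"] assms by simp
qed (use that(1) in simp)

definition partner :: "nat \<Rightarrow> nat" where
  "partner a = (if a < A then a + A else a - A)"

lemma partner:
  assumes "a < A + A"
  shows "partner a < A + A" "partner a \<noteq> a" "U (partner a) = V a" "V (partner a) = U a"
    "C (partner a) = - C a"
proof -
  consider "a < A" "partner a = A + a" | b where "b < A" "a = A + b" "partner a = b"
    using assms by (cases rule: arc_cases) (simp_all add: partner_def)
  note cases = this
  show "partner a < A + A" by (cases rule: cases) simp_all
  show "partner a \<noteq> a" by (cases rule: cases) simp_all
  show "U (partner a) = V a" by (cases rule: cases) (simp_all add: rev)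
  show "V (partner a) = U a" by (cases rule: cases) (simp_all add: rev)
  show "C (partner a) = - C a" by (cases rule: cases) (simp_all add: rev)
qed

lemma nodes2: "a < A + A \<Longrightarrow> U a < N" "a < A + A \<Longrightarrow> V a < N"
  by (erule arc_cases; simp add: nodes rev)+

definition net :: "(nat \<Rightarrow> nat) \<Rightarrow> nat \<Rightarrow> int" where
  "net F v = (\<Sum>a<A. int (F a) * (of_bool (U a = v) - of_bool (V a = v)))"

text \<open>The value of the flow is left free: edge sets of different sizes compete, and a cheapest
  flow need not be a maximum one.\<close>

definition is_flow :: "(nat \<Rightarrow> nat) \<Rightarrow> (nat \<Rightarrow> nat) \<Rightarrow> bool" where
  "is_flow cap F \<longleftrightarrow> (\<forall>a<A. F a \<le> cap a) \<and> (\<forall>v. v \<noteq> src \<longrightarrow> v \<noteq> snk \<longrightarrow> net F v = 0)"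

definition residual :: "(nat \<Rightarrow> nat) \<Rightarrow> (nat \<Rightarrow> nat) \<Rightarrow> bool" where
  "residual cap R \<longleftrightarrow> (\<forall>a<A. R a + R (A + a) = cap a)"

abbreviation "flow_of R \<equiv> (\<lambda>a. R (A + a))"

text \<open>Nonnegative reduced costs on all arcs with residual capacity. The last conjunct says the
  same of an additional arc of cost 0 from source to sink; when that arc becomes tight, no path of
  negative cost is left.\<close>

definition feasible :: "(nat \<Rightarrow> nat) \<Rightarrow> (nat \<Rightarrow> real) \<Rightarrow> bool" where
  "feasible R \<pi> \<longleftrightarrow> (\<forall>a<A + A. 0 < R a \<longrightarrow> \<pi> (V a) \<le> \<pi> (U a) + C a) \<and> \<pi> snk \<le> \<pi> src"

text \<open>\<open>par v\<close> is the arc by which \<open>v\<close> was reached; the rank function excludes cycles.\<close>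
definition tight_tree ::
    "(nat \<Rightarrow> nat) \<Rightarrow> (nat \<Rightarrow> real) \<Rightarrow> (nat \<Rightarrow> nat) \<Rightarrow> nat set \<Rightarrow> (nat \<Rightarrow> nat) \<Rightarrow> bool" where
  "tight_tree R \<pi> par X rk \<longleftrightarrow> src \<in> X \<and> X \<subseteq> {..<N} \<and> (\<forall>v\<in>X. rk v < card X) \<and>
     (\<forall>v\<in>X. v \<noteq> src \<longrightarrow> par v < A + A \<and> 0 < R (par v) \<and> V (par v) = v \<and> U (par v) \<in> X \<and>
        rk (U (par v)) < rk v \<and> \<pi> v = \<pi> (U (par v)) + C (par v))"

lemma feasible_cong: "(\<And>v. v < N \<Longrightarrow> \<pi> v = \<pi>' v) \<Longrightarrow> feasible R \<pi> \<longleftrightarrow> feasible R \<pi>'"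
  using nodes nodes2 by (simp add: feasible_def)

lemma tight_tree_cong:
  assumes "\<And>v. v < N \<Longrightarrow> \<pi> v = \<pi>' v"
  shows "tight_tree R \<pi> par X rk \<longleftrightarrow> tight_tree R \<pi>' par X rk"
proof -
  have "tight_tree R p' par X rk"
    if "tight_tree R p par X rk" "\<And>v. v < N \<Longrightarrow> p v = p' v" for p p'
    unfolding tight_tree_def
  proof (intro conjI ballI impI)
    fix v assume v: "v \<in> X" "v \<noteq> src"
    then have "p v = p (U (par v)) + C (par v)" "v < N" "U (par v) < N"
      using that(1) by (auto simp: tight_tree_def)
    then show "p' v = p' (U (par v)) + C (par v)" using that(2) by simp
  qed (use that(1) in \<open>auto simp: tight_tree_def\<close>)
  from this[of \<pi> \<pi>'] this[of \<pi>' \<pi>] show ?thesis using assms by auto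
qed

definition pushed :: "nat \<Rightarrow> (nat \<Rightarrow> nat) \<Rightarrow> nat \<Rightarrow> nat" where
  "pushed a R = (R(a := R a - 1))(partner a := R (partner a) + 1)"

lemma residual_pushed:
  assumes "residual cap R" "a < A + A" "0 < R a"
  shows "residual cap (pushed a R)"
  unfolding residual_def
proof (intro allI impI)
  fix b assume b: "b < A"
  have *: "R b + R (A + b) = cap b" using assms(1) b by (simp add: residual_def)
  have eq: "partner a = b \<longleftrightarrow> a = A + b" "partner a = A + b \<longleftrightarrow> a = b"
    using b assms(2) by (auto simp: partner_def)
  consider "a = b" "partner a = A + b" | "a = A + b" "partner a = b"
    | "a \<noteq> b" "a \<noteq> A + b" "partner a \<noteq> b" "partner a \<noteq> A + b"
    using eq by blast
  then show "pushed a R b + pushed a R (A + b) = cap b"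
    using * assms(3) b by cases (simp_all add: pushed_def)
qed

text \<open>A push on a reverse arc \<open>A + b\<close> removes a unit from \<open>b\<close>, but
  its ends are those of \<open>b\<close> swapped; the two signs cancel and both kinds of arcs obey
  one formula.\<close>

lemma net_pushed:
  assumes "a < A + A" "0 < R a"
  shows "net (flow_of (pushed a R)) v = net (flow_of R) v + of_bool (U a = v) - of_bool (V a = v)"
proof -
  define s :: "nat \<Rightarrow> int" where "s b = of_bool (U b = v) - of_bool (V b = v)" for b
  have net: "net F v = (\<Sum>b<A. int (F b) * s b)" for F by (simp add: net_def s_def)
  obtain b where b: "b < A" "a = b \<or> a = A + b"
    using arc_cases[OF assms(1)] by metis
  have "int (flow_of (pushed a R) c) * s c =
      int (flow_of R c) * s c + (if c = b then (if a = b then 1 else -1) * s c else 0)" if "c < A" for c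
    using b that assms(2) by (auto simp: pushed_def partner_def of_nat_diff algebra_simps)
  then have "net (flow_of (pushed a R)) v =
      (\<Sum>c<A. int (flow_of R c) * s c + (if c = b then (if a = b then 1 else -1) * s c else 0))"
    unfolding net by (intro sum.cong) auto
  also have "\<dots> = net (flow_of R) v + (if a = b then 1 else -1) * s b"
    using b(1) by (simp add: sum.distrib net)
  finally show ?thesis using b rev by (auto simp: s_def)
qed

text \<open>The only arc that can gain residual capacity is \<open>partner a\<close>, and it has
  reduced cost 0 because \<open>a\<close> is tight.\<close>

lemma feasible_pushed:
  assumes "feasible R \<pi>" "a < A + A" "\<pi> (V a) = \<pi> (U a) + C a"
  shows "feasible (pushed a R) \<pi>"
  unfolding feasible_def
proof (intro conjI allI impI)
  fix b assume b: "b < A + A" "0 < pushed a R b"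
  show "\<pi> (V b) \<le> \<pi> (U b) + C b"
  proof (cases "b = partner a")
    case True
    then show ?thesis using partner[OF assms(2)] assms(3) by simp
  next
    case False
    then have "0 < R b" using b(2) by (auto simp: pushed_def split: if_splits)
    then show ?thesis using assms(1) b(1) by (simp add: feasible_def)
  qed
next
  show "\<pi> snk \<le> \<pi> src" using assms(1) by (simp add: feasible_def)
qed

definition raised :: "nat set \<Rightarrow> real \<Rightarrow> (nat \<Rightarrow> real) \<Rightarrow> nat \<Rightarrow> real" where
  "raised X \<delta> \<pi> v = (if v \<in> X then \<pi> v else \<pi> v + \<delta>)"

text \<open>Arcs with both ends on the same side of \<open>X\<close> keep their reduced costs and
  arcs into \<open>X\<close> gain slack. Only arcs out of \<open>X\<close>, and the comparison of
  source and sink, lose \<open>\<delta>\<close>.\<close>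

lemma feasible_raised:
  assumes "feasible R \<pi>" "src \<in> X" "snk \<notin> X" "0 \<le> \<delta>" "\<delta> \<le> \<pi> src - \<pi> snk"
    and "\<And>a. a < A + A \<Longrightarrow> 0 < R a \<Longrightarrow> U a \<in> X \<Longrightarrow> V a \<notin> X \<Longrightarrow> \<delta> \<le> \<pi> (U a) + C a - \<pi> (V a)"
  shows "feasible R (raised X \<delta> \<pi>)"
  unfolding feasible_def
proof (intro conjI allI impI)
  fix a assume a: "a < A + A" "0 < R a"
  have "\<pi> (V a) \<le> \<pi> (U a) + C a" using assms(1) a by (simp add: feasible_def)
  then show "raised X \<delta> \<pi> (V a) \<le> raised X \<delta> \<pi> (U a) + C a"
    using assms(4) assms(6)[OF a] by (auto simp: raised_def)
next
  show "raised X \<delta> \<pi> snk \<le> raised X \<delta> \<pi> src"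
    using assms(2,3,5) by (simp add: raised_def)
qed

text \<open>This choice of \<open>\<delta>\<close> makes \<open>a\<close> tight, and the old tree
  arcs stay tight since both their ends lie in \<open>X\<close>. All ranks in \<open>X\<close> are
  below \<open>card X\<close>, which is therefore a valid rank for the new node.\<close>

lemma tight_tree_insert:
  assumes "tight_tree R \<pi> par X rk" "a < A + A" "0 < R a" "U a \<in> X" "V a \<notin> X"
    and "\<delta> = \<pi> (U a) + C a - \<pi> (V a)"
  shows "tight_tree R (raised X \<delta> \<pi>) (par(V a := a)) (insert (V a) X) (rk(V a := card X))"
proof -
  have "finite X" using assms(1) finite_subset by (auto simp: tight_tree_def)
  then have card: "card (insert (V a) X) = Suc (card X)" using assms(5) by simp
  show ?thesis
    using assms nodes2[OF assms(2)] unfolding tight_tree_def card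
    by (auto simp: raised_def less_Suc_eq dest: bspec)
qed

lemma tight_tree_start: "tight_tree R \<pi> par {src} (\<lambda>_. 0)"
  using nodes by (simp add: tight_tree_def)

text \<open>Complementary slackness. On each arc, the difference of the two flows is positive only
  if the arc has residual capacity and negative only if its reverse has, so reduced cost times
  difference is nonnegative. In the sum, the potentials contribute nothing.\<close>

lemma feasible_optimal:
  assumes "residual cap R" "is_flow cap (flow_of R)" "feasible R \<pi>" "\<pi> src = \<pi> snk"
    and "is_flow cap F"
  shows "(\<Sum>a<A. C a * real (R (A + a))) \<le> (\<Sum>a<A. C a * real (F a))"
proof -
  define D where "D a = real (F a) - real (R (A + a))" for a
  \<comment> \<open>This shift makes \<open>p\<close> vanish at the source and, by the equality of
    potentials, at the sink as well. Hence the values of the two flows do not enter.\<close>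
  define p where "p v = \<pi> v - \<pi> src" for v
  have pos: "0 \<le> (C a + p (U a) - p (V a)) * D a" if a: "a < A" for a
  proof -
    have red: "0 < R b \<Longrightarrow> 0 \<le> C b + p (U b) - p (V b)" if "b < A + A" for b
      using assms(3) that by (fastforce simp: feasible_def p_def)
    have cap: "F a \<le> cap a" "R a + R (A + a) = cap a"
      using assms(1,5) a by (auto simp: is_flow_def residual_def)
    consider "D a = 0" | "0 < D a" | "D a < 0" by linarith
    then show ?thesis
    proof cases
      case 2
      then have "0 < R a" using cap by (simp add: D_def)
      then show ?thesis using red[of a] a 2 by simp
    next
      case 3
      then have "0 < R (A + a)" by (simp add: D_def)
      then have "C a + p (U a) - p (V a) \<le> 0" using red[of "A + a"] a rev by simp
      then show ?thesis using 3 by (simp add: mult_nonpos_nonpos)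
    qed simp
  qed
  \<comment> \<open>Summation by parts: collected by nodes, the sum weighs the net outflow of
    \<open>v\<close> with \<open>p v\<close>, and at every node one of the two is 0.\<close>
  have potential: "(\<Sum>a<A. (p (U a) - p (V a)) * real (G a)) = 0" if G: "is_flow cap G" for G
  proof -
    have eq: "(p (U a) - p (V a)) * real (G a) =
        (\<Sum>v<N. p v * (real (G a) * (of_bool (U a = v) - of_bool (V a = v))))" if "a < A" for a
    proof -
      have pick: "(\<Sum>v<N. p v * (real (G a) * of_bool (x = v))) = p x * real (G a)" if "x < N" for x
      proof -
        have "(\<Sum>v<N. p v * (real (G a) * of_bool (x = v))) =
            (\<Sum>v<N. if x = v then p v * real (G a) else 0)"
          by (intro sum.cong) auto
        then show ?thesis using that by simp
      qed
      show ?thesis using pick[of "U a"] pick[of "V a"] nodes that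
        by (simp add: right_diff_distrib left_diff_distrib sum_subtractf)
    qed
    have "(\<Sum>a<A. (p (U a) - p (V a)) * real (G a)) =
        (\<Sum>v<N. \<Sum>a<A. p v * (real (G a) * (of_bool (U a = v) - of_bool (V a = v))))"
      by (subst sum.swap) (simp add: eq)
    also have "\<dots> = (\<Sum>v<N. p v * of_int (net G v))"
      by (simp add: net_def sum_distrib_left)
    also have "\<dots> = 0"
    proof (intro sum.neutral ballI)
      fix v
      show "p v * of_int (net G v) = 0"
        using G assms(4) by (cases "v = src \<or> v = snk") (auto simp: p_def is_flow_def)
    qed
    finally show ?thesis .
  qed
  have "0 \<le> (\<Sum>a<A. (C a + p (U a) - p (V a)) * D a)"
    using pos by (intro sum_nonneg) simp
  also have "\<dots> = (\<Sum>a<A. C a * real (F a)) - (\<Sum>a<A. C a * real (R (A + a)))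
      + ((\<Sum>a<A. (p (U a) - p (V a)) * real (F a)) -
         (\<Sum>a<A. (p (U a) - p (V a)) * real (R (A + a))))"
    unfolding D_def sum_subtractf[symmetric] sum.distrib[symmetric]
    by (intro sum.cong) (simp_all add: algebra_simps)
  finally show ?thesis using potential[OF assms(5)] potential[OF assms(2)] by simp
qed

text \<open>Each augmentation raises the net outflow of the source, so this bounds their number.\<close>
lemma net_src_bound:
  assumes "residual cap R"
  shows "net (flow_of R) src \<le> int (\<Sum>a<A. if U a = src then cap a else 0)"
  unfolding net_def of_nat_sum
proof (intro sum_mono)
  fix a assume "a \<in> {..<A}"
  then have "R (A + a) \<le> cap a" using assms by (fastforce simp: residual_def)
  then show "int (R (A + a)) * (of_bool (U a = src) - of_bool (V a = src))
      \<le> int (if U a = src then cap a else 0)" by auto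
qed

end

section \<open>A primal-dual program for minimum cost flows\<close>

abbreviation "rvar a \<equiv> RCell a (NConst 0)"
abbreviation "setr a x \<equiv> RStore a (NConst 0) x"

text \<open>Natural arrays: 5, 6 tail and head of an arc, 7 residual capacity, 8 reached nodes, 9 parent
  arcs; natural variables: 12 \<open>A\<close>, 13 \<open>N\<close>, 14 source, 15 sink, 16 loop counter, 17 best arc,
  18 termination flag, 19--21 current node, arc and partner arc of an augmentation. Real arrays:
  1 costs, 2 potentials, 3 (a variable) the amount \<open>\<delta>\<close>. Best arc \<open>A + A\<close> stands for a virtual
  arc of cost 0 from source to sink, whose use means that no augmentation is profitable.\<close>

definition reduced_cost :: "nexp \<Rightarrow> rexp" where
  "reduced_cost a = RSub (RAdd (RCell 2 (NCell 5 a)) (RCell 1 a)) (RCell 2 (NCell 6 a))"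

text \<open>The virtual arc is the first candidate, so the minimum always exists, and an arc of the
  network replaces it only if it is strictly cheaper.\<close>

definition scan :: com where
  "scan = Seq (setv 17 (NAdd (var 12) (var 12)))
     (Seq (setr 3 (RSub (RCell 2 (var 14)) (RCell 2 (var 15))))
     (For 16 (NAdd (var 12) (var 12))
       (Cond (BAnd (NLess (NConst 0) (NCell 7 (var 16)))
               (BAnd (NLess (NConst 0) (NCell 8 (NCell 5 (var 16))))
               (BAnd (BNot (NLess (NConst 0) (NCell 8 (NCell 6 (var 16)))))
                 (RLess (reduced_cost (var 16)) (rvar 3)))))
         (Seq (setv 17 (var 16)) (setr 3 (reduced_cost (var 16))))
         Skip)))"

definition raise :: com where
  "raise = For 16 (var 13)
     (Cond (NLess (NConst 0) (NCell 8 (var 16))) Skip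
       (RStore 2 (var 16) (RAdd (RCell 2 (var 16)) (rvar 3))))"

text \<open>If the virtual arc is best, the sink is marked although no arc reaches it. The mark
  stops the loop in \<open>phase\<close>, and flag 18 then prevents an augmentation.\<close>

definition grow :: com where
  "grow = Seq scan (Seq raise
     (Cond (NLess (var 17) (NAdd (var 12) (var 12)))
       (Seq (NStore 9 (NCell 6 (var 17)) (var 17)) (NStore 8 (NCell 6 (var 17)) (NConst 1)))
       (Seq (setv 18 (NConst 1)) (NStore 8 (var 15) (NConst 1)))))"

text \<open>One unit is sent per path and no bottleneck is computed, as the capacity at the source
  already limits the number of paths. The loop test says that the current node is not the source, in
  a language whose only comparison is \<open><\<close>.\<close>

definition augment :: com where
  "augment = Seq (setv 19 (var 15))
     (While (BNot (BAnd (BNot (NLess (var 19) (var 14))) (BNot (NLess (var 14) (var 19)))))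
       (Seq (setv 20 (NCell 9 (var 19)))
       (Seq (Cond (NLess (var 20) (var 12)) (setv 21 (NAdd (var 20) (var 12)))
               (setv 21 (NSub (var 20) (var 12))))
       (Seq (NStore 7 (var 20) (NSub (NCell 7 (var 20)) (NConst 1)))
       (Seq (NStore 7 (var 21) (NAdd (NCell 7 (var 21)) (NConst 1)))
         (setv 19 (NCell 5 (var 20))))))))"

definition phase :: com where
  "phase = Seq (For 16 (var 13) (NStore 8 (var 16) (NConst 0)))
     (Seq (NStore 8 (var 14) (NConst 1))
     (Seq (While (NLess (NCell 8 (var 15)) (NConst 1)) grow)
     (Cond (NLess (NConst 0) (var 18)) Skip augment)))"

definition solver :: com where
  "solver = While (NLess (var 18) (NConst 1)) phase"

lemma writes_solver [simp]:
  "nwrites scan = {16, 17}" "rwrites scan = {3}"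
  "nwrites raise = {16}" "rwrites raise = {2}"
  "nwrites grow = {8, 9, 16, 17, 18}" "rwrites grow = {2, 3}"
  "nwrites augment = {7, 19, 20, 21}" "rwrites augment = {}"
  "nwrites phase = {7, 8, 9, 16, 17, 18, 19, 20, 21}" "rwrites phase = {2, 3}"
  "nwrites solver = {7, 8, 9, 16, 17, 18, 19, 20, 21}" "rwrites solver = {2, 3}"
  by (auto simp: scan_def raise_def grow_def augment_def phase_def solver_def)

section \<open>Correctness of the primal-dual program\<close>

context residual_network
begin

definition stored :: "memory \<Rightarrow> bool" where
  "stored \<sigma> \<longleftrightarrow> nat_arr \<sigma> 5 = U \<and> nat_arr \<sigma> 6 = V \<and> real_arr \<sigma> 1 = C \<and> nat_arr \<sigma> 12 0 = A \<and>
     nat_arr \<sigma> 13 0 = N \<and> nat_arr \<sigma> 14 0 = src \<and> nat_arr \<sigma> 15 0 = snk"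

definition reached :: "memory \<Rightarrow> nat set" where
  "reached \<sigma> = {v. v < N \<and> 0 < nat_arr \<sigma> 8 v}"

definition crossing :: "(nat \<Rightarrow> nat) \<Rightarrow> nat set \<Rightarrow> nat \<Rightarrow> bool" where
  "crossing R X a \<longleftrightarrow> 0 < R a \<and> U a \<in> X \<and> V a \<notin> X"

text \<open>The postcondition is arbitrary and only has to follow from the effect of the stage;
  rules of this form compose along \<open>Seq\<close> with no weakening in between.\<close>

lemma wp_scan:
  assumes st: "stored \<sigma>" and B: "A + A \<le> B"
    and R: "R = nat_arr \<sigma> 7" and \<pi>: "\<pi> = real_arr \<sigma> 2" and X: "X = reached \<sigma>"
    and Q: "\<And>\<tau> \<delta> b. eqoff {16, 17} {3} \<sigma> \<tau> \<Longrightarrow> nat_arr \<tau> 17 0 = b \<Longrightarrow> real_arr \<tau> 3 0 = \<delta> \<Longrightarrow>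
      b = A + A \<and> \<delta> = \<pi> src - \<pi> snk \<or>
        b < A + A \<and> crossing R X b \<and> \<delta> = \<pi> (U b) + C b - \<pi> (V b) \<Longrightarrow>
      \<delta> \<le> \<pi> src - \<pi> snk \<Longrightarrow>
      (\<And>a. a < A + A \<Longrightarrow> crossing R X a \<Longrightarrow> \<delta> \<le> \<pi> (U a) + C a - \<pi> (V a)) \<Longrightarrow> Q \<tau>"
  shows "wp B scan Q \<sigma>"
proof -
  define I where "I j \<tau> \<longleftrightarrow>
    (nat_arr \<tau> 17 0 = A + A \<and> real_arr \<tau> 3 0 = \<pi> src - \<pi> snk \<or>
      nat_arr \<tau> 17 0 < A + A \<and> crossing R X (nat_arr \<tau> 17 0) \<and>
      real_arr \<tau> 3 0 = \<pi> (U (nat_arr \<tau> 17 0)) + C (nat_arr \<tau> 17 0) - \<pi> (V (nat_arr \<tau> 17 0))) \<and>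
    real_arr \<tau> 3 0 \<le> \<pi> src - \<pi> snk \<and>
    (\<forall>a<j. crossing R X a \<longrightarrow> real_arr \<tau> 3 0 \<le> \<pi> (U a) + C a - \<pi> (V a))" for j and \<tau> :: memory
  define \<sigma>1 where "\<sigma>1 = rset 3 0 (\<pi> src - \<pi> snk) (nset 17 0 (A + A) \<sigma>)"
  have \<sigma>1: "eqoff {16, 17} {3} \<sigma> \<sigma>1" by (simp add: \<sigma>1_def eqoff_def)
  note st' = st[unfolded stored_def]
  have "wp B (For 16 (NAdd (var 12) (var 12))
       (Cond (BAnd (NLess (NConst 0) (NCell 7 (var 16)))
               (BAnd (NLess (NConst 0) (NCell 8 (NCell 5 (var 16))))
               (BAnd (BNot (NLess (NConst 0) (NCell 8 (NCell 6 (var 16)))))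
                 (RLess (reduced_cost (var 16)) (rvar 3)))))
         (Seq (setv 17 (var 16)) (setr 3 (reduced_cost (var 16))))
         Skip)) Q \<sigma>1"
  proof (rule wp_For[where X = "{16, 17}" and Y = "{3}" and N = "A + A" and I = I])
    show "I 0 (nset 16 0 0 \<sigma>1)" by (simp add: I_def \<sigma>1_def)
  next
    fix j \<tau> assume j: "j < A + A" "I j \<tau>" "nat_arr \<tau> 16 0 = j" "eqoff {16, 17} {3} \<sigma>1 \<tau>"
    have eq: "nat_arr \<tau> 5 = U" "nat_arr \<tau> 6 = V" "nat_arr \<tau> 7 = R" "nat_arr \<tau> 8 = nat_arr \<sigma> 8"
      "real_arr \<tau> 1 = C" "real_arr \<tau> 2 = \<pi>"
      using eqoff_trans[OF \<sigma>1 j(4)] st' R \<pi> by (simp_all add: eqoff_def)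
    have cr: "crossing R X j \<longleftrightarrow> 0 < R j \<and> 0 < nat_arr \<sigma> 8 (U j) \<and> \<not> 0 < nat_arr \<sigma> 8 (V j)"
      using nodes2[OF j(1)] by (auto simp: crossing_def X reached_def)
    show "wp B (Cond (BAnd (NLess (NConst 0) (NCell 7 (var 16)))
               (BAnd (NLess (NConst 0) (NCell 8 (NCell 5 (var 16))))
               (BAnd (BNot (NLess (NConst 0) (NCell 8 (NCell 6 (var 16)))))
                 (RLess (reduced_cost (var 16)) (rvar 3)))))
         (Seq (setv 17 (var 16)) (setr 3 (reduced_cost (var 16))))
         Skip) (\<lambda>\<tau>. I (Suc j) (nset 16 0 (Suc j) \<tau>)) \<tau>"
    proof (cases "crossing R X j \<and> \<pi> (U j) + C j - \<pi> (V j) < real_arr \<tau> 3 0")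
      case True
      then have "I (Suc j) (nset 16 0 (Suc j) (rset 3 0 (\<pi> (U j) + C j - \<pi> (V j)) (nset 17 0 j \<tau>)))"
        using j(1,2) by (fastforce simp: I_def less_Suc_eq)
      then show ?thesis using True cr by (simp add: eq eq(5)[unfolded One_nat_def] j(3) reduced_cost_def)
    next
      case False
      then have "I (Suc j) (nset 16 0 (Suc j) \<tau>)"
        using j(2) by (auto simp: I_def less_Suc_eq)
      then show ?thesis using False cr
        by (auto simp: eq eq(5)[unfolded One_nat_def] j(3) reduced_cost_def)
    qed
  next
    fix \<tau> assume *: "I (A + A) \<tau>" "eqoff {16, 17} {3} \<sigma>1 \<tau>"
    show "Q \<tau>"
      by (rule Q[OF eqoff_trans[OF \<sigma>1 *(2)] refl refl]) (use *(1) in \<open>auto simp: I_def\<close>)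
  next
    fix \<tau> assume "eqoff {16, 17} {3} \<sigma>1 \<tau>"
    from eqoff_trans[OF \<sigma>1 this] show "nval (NAdd (var 12) (var 12)) \<tau> = A + A"
      using st' by (simp add: eqoff_def)
  qed (use B in simp_all)
  then show ?thesis
    using st' by (simp add: scan_def \<sigma>1_def \<pi>)
qed

lemma wp_raise:
  assumes st: "stored \<sigma>" and B: "N \<le> B"
    and Q: "\<And>\<tau>. eqoff {16} {2} \<sigma> \<tau> \<Longrightarrow>
      (\<And>v. v < N \<Longrightarrow> real_arr \<tau> 2 v = raised (reached \<sigma>) (real_arr \<sigma> 3 0) (real_arr \<sigma> 2) v) \<Longrightarrow> Q \<tau>"
  shows "wp B raise Q \<sigma>"
  unfolding raise_def
proof (rule wp_For[where X = "{16}" and Y = "{2}" and N = N and I = "\<lambda>j \<tau>.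
    (\<forall>v. real_arr \<tau> 2 v =
      (if v < j then raised (reached \<sigma>) (real_arr \<sigma> 3 0) (real_arr \<sigma> 2) v else real_arr \<sigma> 2 v))"])
  fix j \<tau> assume j: "j < N" "nat_arr \<tau> 16 0 = j" "eqoff {16} {2} \<sigma> \<tau>"
    and I: "\<forall>v. real_arr \<tau> 2 v =
      (if v < j then raised (reached \<sigma>) (real_arr \<sigma> 3 0) (real_arr \<sigma> 2) v else real_arr \<sigma> 2 v)"
  have eq: "nat_arr \<tau> 8 = nat_arr \<sigma> 8" "real_arr \<tau> 3 = real_arr \<sigma> 3"
    using j(3) by (simp_all add: eqoff_def)
  show "wp B (Cond (NLess (NConst 0) (NCell 8 (var 16))) Skip
       (RStore 2 (var 16) (RAdd (RCell 2 (var 16)) (rvar 3))))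
     (\<lambda>\<tau>. \<forall>v. real_arr (nset 16 0 (Suc j) \<tau>) 2 v =
      (if v < Suc j then raised (reached \<sigma>) (real_arr \<sigma> 3 0) (real_arr \<sigma> 2) v
       else real_arr \<sigma> 2 v)) \<tau>"
    using I j(1) by (auto simp: j(2) eq raised_def reached_def less_Suc_eq)
qed (use st B in \<open>auto simp: stored_def eqoff_def intro!: Q\<close>)

lemma wp_grow:
  assumes st: "stored \<sigma>" and B: "N \<le> B" "A + A \<le> B"
    and R: "R = nat_arr \<sigma> 7"
    and feas: "feasible R (real_arr \<sigma> 2)"
    and tree: "tight_tree R (real_arr \<sigma> 2) (nat_arr \<sigma> 9) (reached \<sigma>) rk"
    and snk: "snk \<notin> reached \<sigma>"
    and Q: "\<And>\<tau>. eqoff {8, 9, 16, 17, 18} {2, 3} \<sigma> \<tau> \<Longrightarrow> feasible R (real_arr \<tau> 2) \<Longrightarrow>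
      card (reached \<sigma>) < card (reached \<tau>) \<Longrightarrow>
      0 < nat_arr \<tau> 18 0 \<and> real_arr \<tau> 2 src = real_arr \<tau> 2 snk \<and> snk \<in> reached \<tau> \<or>
        nat_arr \<tau> 18 0 = nat_arr \<sigma> 18 0 \<and>
        (\<exists>rk. tight_tree R (real_arr \<tau> 2) (nat_arr \<tau> 9) (reached \<tau>) rk) \<Longrightarrow> Q \<tau>"
  shows "wp B grow Q \<sigma>"
proof -
  define X where "X = reached \<sigma>"
  define \<pi> where "\<pi> = real_arr \<sigma> 2"
  define rest where "rest = Cond (NLess (var 17) (NAdd (var 12) (var 12)))
       (Seq (NStore 9 (NCell 6 (var 17)) (var 17)) (NStore 8 (NCell 6 (var 17)) (NConst 1)))
       (Seq (setv 18 (NConst 1)) (NStore 8 (var 15) (NConst 1)))"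
  note st' = st[unfolded stored_def]
  have src: "src \<in> X" and fin: "finite X"
    using tree finite_subset[of X "{..<N}"] by (auto simp: tight_tree_def X_def)
  have "wp B scan (wp B (Seq raise rest) Q) \<sigma>"
  proof (rule wp_scan[OF st B(2) R \<pi>_def X_def])
    fix \<sigma>1 \<delta> b
    assume 1: "eqoff {16, 17} {3} \<sigma> \<sigma>1" and b: "nat_arr \<sigma>1 17 0 = b" and \<delta>: "real_arr \<sigma>1 3 0 = \<delta>"
      and best: "b = A + A \<and> \<delta> = \<pi> src - \<pi> snk \<or>
        b < A + A \<and> crossing R X b \<and> \<delta> = \<pi> (U b) + C b - \<pi> (V b)"
      and le: "\<delta> \<le> \<pi> src - \<pi> snk"
      and min: "\<And>a. a < A + A \<Longrightarrow> crossing R X a \<Longrightarrow> \<delta> \<le> \<pi> (U a) + C a - \<pi> (V a)"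
    have \<sigma>1: "stored \<sigma>1" "reached \<sigma>1 = X" "real_arr \<sigma>1 2 = \<pi>"
      using 1 st' by (simp_all add: stored_def eqoff_def reached_def X_def \<pi>_def)
    \<comment> \<open>By feasibility every candidate has nonnegative slack, the virtual arc
      included.\<close>
    have "0 \<le> \<delta>" using best feas by (auto simp: feasible_def crossing_def \<pi>_def)
    then have feas': "feasible R (raised X \<delta> \<pi>)"
      using feas snk src le min
      by (intro feasible_raised) (auto simp: X_def \<pi>_def crossing_def)
    have "wp B raise (wp B rest Q) \<sigma>1"
    proof (rule wp_raise[OF \<sigma>1(1) B(1)])
      fix \<sigma>2 assume 2: "eqoff {16} {2} \<sigma>1 \<sigma>2"
        and "\<And>v. v < N \<Longrightarrow>
          real_arr \<sigma>2 2 v = raised (reached \<sigma>1) (real_arr \<sigma>1 3 0) (real_arr \<sigma>1 2) v"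
      then have \<pi>2: "real_arr \<sigma>2 2 v = raised X \<delta> \<pi> v" if "v < N" for v
        using that \<sigma>1 \<delta> by simp
      have off: "eqoff {16, 17} {2, 3} \<sigma> \<sigma>2"
        using eqoff_trans[OF eqoff_mono[OF 1] eqoff_mono[OF 2]] by simp
      have eq: "nat_arr \<sigma>2 17 0 = b" "nat_arr \<sigma>2 12 0 = A" "nat_arr \<sigma>2 15 0 = snk" "nat_arr \<sigma>2 6 = V"
        "nat_arr \<sigma>2 8 = nat_arr \<sigma> 8" "nat_arr \<sigma>2 9 = nat_arr \<sigma> 9"
        using off 2 b st' by (simp_all add: eqoff_def)
      have feas2: "feasible R (real_arr \<sigma>2 2)"
        using feas' feasible_cong[of "real_arr \<sigma>2 2" "raised X \<delta> \<pi>" R] \<pi>2 by blast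
      show "wp B rest Q \<sigma>2"
      proof (cases "b < A + A")
        case True
        then have cross: "crossing R X b" and \<delta>': "\<delta> = \<pi> (U b) + C b - \<pi> (V b)" using best by auto
        define \<tau> where "\<tau> = nset 8 (V b) 1 (nset 9 (V b) b \<sigma>2)"
        have X': "reached \<tau> = insert (V b) X"
          using nodes2[OF True] by (auto simp: \<tau>_def reached_def X_def eq)
        have "tight_tree R (raised X \<delta> \<pi>) ((nat_arr \<sigma> 9)(V b := b)) (insert (V b) X) (rk(V b := card X))"
          by (rule tight_tree_insert)
            (use tree cross \<delta>' True in \<open>auto simp: X_def \<pi>_def crossing_def\<close>)
        then have "tight_tree R (real_arr \<tau> 2) (nat_arr \<tau> 9) (reached \<tau>) (rk(V b := card X))"
          using tight_tree_cong[of "real_arr \<sigma>2 2" "raised X \<delta> \<pi>"] \<pi>2 X' by (simp add: \<tau>_def eq)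
        moreover have "card X < card (reached \<tau>)"
          using cross fin by (simp add: X' crossing_def)
        moreover have "eqoff {8, 9, 16, 17, 18} {2, 3} \<sigma> \<tau>"
          using off by (auto simp: eqoff_def \<tau>_def)
        moreover have "nat_arr \<tau> 18 0 = nat_arr \<sigma> 18 0"
          using off by (auto simp: eqoff_def \<tau>_def)
        ultimately have "Q \<tau>" using feas2 by (intro Q) (auto simp: \<tau>_def X_def)
        then show ?thesis using True by (simp add: rest_def eq \<tau>_def)
      next
        case False
        then have \<delta>': "\<delta> = \<pi> src - \<pi> snk" using best by auto
        define \<tau> where "\<tau> = nset 8 snk 1 (nset 18 0 1 \<sigma>2)"
        have X': "reached \<tau> = insert snk X"
          using nodes by (auto simp: \<tau>_def reached_def X_def eq)
        have "card X < card (reached \<tau>)"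
          using snk fin by (simp add: X' X_def)
        moreover have "real_arr \<tau> 2 src = real_arr \<tau> 2 snk"
          using \<pi>2 nodes src snk \<delta>' by (simp add: \<tau>_def raised_def X_def)
        moreover have "eqoff {8, 9, 16, 17, 18} {2, 3} \<sigma> \<tau>"
          using off by (auto simp: eqoff_def \<tau>_def)
        ultimately have "Q \<tau>" using feas2 nodes by (intro Q) (auto simp: \<tau>_def X' X_def reached_def)
        then show ?thesis using False by (simp add: rest_def eq \<tau>_def)
      qed
    qed
    then show "wp B (Seq raise rest) Q \<sigma>1" by simp
  qed
  then show ?thesis by (simp add: grow_def rest_def)
qed

lemma wp_augment:
  assumes st: "stored \<sigma>" and B: "N \<le> B"
    and R: "R = nat_arr \<sigma> 7" and \<pi>: "\<pi> = real_arr \<sigma> 2"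
    and res: "residual cap R" and feas: "feasible R \<pi>"
    and tree: "tight_tree R \<pi> (nat_arr \<sigma> 9) X rk"
    and snk: "snk \<in> X"
    and Q: "\<And>\<tau> R'. eqoff {7, 19, 20, 21} {} \<sigma> \<tau> \<Longrightarrow> R' = nat_arr \<tau> 7 \<Longrightarrow> residual cap R' \<Longrightarrow>
      feasible R' \<pi> \<Longrightarrow>
      (\<And>v. net (flow_of R') v = net (flow_of R) v + of_bool (v = src) - of_bool (v = snk)) \<Longrightarrow> Q \<tau>"
  shows "wp B augment Q \<sigma>"
proof -
  define par where "par = nat_arr \<sigma> 9"
  note st' = st[unfolded stored_def]
  have tr: "par v < A + A" "V (par v) = v" "U (par v) \<in> X"
    "rk (U (par v)) < rk v" "\<pi> v = \<pi> (U (par v)) + C (par v)" "0 < R (par v)"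
    if "v \<in> X" "v \<noteq> src" for v
    using tree that by (auto simp: tight_tree_def par_def)
  \<comment> \<open>The path from the current node \<open>v\<close> to the sink has been served, so
    \<open>v\<close> sends out one unit more than it has received. The tree arcs into nodes of rank
    at most \<open>rk v\<close> still have residual capacity, which keeps the rest of the path
    usable.\<close>
  define I where "I \<tau> \<longleftrightarrow> (let v = nat_arr \<tau> 19 0; R' = nat_arr \<tau> 7 in
    eqoff {7, 19, 20, 21} {} \<sigma> \<tau> \<and> v \<in> X \<and> residual cap R' \<and> feasible R' \<pi> \<and>
    (\<forall>u. net (flow_of R') u = net (flow_of R) u + of_bool (v = u) - of_bool (snk = u)) \<and>
    (\<forall>u\<in>X. u \<noteq> src \<longrightarrow> rk u \<le> rk v \<longrightarrow> 0 < R' (par u)))" for \<tau> :: memory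
  have "wp B (While (BNot (BAnd (BNot (NLess (var 19) (var 14))) (BNot (NLess (var 14) (var 19)))))
       (Seq (setv 20 (NCell 9 (var 19)))
       (Seq (Cond (NLess (var 20) (var 12)) (setv 21 (NAdd (var 20) (var 12)))
               (setv 21 (NSub (var 20) (var 12))))
       (Seq (NStore 7 (var 20) (NSub (NCell 7 (var 20)) (NConst 1)))
       (Seq (NStore 7 (var 21) (NAdd (NCell 7 (var 21)) (NConst 1)))
         (setv 19 (NCell 5 (var 20)))))))) Q (nset 19 0 snk \<sigma>)"
  proof (rule wp_While_inv[where I = I and \<mu> = "\<lambda>\<tau>. rk (nat_arr \<tau> 19 0)"])
    show "I (nset 19 0 snk \<sigma>)"
      using snk res feas tr by (simp add: I_def Let_def eqoff_def R)
    have "rk snk < card X" using tree snk by (auto simp: tight_tree_def)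
    also have "\<dots> \<le> N" using tree card_mono[of "{..<N}" X] by (auto simp: tight_tree_def)
    finally show "rk (nat_arr (nset 19 0 snk \<sigma>) 19 0) \<le> B" using B by simp
  next
    fix \<tau> assume I: "I \<tau>"
      and b: "bval (BNot (BAnd (BNot (NLess (var 19) (var 14))) (BNot (NLess (var 14) (var 19))))) \<tau>"
    define v where "v = nat_arr \<tau> 19 0"
    define R' where "R' = nat_arr \<tau> 7"
    define a where "a = par v"
    from I have off: "eqoff {7, 19, 20, 21} {} \<sigma> \<tau>" and v: "v \<in> X" and res': "residual cap R'"
      and feas': "feasible R' \<pi>"
      and net': "\<And>u. net (flow_of R') u = net (flow_of R) u + of_bool (v = u) - of_bool (snk = u)"
      and pos: "\<And>u. u \<in> X \<Longrightarrow> u \<noteq> src \<Longrightarrow> rk u \<le> rk v \<Longrightarrow> 0 < R' (par u)"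
      by (auto simp: I_def Let_def v_def R'_def)
    have eq: "nat_arr \<tau> 9 = par" "nat_arr \<tau> 5 = U" "nat_arr \<tau> 12 0 = A" "nat_arr \<tau> 14 0 = src"
      using off st' by (simp_all add: eqoff_def par_def)
    have v_src: "v \<noteq> src" using b by (auto simp: eq v_def)
    note a = tr[OF v v_src, folded a_def]
    have Ra: "0 < R' a" using pos[OF v v_src] by (simp add: a_def)
    define \<tau>' where "\<tau>' = nset 19 0 (U a) (nset 7 (partner a) (R' (partner a) + 1)
      (nset 7 a (R' a - 1) (nset 21 0 (partner a) (nset 20 0 a \<tau>))))"
    have \<tau>': "nat_arr \<tau>' 19 0 = U a" "nat_arr \<tau>' 7 = pushed a R'"
      by (simp_all add: \<tau>'_def pushed_def R'_def)
    have "I \<tau>'"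
      unfolding I_def Let_def \<tau>'
    proof (intro conjI allI ballI impI)
      show "eqoff {7, 19, 20, 21} {} \<sigma> \<tau>'" using off by (auto simp: \<tau>'_def eqoff_def)
      show "U a \<in> X" by (rule a)
      show "residual cap (pushed a R')" using res' a(1) Ra by (rule residual_pushed)
      show "feasible (pushed a R') \<pi>" using feas' a by (intro feasible_pushed) simp_all
      fix u
      show "net (flow_of (pushed a R')) u =
          net (flow_of R) u + of_bool (U a = u) - of_bool (snk = u)"
        using net_pushed[of a R' u] a(1,2) Ra net' by simp
      assume u: "u \<in> X" "u \<noteq> src" "rk u \<le> rk (U a)"
      then have "u \<noteq> v" "rk u \<le> rk v" using a(4) by auto
      \<comment> \<open>\<open>par u\<close> ends in \<open>u\<close> and \<open>a\<close> ends in
        \<open>v\<close>, so the arc that has just lost capacity is not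
        \<open>par u\<close>.\<close>
      then have "par u \<noteq> a" "0 < R' (par u)" using tr(2)[OF u(1,2)] a(2) pos u by auto
      then show "0 < pushed a R' (par u)" by (simp add: pushed_def)
    qed
    moreover have "rk (nat_arr \<tau>' 19 0) < rk v" using a(4) by (simp add: \<tau>')
    ultimately show "wp B (Seq (setv 20 (NCell 9 (var 19)))
       (Seq (Cond (NLess (var 20) (var 12)) (setv 21 (NAdd (var 20) (var 12)))
               (setv 21 (NSub (var 20) (var 12))))
       (Seq (NStore 7 (var 20) (NSub (NCell 7 (var 20)) (NConst 1)))
       (Seq (NStore 7 (var 21) (NAdd (NCell 7 (var 21)) (NConst 1)))
         (setv 19 (NCell 5 (var 20)))))))
       (\<lambda>\<tau>'. I \<tau>' \<and> rk (nat_arr \<tau>' 19 0) < rk (nat_arr \<tau> 19 0)) \<tau>"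
      \<comment> \<open>The second store reads array 7 after the first one has changed it; since
        \<open>partner a\<close> differs from \<open>a\<close>, it still finds the old value, as in
        \<open>pushed\<close>.\<close>
      using partner(2)[OF a(1)]
      by (auto simp: \<tau>'_def eq v_def[symmetric] a_def[symmetric] R'_def[symmetric] partner_def)
  next
    fix \<tau> assume I: "I \<tau>"
      and b: "\<not> bval (BNot (BAnd (BNot (NLess (var 19) (var 14))) (BNot (NLess (var 14) (var 19))))) \<tau>"
    from I have off: "eqoff {7, 19, 20, 21} {} \<sigma> \<tau>" by (simp add: I_def Let_def)
    then have "nat_arr \<tau> 14 0 = src" using st' by (simp add: eqoff_def)
    then have "nat_arr \<tau> 19 0 = src" using b by simp
    then show "Q \<tau>"
      using I by (intro Q[OF off refl]) (auto simp: I_def Let_def)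
  qed
  then show ?thesis using st' by (simp add: augment_def)
qed

lemma wp_phase:
  assumes st: "stored \<sigma>" and B: "N \<le> B" "A + A \<le> B"
    and R: "R = nat_arr \<sigma> 7" and running: "nat_arr \<sigma> 18 0 = 0"
    and res: "residual cap R" and feas: "feasible R (real_arr \<sigma> 2)"
    and Q: "\<And>\<tau> R'. eqoff {7, 8, 9, 16, 17, 18, 19, 20, 21} {2, 3} \<sigma> \<tau> \<Longrightarrow> R' = nat_arr \<tau> 7 \<Longrightarrow>
      residual cap R' \<Longrightarrow> feasible R' (real_arr \<tau> 2) \<Longrightarrow>
      0 < nat_arr \<tau> 18 0 \<and> R' = R \<and> real_arr \<tau> 2 src = real_arr \<tau> 2 snk \<or>
      nat_arr \<tau> 18 0 = 0 \<and>
        (\<forall>v. net (flow_of R') v = net (flow_of R) v + of_bool (v = src) - of_bool (v = snk)) \<Longrightarrow> Q \<tau>"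
  shows "wp B phase Q \<sigma>"
proof -
  define rest where "rest = Seq (NStore 8 (var 14) (NConst 1))
     (Seq (While (NLess (NCell 8 (var 15)) (NConst 1)) grow)
     (Cond (NLess (NConst 0) (var 18)) Skip augment))"
  note st' = st[unfolded stored_def]
  have "wp B (For 16 (var 13) (NStore 8 (var 16) (NConst 0))) (wp B rest Q) \<sigma>"
  proof (rule wp_For[where X = "{8, 16}" and Y = "{}" and N = N
        and I = "\<lambda>j \<tau>. \<forall>v<j. nat_arr \<tau> 8 v = 0"])
    fix \<sigma>1 assume zero: "\<forall>v<N. nat_arr \<sigma>1 8 v = 0" and 1: "eqoff {8, 16} {} \<sigma> \<sigma>1"
    define \<sigma>2 where "\<sigma>2 = nset 8 src 1 \<sigma>1"
    have 2: "eqoff {8, 9, 16, 17, 18} {2, 3} \<sigma> \<sigma>2" using 1 by (auto simp: eqoff_def \<sigma>2_def)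
    have X: "reached \<sigma>2 = {src}" using zero nodes by (auto simp: reached_def \<sigma>2_def)
    define I where "I \<tau> \<longleftrightarrow> eqoff {8, 9, 16, 17, 18} {2, 3} \<sigma> \<tau> \<and> feasible R (real_arr \<tau> 2) \<and>
      (0 < nat_arr \<tau> 18 0 \<and> real_arr \<tau> 2 src = real_arr \<tau> 2 snk \<and> snk \<in> reached \<tau> \<or>
        nat_arr \<tau> 18 0 = 0 \<and>
        (\<exists>rk. tight_tree R (real_arr \<tau> 2) (nat_arr \<tau> 9) (reached \<tau>) rk))" for \<tau> :: memory
    have stored: "stored \<tau>" "nat_arr \<tau> 7 = R" if "I \<tau>" for \<tau> :: memory
      using that st' R by (simp_all add: I_def eqoff_def stored_def)
    have card: "card (reached \<tau>) \<le> N" for \<tau> :: memory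
      using card_mono[of "{..<N}" "reached \<tau>"] by (auto simp: reached_def)
    have "wp B (While (NLess (NCell 8 (var 15)) (NConst 1)) grow)
      (wp B (Cond (NLess (NConst 0) (var 18)) Skip augment) Q) \<sigma>2"
    proof (rule wp_While_inv[where I = I and \<mu> = "\<lambda>\<tau>. N - card (reached \<tau>)"])
      have "real_arr \<sigma>2 = real_arr \<sigma>" "nat_arr \<sigma>2 18 = nat_arr \<sigma> 18"
        using 1 by (auto simp: \<sigma>2_def eqoff_def)
      then show "I \<sigma>2" using 2 feas running tight_tree_start by (auto simp: I_def X)
      show "N - card (reached \<sigma>2) \<le> B" using B by simp
    next
      fix \<tau> assume I: "I \<tau>" and b: "bval (NLess (NCell 8 (var 15)) (NConst 1)) \<tau>"
      have snk: "snk \<notin> reached \<tau>"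
        using b stored[OF I] by (simp add: stored_def reached_def)
      then obtain rk where "nat_arr \<tau> 18 0 = 0"
        "tight_tree R (real_arr \<tau> 2) (nat_arr \<tau> 9) (reached \<tau>) rk" "feasible R (real_arr \<tau> 2)"
        using I by (auto simp: I_def)
      note * = this
      have off: "eqoff {8, 9, 16, 17, 18} {2, 3} \<sigma> \<tau>" using I by (simp add: I_def)
      show "wp B grow (\<lambda>\<tau>'. I \<tau>' \<and> N - card (reached \<tau>') < N - card (reached \<tau>)) \<tau>"
      proof (rule wp_grow[OF stored(1)[OF I] B stored(2)[OF I, symmetric] *(3,2) snk])
        fix \<tau>' assume "eqoff {8, 9, 16, 17, 18} {2, 3} \<tau> \<tau>'" "feasible R (real_arr \<tau>' 2)"
          and less: "card (reached \<tau>) < card (reached \<tau>')"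
          and "0 < nat_arr \<tau>' 18 0 \<and> real_arr \<tau>' 2 src = real_arr \<tau>' 2 snk \<and> snk \<in> reached \<tau>' \<or>
            nat_arr \<tau>' 18 0 = nat_arr \<tau> 18 0 \<and>
            (\<exists>rk. tight_tree R (real_arr \<tau>' 2) (nat_arr \<tau>' 9) (reached \<tau>') rk)"
        then have "I \<tau>'" using *(1) eqoff_trans[OF off] by (simp add: I_def)
        then show "I \<tau>' \<and> N - card (reached \<tau>') < N - card (reached \<tau>)"
          using less card[of \<tau>'] by simp
      qed
    next
      fix \<tau> assume I: "I \<tau>" and b: "\<not> bval (NLess (NCell 8 (var 15)) (NConst 1)) \<tau>"
      have snk: "snk \<in> reached \<tau>"
        using b stored[OF I] nodes by (simp add: stored_def reached_def)
      have off: "eqoff {7, 8, 9, 16, 17, 18, 19, 20, 21} {2, 3} \<sigma> \<tau>"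
        using I by (auto simp: I_def intro: eqoff_mono)
      show "wp B (Cond (NLess (NConst 0) (var 18)) Skip augment) Q \<tau>"
      proof (cases "0 < nat_arr \<tau> 18 0")
        case True
        then have "Q \<tau>"
          using I stored(2)[OF I] res by (intro Q[OF off refl]) (auto simp: I_def)
        then show ?thesis using True by simp
      next
        case False
        then obtain rk where *: "nat_arr \<tau> 18 0 = 0"
          "tight_tree R (real_arr \<tau> 2) (nat_arr \<tau> 9) (reached \<tau>) rk" "feasible R (real_arr \<tau> 2)"
          using I by (auto simp: I_def)
        have "wp B augment Q \<tau>"
        proof (rule wp_augment[OF stored(1)[OF I] B(1) stored(2)[OF I, symmetric] refl res *(3,2) snk])
          fix \<tau>' R' assume **: "eqoff {7, 19, 20, 21} {} \<tau> \<tau>'" "R' = nat_arr \<tau>' 7" "residual cap R'"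
            "feasible R' (real_arr \<tau> 2)"
            "\<And>v. net (flow_of R') v = net (flow_of R) v + of_bool (v = src) - of_bool (v = snk)"
          have "real_arr \<tau>' = real_arr \<tau>" "nat_arr \<tau>' 18 = nat_arr \<tau> 18"
            using **(1) by (auto simp: eqoff_def)
          moreover have "eqoff {7, 8, 9, 16, 17, 18, 19, 20, 21} {2, 3} \<tau> \<tau>'"
            using **(1) by (rule eqoff_mono) auto
          ultimately show "Q \<tau>'"
            using ** *(1) eqoff_trans[OF off] by (intro Q[of \<tau>' R']) simp_all
        qed
        then show ?thesis using False by simp
      qed
    qed
    moreover have "nat_arr \<sigma>1 14 0 = src" using 1 st' by (simp add: eqoff_def)
    ultimately show "wp B rest Q \<sigma>1" by (simp add: rest_def \<sigma>2_def)
  qed (use st' B in \<open>auto simp: eqoff_def less_Suc_eq\<close>)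
  then show ?thesis by (simp add: phase_def rest_def)
qed

text \<open>Phases are counted by the value of the flow, which is bounded by the capacity at the
  source; the real potentials enter only into the certificate of optimality at the end.\<close>

lemma wp_solver:
  assumes st: "stored \<sigma>" and B: "N \<le> B" "A + A \<le> B" "(\<Sum>a<A. if U a = src then cap a else 0) < B"
    and R: "R = nat_arr \<sigma> 7" and running: "nat_arr \<sigma> 18 0 = 0"
    and res: "residual cap R" and feas: "feasible R (real_arr \<sigma> 2)"
    and flow: "\<And>v. net (flow_of R) v = 0"
    and Q: "\<And>\<tau> F. eqoff {7, 8, 9, 16, 17, 18, 19, 20, 21} {2, 3} \<sigma> \<tau> \<Longrightarrow>
      F = flow_of (nat_arr \<tau> 7) \<Longrightarrow> is_flow cap F \<Longrightarrow>
      (\<And>F'. is_flow cap F' \<Longrightarrow> (\<Sum>a<A. C a * real (F a)) \<le> (\<Sum>a<A. C a * real (F' a))) \<Longrightarrow> Q \<tau>"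
  shows "wp B solver Q \<sigma>"
  unfolding solver_def
proof -
  define K where "K = (\<Sum>a<A. if U a = src then cap a else 0)"
  note st' = st[unfolded stored_def]
  define I where "I \<tau> \<longleftrightarrow> (let R' = nat_arr \<tau> 7 in
    eqoff {7, 8, 9, 16, 17, 18, 19, 20, 21} {2, 3} \<sigma> \<tau> \<and> residual cap R' \<and>
    feasible R' (real_arr \<tau> 2) \<and> 0 \<le> net (flow_of R') src \<and>
    (\<forall>v. v \<noteq> src \<longrightarrow> v \<noteq> snk \<longrightarrow> net (flow_of R') v = 0) \<and>
    (0 < nat_arr \<tau> 18 0 \<longrightarrow> real_arr \<tau> 2 src = real_arr \<tau> 2 snk))" for \<tau> :: memory
  \<comment> \<open>The extra 1 pays for the last phase, which sets the flag and sends
    nothing.\<close>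
  define \<mu> where "\<mu> \<tau> = (if 0 < nat_arr \<tau> 18 0 then 0
    else nat (int K + 1 - net (flow_of (nat_arr \<tau> 7)) src))" for \<tau> :: memory
  have K: "net (flow_of R') src \<le> int K" if "residual cap R'" for R'
    using net_src_bound[OF that] by (simp add: K_def)
  show "wp B (While (NLess (var 18) (NConst 1)) phase) Q \<sigma>"
  proof (rule wp_While_inv[where I = I and \<mu> = \<mu>])
    show "I \<sigma>" using res feas flow running by (simp add: I_def R)
    show "\<mu> \<sigma> \<le> B" proof -
      have "net (flow_of (nat_arr \<sigma> 7)) src = 0" using flow R by simp
      then have "\<mu> \<sigma> \<le> K + 1" by (simp add: \<mu>_def nat_add_distrib del: of_nat_sum)
      then show ?thesis using B(3) by (simp add: K_def)
    qed
  next
    fix \<tau> assume I: "I \<tau>" and b: "bval (NLess (var 18) (NConst 1)) \<tau>"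
    then have done0: "nat_arr \<tau> 18 0 = 0" by simp
    from I have I': "eqoff {7, 8, 9, 16, 17, 18, 19, 20, 21} {2, 3} \<sigma> \<tau>" "residual cap (nat_arr \<tau> 7)"
      "feasible (nat_arr \<tau> 7) (real_arr \<tau> 2)" "0 \<le> net (flow_of (nat_arr \<tau> 7)) src"
      "\<And>v. v \<noteq> src \<Longrightarrow> v \<noteq> snk \<Longrightarrow> net (flow_of (nat_arr \<tau> 7)) v = 0"
      by (auto simp: I_def Let_def)
    have "stored \<tau>" using I'(1) st' by (simp add: eqoff_def stored_def)
    then show "wp B phase (\<lambda>\<tau>'. I \<tau>' \<and> \<mu> \<tau>' < \<mu> \<tau>) \<tau>"
    proof (rule wp_phase[OF _ B(1,2) refl done0 I'(2,3)])
      fix \<tau>' R' assume *: "eqoff {7, 8, 9, 16, 17, 18, 19, 20, 21} {2, 3} \<tau> \<tau>'" "R' = nat_arr \<tau>' 7"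
        "residual cap R'" "feasible R' (real_arr \<tau>' 2)"
        "0 < nat_arr \<tau>' 18 0 \<and> R' = nat_arr \<tau> 7 \<and> real_arr \<tau>' 2 src = real_arr \<tau>' 2 snk \<or>
          nat_arr \<tau>' 18 0 = 0 \<and> (\<forall>v. net (flow_of R') v =
            net (flow_of (nat_arr \<tau> 7)) v + of_bool (v = src) - of_bool (v = snk))"
      note off = eqoff_trans[OF I'(1) *(1)]
      have "I \<tau>'"
        using *(5) I'(4,5) *(3,4) off src_neq_snk by (auto simp: I_def Let_def *(2))
      moreover have "\<mu> \<tau>' < \<mu> \<tau>"
        using *(5) K[OF *(3)] K[OF I'(2)] done0 src_neq_snk by (auto simp: \<mu>_def *(2))
      ultimately show "I \<tau>' \<and> \<mu> \<tau>' < \<mu> \<tau>" ..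
    qed
  next
    fix \<tau> assume I: "I \<tau>" and b: "\<not> bval (NLess (var 18) (NConst 1)) \<tau>"
    have off: "eqoff {7, 8, 9, 16, 17, 18, 19, 20, 21} {2, 3} \<sigma> \<tau>"
      and *: "residual cap (nat_arr \<tau> 7)" "feasible (nat_arr \<tau> 7) (real_arr \<tau> 2)"
      "real_arr \<tau> 2 src = real_arr \<tau> 2 snk"
      using I b by (simp_all add: I_def Let_def)
    have flow: "is_flow cap (flow_of (nat_arr \<tau> 7))"
      using I by (auto simp: I_def Let_def is_flow_def residual_def)
    show "Q \<tau>"
      by (rule Q[OF off refl flow feasible_optimal[OF *(1) flow *(2,3)]])
  qed
qed

end

section \<open>Degree sequences of distance matchings\<close>

lemma gap_set_bound:
  fixes A :: "nat set"
  assumes "finite A" "A \<noteq> {}" "\<And>x y. x \<in> A \<Longrightarrow> y \<in> A \<Longrightarrow> x < y \<Longrightarrow> x + d \<le> y"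
  shows "\<exists>y\<in>A. Min A + (card A - 1) * d \<le> y"
  using assms
proof (induction A rule: finite_linorder_max_induct)
  case (insert b A)
  show ?case
  proof (cases "A = {}")
    case False
    then obtain y where y: "y \<in> A" "Min A + (card A - 1) * d \<le> y" using insert by blast
    have "y + d \<le> b" using insert y by simp
    moreover have "Min (insert b A) \<le> Min A" using False insert.hyps by simp
    moreover have "card (insert b A) - 1 = Suc (card A - 1)"
      using insert.hyps False by (auto simp: card_gt_0_iff)
    ultimately have "Min (insert b A) + (card (insert b A) - 1) * d \<le> b" using y by simp
    then show ?thesis by blast
  qed simp
qed simp

lemma distance_matching_degrees:
  fixes ss :: "'a list"
  assumes n: "n = h * d + r" and r: "r \<le> d" and d: "0 < d"
    and perm: "ss \<in> permutations_of_set S" and card: "card S = n" and E: "E \<subseteq> S \<times> T" and fin: "finite T"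
    and M: "distance_matching d E ss M"
  shows "card {s. (s, t) \<in> M} \<le> Suc h" "card {t. card {s. (s, t) \<in> M} = Suc h} \<le> r"
proof -
  have ss: "distinct ss" "set ss = S" "length ss = n"
    using perm card by (auto simp: permutations_of_set_def distinct_card)
  have ME: "M \<subseteq> S \<times> T" using M E by (auto simp: distance_matching_def)
  have one: "t = t'" if "(s, t) \<in> M" "(s, t') \<in> M" for s t t'
  proof -
    have "s \<in> set ss" using that ME ss by auto
    then have "card {e \<in> M. fst e = s} \<le> 1" using M by (auto simp: distance_matching_def)
    moreover have "finite {e \<in> M. fst e = s}"
    proof (rule finite_subset)
      show "{e \<in> M. fst e = s} \<subseteq> S \<times> T" using ME by blast
      show "finite (S \<times> T)" using fin ss(2) by (simp flip: ss(2))
    qed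
    ultimately have "\<forall>e\<in>{e \<in> M. fst e = s}. \<forall>e'\<in>{e \<in> M. fst e = s}. e = e'"
      by (simp only: One_nat_def card_le_Suc0_iff_eq)
    then have "(s, t) = (s, t')" using that by simp
    then show ?thesis by simp
  qed
  define P where "P t = {i. i < n \<and> (ss ! i, t) \<in> M}" for t
  have card_P: "card {s. (s, t) \<in> M} = card (P t)" for t
  proof -
    have "{s. (s, t) \<in> M} = (!) ss ` P t"
      using ME ss by (fastforce simp: P_def in_set_conv_nth)
    moreover have "inj_on ((!) ss) (P t)"
      using ss by (auto simp: inj_on_def P_def nth_eq_iff_index_eq)
    ultimately show ?thesis by (simp add: card_image)
  qed
  have bound: "Min (P t) + (card (P t) - 1) * d < n" if ne: "P t \<noteq> {}" for t
  proof -
    have "x + d \<le> y" if "x \<in> P t" "y \<in> P t" "x < y" for x y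
    proof -
      have "int d \<le> \<bar>int x - int y\<bar>"
        using M that ss unfolding distance_matching_def P_def by blast
      then show ?thesis using that by simp
    qed
    then obtain y where "y \<in> P t" "Min (P t) + (card (P t) - 1) * d \<le> y"
      using gap_set_bound[of "P t" d] ne by (auto simp: P_def)
    then show ?thesis by (auto simp: P_def)
  qed
  show "card {s. (s, t) \<in> M} \<le> Suc h"
  proof (rule ccontr)
    assume "\<not> card {s. (s, t) \<in> M} \<le> Suc h"
    then have c: "Suc h \<le> card (P t) - 1" by (simp add: card_P)
    then have "P t \<noteq> {}" by auto
    from bound[OF this] have "(card (P t) - 1) * d < h * d + r" using n by simp
    moreover have "Suc h * d \<le> (card (P t) - 1) * d" using c by (rule mult_le_mono1)
    ultimately show False using r by simp
  qed
  define F where "F = {t. card (P t) = Suc h}"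
  have ne: "P t \<noteq> {}" if "t \<in> F" for t using that by (auto simp: F_def)
  have Min: "Min (P t) \<in> P t" if "t \<in> F" for t
    using ne[OF that] by (intro Min_in) (auto simp: P_def)
  \<comment> \<open>A position holds one node of \<open>S\<close>, and that node has at most one
    partner, so different nodes of \<open>T\<close> have different first positions.\<close>
  have "inj_on (\<lambda>t. Min (P t)) F"
  proof (rule inj_onI)
    fix t t' assume "t \<in> F" "t' \<in> F" "Min (P t) = Min (P t')"
    then show "t = t'" using Min[of t] Min[of t'] one by (auto simp: P_def)
  qed
  moreover have "(\<lambda>t. Min (P t)) ` F \<subseteq> {..<r}"
    using bound ne n by (fastforce simp: F_def)
  ultimately have "card F \<le> card {..<r}" by (intro card_inj_on_le) auto
  then show "card {t. card {s. (s, t) \<in> M} = Suc h} \<le> r" by (simp add: F_def card_P)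
qed

section \<open>Realising a degree sequence\<close>

text \<open>Positions are read residue class by residue class modulo \<open>d\<close>, each class from its largest
  element down; \<open>idx p\<close> is the place of position \<open>p\<close> in this reading and \<open>start c\<close> the number of
  positions in the first \<open>c\<close> classes. The nodes of \<open>S\<close> are placed in this order, sorted by their
  partners \<open>mt\<close> (a value \<open>\<ge> m\<close> means unmatched), partners of degree \<open>h + 1\<close> first: these fill
  entire classes, and any \<open>h\<close> consecutive places are at pairwise distance at least \<open>d\<close>.\<close>

locale arrangement =
  fixes n m d h r :: nat and mt :: "nat \<Rightarrow> nat"
  assumes n: "n = h * d + r" and r: "r \<le> d" and d: "0 < d"
begin

definition cnt :: "nat \<Rightarrow> nat" where
  "cnt t = card {s. s < n \<and> mt s = t}"

text \<open>Partners of degree above \<open>h\<close> have keys below \<open>m\<close>; the shift by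
  \<open>m + 1\<close> lifts all other keys above them and keeps keys of different partners
  distinct.\<close>

definition key :: "nat \<Rightarrow> nat" where
  "key s = (if mt s < m \<and> h < cnt (mt s) then mt s else mt s + m + 1)"

definition before :: "nat \<Rightarrow> nat \<Rightarrow> bool" where
  "before s s' \<longleftrightarrow> key s < key s' \<or> key s = key s' \<and> s < s'"

definition rank :: "nat \<Rightarrow> nat" where
  "rank s = card {x. x < n \<and> before x s}"

text \<open>Since \<open>n = h * d + r\<close>, a class \<open>c < d\<close> has
  \<open>h + 1\<close> positions if \<open>c < r\<close> and \<open>h\<close> positions
  otherwise.\<close>

definition start :: "nat \<Rightarrow> nat" where
  "start c = c * h + min c r"

definition idx :: "nat \<Rightarrow> nat" where
  "idx p = start (Suc (p mod d)) - 1 - p div d"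

lemma key_eq_iff: "key s = key s' \<longleftrightarrow> mt s = mt s'"
  by (auto simp: key_def)

lemma before_linear: "s \<noteq> s' \<Longrightarrow> before s s' \<or> before s' s"
  by (auto simp: before_def)

lemma rank_mono: "before s s' \<Longrightarrow> s < n \<Longrightarrow> rank s < rank s'"
  unfolding rank_def by (intro psubset_card_mono) (auto simp: before_def)

lemma rank_less: "s < n \<Longrightarrow> rank s < n"
proof -
  assume s: "s < n"
  have "card {x. x < n \<and> before x s} < card {..<n}"
    using s by (intro psubset_card_mono) (auto simp: before_def)
  then show ?thesis by (simp add: rank_def)
qed

lemma inj_on_rank: "inj_on rank {..<n}"
  by (rule inj_onI) (metis before_linear rank_mono lessThan_iff less_irrefl)

lemma rank_surj: "c < n \<Longrightarrow> \<exists>s<n. rank s = c"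
proof -
  assume c: "c < n"
  have "rank ` {..<n} = {..<n}"
    using rank_less inj_on_rank by (intro endo_inj_surj) auto
  then have "c \<in> rank ` {..<n}" using c by simp
  then show ?thesis by auto
qed

text \<open>Nodes with a common partner have equal keys and so form a block. A node before
  \<open>s'\<close> but not before \<open>s\<close> lies in this block and differs from
  \<open>s'\<close>.\<close>

lemma rank_diff:
  assumes "mt s = mt s'" "s' < n"
  shows "rank s' < rank s + cnt (mt s)"
proof -
  have "{x. x < n \<and> before x s'} \<subseteq>
      {x. x < n \<and> before x s} \<union> ({x. x < n \<and> mt x = mt s} - {s'})"
  proof
    fix x assume "x \<in> {x. x < n \<and> before x s'}"
    then show "x \<in> {x. x < n \<and> before x s} \<union> ({x. x < n \<and> mt x = mt s} - {s'})"
      using key_eq_iff[of x s'] key_eq_iff[of s s'] assms(1) by (auto simp: before_def)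
  qed
  then have "rank s' \<le> card ({x. x < n \<and> before x s} \<union> ({x. x < n \<and> mt x = mt s} - {s'}))"
    unfolding rank_def by (intro card_mono) auto
  also have "\<dots> \<le> rank s + card ({x. x < n \<and> mt x = mt s} - {s'})"
    unfolding rank_def by (rule card_Un_le)
  also have "card ({x. x < n \<and> mt x = mt s} - {s'}) < cnt (mt s)"
    unfolding cnt_def using assms by (intro psubset_card_mono) auto
  finally show ?thesis by simp
qed

text \<open>Before \<open>s\<close> come exactly the nodes of the \<open>a\<close> full partners
  with smaller label, \<open>h + 1\<close> for each, and the smaller nodes with partner
  \<open>t\<close>. So the nodes of \<open>t\<close> occupy one aligned block of length
  \<open>h + 1\<close>.\<close>

lemma rank_full:
  assumes le: "\<And>t. t < m \<Longrightarrow> cnt t \<le> Suc h"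
    and s: "s < n" and t: "mt s = t" "t < m" "h < cnt t"
  defines "a \<equiv> card {t'. t' < t \<and> h < cnt t'}"
  shows "a * Suc h \<le> rank s" "rank s < Suc a * Suc h"
proof -
  let ?T = "{t'. t' < t \<and> h < cnt t'}"
  have full: "cnt t' = Suc h" if "t' < m" "h < cnt t'" for t' using le[of t'] that by simp
  have "{x. x < n \<and> before x s} = (\<Union>t'\<in>?T. {x. x < n \<and> mt x = t'}) \<union> {x. x < s \<and> mt x = t}"
    using s t by (auto simp: before_def key_def split: if_splits)
  moreover have "card ((\<Union>t'\<in>?T. {x. x < n \<and> mt x = t'}) \<union> {x. x < s \<and> mt x = t}) =
      card (\<Union>t'\<in>?T. {x. x < n \<and> mt x = t'}) + card {x. x < s \<and> mt x = t}"
    by (intro card_Un_disjoint) auto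
  moreover have "card (\<Union>t'\<in>?T. {x. x < n \<and> mt x = t'}) = (\<Sum>t'\<in>?T. cnt t')"
    unfolding cnt_def by (intro card_UN_disjoint) auto
  moreover have "(\<Sum>t'\<in>?T. cnt t') = (\<Sum>t'\<in>?T. Suc h)"
  proof (intro sum.cong refl)
    fix t' assume "t' \<in> ?T"
    then show "cnt t' = Suc h" using full[of t'] t(2) by simp
  qed
  moreover have "card {x. x < s \<and> mt x = t} < cnt t"
    unfolding cnt_def using s t by (intro psubset_card_mono) auto
  ultimately have "rank s = a * Suc h + card {x. x < s \<and> mt x = t}" "card {x. x < s \<and> mt x = t} < Suc h"
    using full[of t] t by (simp_all add: rank_def a_def)
  then show "a * Suc h \<le> rank s" "rank s < Suc a * Suc h" by simp_all
qed

lemma start_mono: "c \<le> c' \<Longrightarrow> start c \<le> start c'"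
  unfolding start_def by (intro add_mono mult_le_mono1) auto

lemma start_unique:
  assumes "start c \<le> i" "i < start (Suc c)" "start c' \<le> i" "i < start (Suc c')"
  shows "c = c'"
  using assms start_mono[of "Suc c" c'] start_mono[of "Suc c'" c]
  by (cases c c' rule: linorder_cases) auto

text \<open>Row \<open>h\<close> meets only the classes below \<open>r\<close>. Hence the
  subtractions in \<open>idx\<close> are not truncated, and class \<open>c\<close> stays between
  \<open>start c\<close> and \<open>start (Suc c)\<close>.\<close>

lemma idx:
  assumes "p < n"
  shows "start (p mod d) \<le> idx p" "idx p + p div d + 1 = start (Suc (p mod d))"
proof -
  let ?c = "p mod d" and ?q = "p div d"
  have p: "p = ?q * d + ?c" by simp
  have "\<not> Suc h \<le> ?q"
  proof
    assume "Suc h \<le> ?q"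
    then have "Suc h * d \<le> ?q * d" by (rule mult_le_mono1)
    then show False using assms p n r by simp
  qed
  moreover have "?c < r" if "?q = h" using that assms p n by (metis add_less_cancel_left)
  ultimately have "start ?c + ?q < start (Suc ?c)"
    by (cases "?q = h") (auto simp: start_def min_def)
  then show "start ?c \<le> idx p" "idx p + ?q + 1 = start (Suc ?c)" by (auto simp: idx_def)
qed

lemma idx_less: "p < n \<Longrightarrow> idx p < n"
proof -
  assume p: "p < n"
  have "idx p < start (Suc (p mod d))" using idx(2)[OF p] by simp
  also have "\<dots> \<le> start d" using d by (intro start_mono) (simp add: Suc_leI)
  also have "\<dots> = n" using r n by (simp add: start_def mult.commute)
  finally show ?thesis .
qed

text \<open>Fewer than \<open>d\<close> steps lead to a later class of the same row or to an earlier
  class of the next row. Because classes are read downwards, the change of row never reduces the gap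
  between the classes.\<close>

lemma idx_distance:
  assumes "p < p'" "p' < p + d" "p' < n"
  shows "p mod d \<noteq> p' mod d" "idx p + h \<le> idx p' \<or> idx p' + h \<le> idx p"
proof -
  define c c' q q' where "c = p mod d" "c' = p' mod d" "q = p div d" "q' = p' div d"
  note defs = this
  have p: "p = q * d + c" "p' = q' * d + c'" "c < d" "c' < d" using d by (simp_all add: defs)
  have "q \<le> q'" using assms by (simp add: defs div_le_mono)
  moreover have "q' \<le> Suc q"
  proof -
    have "p' div d \<le> (p + d) div d" using assms by (intro div_le_mono) simp
    then show ?thesis using d by (simp add: defs)
  qed
  ultimately consider "q' = q" | "q' = Suc q" by linarith
  then have cases: "q' = q \<and> c < c' \<or> q' = Suc q \<and> c' < c"
    using assms p by cases auto
  then show "p mod d \<noteq> p' mod d" by (auto simp: defs)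
  have step: "start (Suc a) + h \<le> start (Suc b)" if "a < b" for a b
  proof -
    have "start (Suc a) + h \<le> start (Suc (Suc a))" by (auto simp: start_def)
    also have "\<dots> \<le> start (Suc b)" using that by (intro start_mono) simp
    finally show ?thesis .
  qed
  have "idx p + q + 1 = start (Suc c)" "idx p' + q' + 1 = start (Suc c')"
    using idx(2)[of p] idx(2)[of p'] assms by (simp_all add: defs)
  then show "idx p + h \<le> idx p' \<or> idx p' + h \<le> idx p"
    using cases step[of c c'] step[of c' c] by auto
qed

lemma inj_on_idx: "inj_on idx {..<n}"
proof (rule inj_onI)
  fix p p' assume "p \<in> {..<n}" "p' \<in> {..<n}" and eq: "idx p = idx p'"
  then have p: "p < n" "p' < n" by auto
  have "p mod d = p' mod d"
    using idx[OF p(1)] idx[OF p(2)] eq by (intro start_unique[of _ "idx p"]) auto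
  moreover from this have "p div d = p' div d"
    using idx(2)[OF p(1)] idx(2)[OF p(2)] eq by simp
  ultimately show "p = p'" by (metis div_mult_mod_eq)
qed

theorem arranged:
  assumes le: "\<And>t. t < m \<Longrightarrow> cnt t \<le> Suc h"
    and full: "card {t. t < m \<and> cnt t = Suc h} \<le> r"
    and ss: "length ss = n" "\<And>p. p < n \<Longrightarrow> ss ! p < n" "\<And>p. p < n \<Longrightarrow> rank (ss ! p) = idx p"
  shows "ss \<in> permutations_of_set {..<n}"
    and "\<And>p p'. p < n \<Longrightarrow> p' < n \<Longrightarrow> p \<noteq> p' \<Longrightarrow> mt (ss ! p) = mt (ss ! p') \<Longrightarrow> mt (ss ! p) < m \<Longrightarrow>
      int d \<le> \<bar>int p - int p'\<bar>"
proof -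
  have "distinct ss"
    unfolding distinct_conv_nth using ss inj_on_idx by (metis inj_on_def lessThan_iff)
  moreover have "set ss \<subseteq> {..<n}" using ss by (auto simp: in_set_conv_nth)
  ultimately show "ss \<in> permutations_of_set {..<n}"
    using ss(1) by (auto simp: permutations_of_set_def distinct_card card_subset_eq)
  have far: "p + d \<le> p'"
    if p: "p < p'" "p' < n" and t: "mt (ss ! p) = t" "mt (ss ! p') = t" "t < m" for p p' t
  proof (rule ccontr)
    assume "\<not> p + d \<le> p'"
    then have "p' < p + d" by simp
    note dist = idx_distance[OF p(1) this p(2)]
    let ?s = "ss ! p" and ?s' = "ss ! p'"
    have s: "?s < n" "?s' < n" "rank ?s = idx p" "rank ?s' = idx p'" using ss p by auto
    show False
    proof (cases "h < cnt t")
      case False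
      then have "rank ?s' < rank ?s + cnt t \<and> rank ?s < rank ?s' + cnt t"
        using rank_diff[of ?s ?s'] rank_diff[of ?s' ?s] s t by simp
      then show False using dist(2) s False by auto
    next
      case True
      define a where "a = card {t'. t' < t \<and> h < cnt t'}"
      \<comment> \<open>The node \<open>t\<close> is itself full but not counted by
        \<open>a\<close>, so the inclusion is strict and \<open>a < r\<close> follows.\<close>
      have "{t'. t' < t \<and> h < cnt t'} \<subset> {t. t < m \<and> cnt t = Suc h}"
        using t True le by (force simp: less_Suc_eq_le intro: antisym Suc_leI)
      then have "a < card {t. t < m \<and> cnt t = Suc h}"
        unfolding a_def by (intro psubset_card_mono) auto
      then have "a < r" using full by simp
      then have start: "start a = a * Suc h" "start (Suc a) = Suc a * Suc h"
        by (simp_all add: start_def)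
      \<comment> \<open>Classes up to \<open>a\<close> all have \<open>h + 1\<close> positions
        because \<open>a < r\<close>, so the block of ranks belonging to \<open>t\<close> is exactly
        class \<open>a\<close>. Two positions closer than \<open>d\<close> cannot share a
        class.\<close>
      have "p mod d = a" if "p < n" "mt (ss ! p) = t" for p
        using rank_full[OF le _ that(2) t(3) True, folded a_def] ss that idx[OF that(1)] start
        by (intro start_unique[of _ "idx p"]) auto
      then show False using dist(1) p t by (metis less_trans)
    qed
  qed
  fix p p' assume "p < n" "p' < n" "p \<noteq> p'" "mt (ss ! p) = mt (ss ! p')" "mt (ss ! p) < m"
  then show "int d \<le> \<bar>int p - int p'\<bar>"
    using far[of p p'] far[of p' p] by (cases p p' rule: linorder_cases) auto
qed

end

section \<open>Distance matchings as flows\<close>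

text \<open>The nodes are \<open>s < n\<close>, then \<open>n + t\<close> for \<open>t < m\<close>, the source \<open>n + m\<close>, an auxiliary node
  \<open>n + m + 1\<close> and the sink \<open>n + m + 2\<close>. A unit through the auxiliary node raises the degree of one
  \<open>t\<close> from \<open>h\<close> to \<open>h + 1\<close>.\<close>

locale flow_instance =
  fixes n m d h r :: nat and es :: "(nat \<times> nat) list" and w :: "nat \<times> nat \<Rightarrow> real"
  assumes edges: "set es \<subseteq> {..<n} \<times> {..<m}" and distinct: "distinct es"
    and w: "e \<in> set es \<Longrightarrow> 0 \<le> w e"
    and d: "0 < d" and n: "n = h * d + r" and r: "r \<le> d"
begin

abbreviation "ne \<equiv> length es"

definition A :: nat where "A = ne + n + m + m + 1"
definition N :: nat where "N = n + m + 3"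
definition src :: nat where "src = n + m"
definition aux :: nat where "aux = n + m + 1"
definition snk :: nat where "snk = n + m + 2"

lemmas node_defs = N_def src_def aux_def snk_def

definition tail :: "nat \<Rightarrow> nat" where
  "tail a = (if a < ne then fst (es ! a) else if a < ne + n then n + m
     else if a < ne + n + m then n + (a - (ne + n))
     else if a < ne + n + m + m then n + (a - (ne + n + m)) else n + m + 1)"

definition head :: "nat \<Rightarrow> nat" where
  "head a = (if a < ne then n + snd (es ! a) else if a < ne + n then a - ne
     else if a < ne + n + m then n + m + 2
     else if a < ne + n + m + m then n + m + 1 else n + m + 2)"

text \<open>A node \<open>t\<close> has two routes to the sink: \<open>h\<close> units directly and
  one more through the auxiliary node, which passes on at most \<open>r\<close> units in
  total.\<close>

definition cap :: "nat \<Rightarrow> nat" where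
  "cap a = (if a < ne then 1 else if a < ne + n then 1 else if a < ne + n + m then h
     else if a < ne + n + m + m then 1 else r)"

definition cost :: "nat \<Rightarrow> real" where
  "cost a = (if a < ne then - w (es ! a) else 0)"

definition fill :: "(nat \<Rightarrow> 'c::zero) \<Rightarrow> (nat \<Rightarrow> 'c) \<Rightarrow> nat \<Rightarrow> nat \<Rightarrow> 'c" where
  "fill f g j a = (if a < j then f a else if A \<le> a \<and> a < A + j then g (a - A) else 0)"

lemma fill_Suc: "j < A \<Longrightarrow> fill f g (Suc j) = (fill f g j)(j := f j, A + j := g j)"
  by (auto simp: fill_def fun_eq_iff less_Suc_eq)

lemma fill_0: "fill f g 0 = (\<lambda>_. 0)"
  by (auto simp: fill_def fun_eq_iff)

definition U :: "nat \<Rightarrow> nat" where "U = fill tail head A"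
definition V :: "nat \<Rightarrow> nat" where "V = fill head tail A"
definition C :: "nat \<Rightarrow> real" where "C = fill cost (\<lambda>a. - cost a) A"
definition R0 :: "nat \<Rightarrow> nat" where "R0 = fill cap (\<lambda>_. 0) A"

lemma arc_simps:
  "a < A \<Longrightarrow> U a = tail a" "a < A \<Longrightarrow> V a = head a" "a < A \<Longrightarrow> C a = cost a" "a < A \<Longrightarrow> R0 a = cap a"
  "a < A \<Longrightarrow> U (A + a) = head a" "a < A \<Longrightarrow> V (A + a) = tail a"
  "a < A \<Longrightarrow> C (A + a) = - cost a" "R0 (A + a) = 0"
  by (simp_all add: U_def V_def C_def R0_def fill_def)

lemma edge:
  assumes "k < ne"
  shows "fst (es ! k) < n" "snd (es ! k) < m"
proof -
  have "es ! k \<in> {..<n} \<times> {..<m}" using nth_mem[OF assms] edges by blast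
  then show "fst (es ! k) < n" "snd (es ! k) < m" by (simp_all add: mem_Times_iff)
qed

sublocale residual_network U V C A N src snk
proof unfold_locales
  fix a assume a: "a < A"
  then show "U (A + a) = V a" "V (A + a) = U a" "C (A + a) = - C a" by (simp_all add: arc_simps)
  show "U a < N" "V a < N"
    using a edge[of a] by (auto simp: arc_simps tail_def head_def node_defs)
qed (simp_all add: node_defs)

section \<open>Net outflow at each kind of node\<close>

lemma sum_arcs:
  fixes f :: "nat \<Rightarrow> 'c::comm_monoid_add"
  shows "(\<Sum>a<A. f a) = (\<Sum>k<ne. f k) + (\<Sum>s<n. f (ne + s)) + (\<Sum>t<m. f (ne + n + t)) +
    (\<Sum>t<m. f (ne + n + m + t)) + f (ne + n + m + m)"
proof -
  have add: "(\<Sum>i<p + q. f i) = (\<Sum>i<p. f i) + (\<Sum>i<q. f (p + i))" for p q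
    by (induction q) (simp_all add: add.assoc)
  show ?thesis by (simp add: A_def add)
qed

lemma net_arcs:
  "net F v = (\<Sum>k<ne. int (F k) * (of_bool (fst (es ! k) = v) - of_bool (n + snd (es ! k) = v)))
     + (\<Sum>s<n. int (F (ne + s)) * (of_bool (src = v) - of_bool (s = v)))
     + (\<Sum>t<m. int (F (ne + n + t)) * (of_bool (n + t = v) - of_bool (snk = v)))
     + (\<Sum>t<m. int (F (ne + n + m + t)) * (of_bool (n + t = v) - of_bool (aux = v)))
     + int (F (ne + n + m + m)) * (of_bool (aux = v) - of_bool (snk = v))"
  unfolding net_def sum_arcs
  by (intro arg_cong2[where f = "(+)"] sum.cong refl) (auto simp: arc_simps A_def tail_def head_def node_defs)

lemma net_S:
  assumes "s < n"
  shows "net F s = (\<Sum>k<ne. int (F k) * of_bool (fst (es ! k) = s)) - int (F (ne + s))"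
proof -
  have "(\<Sum>k<ne. int (F k) * (of_bool (fst (es ! k) = s) - of_bool (n + snd (es ! k) = s))) =
      (\<Sum>k<ne. int (F k) * of_bool (fst (es ! k) = s))"
    using assms by (intro sum.cong) auto
  moreover have "(\<Sum>s'<n. int (F (ne + s')) * (of_bool (src = s) - of_bool (s' = s))) =
      (\<Sum>s'<n. if s' = s then - int (F (ne + s')) else 0)"
    using assms by (intro sum.cong) (auto simp: node_defs)
  moreover have "\<dots> = - int (F (ne + s))" using assms by simp
  moreover have "(\<Sum>t<m. int (F (ne + n + t)) * (of_bool (n + t = s) - of_bool (snk = s))) = 0"
    "(\<Sum>t<m. int (F (ne + n + m + t)) * (of_bool (n + t = s) - of_bool (aux = s))) = 0"
    "of_bool (aux = s) - of_bool (snk = s) = (0 :: int)"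
    using assms by (auto simp: node_defs)
  ultimately show ?thesis unfolding net_arcs by simp
qed

lemma net_T:
  assumes "t < m"
  shows "net F (n + t) = int (F (ne + n + t)) + int (F (ne + n + m + t))
    - (\<Sum>k<ne. int (F k) * of_bool (snd (es ! k) = t))"
proof -
  have "(\<Sum>k<ne. int (F k) * (of_bool (fst (es ! k) = n + t) - of_bool (n + snd (es ! k) = n + t))) =
      (\<Sum>k<ne. - (int (F k) * of_bool (snd (es ! k) = t)))"
  proof (intro sum.cong refl)
    fix k assume "k \<in> {..<ne}"
    then show "int (F k) * (of_bool (fst (es ! k) = n + t) - of_bool (n + snd (es ! k) = n + t)) =
        - (int (F k) * of_bool (snd (es ! k) = t))"
      using edge(1)[of k] by auto
  qed
  moreover have "(\<Sum>s<n. int (F (ne + s)) * (of_bool (src = n + t) - of_bool (s = n + t))) = 0"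
    using assms by (intro sum.neutral) (auto simp: node_defs)
  moreover have "(\<Sum>t'<m. int (F (ne + n + t')) * (of_bool (n + t' = n + t) - of_bool (snk = n + t)))
      = (\<Sum>t'<m. if t' = t then int (F (ne + n + t')) else 0)"
    using assms by (intro sum.cong) (auto simp: node_defs)
  moreover have "\<dots> = int (F (ne + n + t))" using assms by simp
  moreover have "(\<Sum>t'<m. int (F (ne + n + m + t')) * (of_bool (n + t' = n + t) - of_bool (aux = n + t)))
      = (\<Sum>t'<m. if t' = t then int (F (ne + n + m + t')) else 0)"
    using assms by (intro sum.cong) (auto simp: node_defs)
  moreover have "\<dots> = int (F (ne + n + m + t))" using assms by simp
  moreover have "of_bool (aux = n + t) - of_bool (snk = n + t) = (0 :: int)"
    using assms by (simp add: node_defs)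
  ultimately show ?thesis unfolding net_arcs sum_negf by simp
qed

lemma net_aux:
  "net F (aux) = int (F (ne + n + m + m)) - (\<Sum>t<m. int (F (ne + n + m + t)))"
proof -
  have "(\<Sum>k<ne. int (F k) * (of_bool (fst (es ! k) = aux) - of_bool (n + snd (es ! k) = aux))) = 0"
    using edge by (intro sum.neutral) (fastforce simp: node_defs)
  moreover have "(\<Sum>s<n. int (F (ne + s)) * (of_bool (src = aux) - of_bool (s = aux))) = 0"
    by (intro sum.neutral) (auto simp: node_defs)
  moreover have "(\<Sum>t<m. int (F (ne + n + t)) * (of_bool (n + t = aux) - of_bool (snk = aux))) = 0"
    by (intro sum.neutral) (auto simp: node_defs)
  moreover have "(\<Sum>t<m. int (F (ne + n + m + t)) * (of_bool (n + t = aux) - of_bool (aux = aux)))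
      = (\<Sum>t<m. - int (F (ne + n + m + t)))"
    by (intro sum.cong) (auto simp: node_defs)
  moreover have "of_bool (aux = aux) - of_bool (snk = aux) = (1 :: int)" by (simp add: node_defs)
  ultimately show ?thesis unfolding net_arcs sum_negf by simp
qed

text \<open>\<open>is_flow\<close> asks for conservation at every natural number, hence also beyond
  the last node.\<close>

lemma net_outside:
  assumes "snk < v"
  shows "net F v = 0"
  proof -
  have "(\<Sum>k<ne. int (F k) * (of_bool (fst (es ! k) = v) - of_bool (n + snd (es ! k) = v))) = 0"
    using assms edge by (intro sum.neutral) (fastforce simp: node_defs)
  moreover have "(\<Sum>s<n. int (F (ne + s)) * (of_bool (src = v) - of_bool (s = v))) = 0"
    "(\<Sum>t<m. int (F (ne + n + t)) * (of_bool (n + t = v) - of_bool (snk = v))) = 0"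
    "(\<Sum>t<m. int (F (ne + n + m + t)) * (of_bool (n + t = v) - of_bool (aux = v))) = 0"
    "of_bool (aux = v) - of_bool (snk = v) = (0 :: int)"
    using assms by (auto simp: node_defs intro!: sum.neutral)
  ultimately show ?thesis unfolding net_arcs by simp
qed

section \<open>Translation between edge sets and flows\<close>

lemma sum_edges:
  fixes f :: "nat \<times> nat \<Rightarrow> 'c::comm_monoid_add"
  shows "(\<Sum>k<ne. f (es ! k)) = (\<Sum>e\<in>set es. f e)"
  using sum.reindex_bij_betw[OF bij_betw_nth[OF distinct refl refl]] .

lemma degree_sums:
  assumes "M \<subseteq> set es" "\<And>k. k < ne \<Longrightarrow> F k = of_bool (es ! k \<in> M)"
  shows "(\<Sum>k<ne. int (F k) * of_bool (fst (es ! k) = s)) = int (card {t. (s, t) \<in> M})"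
    and "(\<Sum>k<ne. int (F k) * of_bool (snd (es ! k) = t)) = int (card {s. (s, t) \<in> M})"
    and "(\<Sum>a<A. C a * real (F a)) = - sum w M"
proof -
  have card: "(\<Sum>e\<in>set es. of_bool (e \<in> M \<and> P e)) = int (card {e \<in> M. P e})"
    for P :: "nat \<times> nat \<Rightarrow> bool"
    using assms(1) by (auto simp: of_bool_def sum.If_cases intro!: arg_cong[where f = card])
  have "(\<Sum>k<ne. int (F k) * of_bool (fst (es ! k) = s)) =
      (\<Sum>k<ne. of_bool (es ! k \<in> M \<and> fst (es ! k) = s))"
    using assms by (intro sum.cong) auto
  also have "\<dots> = int (card {e \<in> M. fst e = s})"
    using sum_edges[of "\<lambda>e. of_bool (e \<in> M \<and> fst e = s) :: int"] card by simp
  also have "{e \<in> M. fst e = s} = Pair s ` {t. (s, t) \<in> M}" by auto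
  finally show "(\<Sum>k<ne. int (F k) * of_bool (fst (es ! k) = s)) = int (card {t. (s, t) \<in> M})"
    by (simp add: card_image inj_on_def)
  have "(\<Sum>k<ne. int (F k) * of_bool (snd (es ! k) = t)) =
      (\<Sum>k<ne. of_bool (es ! k \<in> M \<and> snd (es ! k) = t))"
    using assms by (intro sum.cong) auto
  also have "\<dots> = int (card {e \<in> M. snd e = t})"
    using sum_edges[of "\<lambda>e. of_bool (e \<in> M \<and> snd e = t) :: int"] card by simp
  also have "{e \<in> M. snd e = t} = (\<lambda>s. (s, t)) ` {s. (s, t) \<in> M}" by auto
  finally show "(\<Sum>k<ne. int (F k) * of_bool (snd (es ! k) = t)) = int (card {s. (s, t) \<in> M})"
    by (simp add: card_image inj_on_def)
  have "(\<Sum>a<A. C a * real (F a)) =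
      (\<Sum>k<ne. - (w (es ! k) * of_bool (es ! k \<in> M)))"
    unfolding sum_arcs using assms(2) by (simp add: arc_simps A_def cost_def)
  also have "\<dots> = (\<Sum>e\<in>set es. - (w e * of_bool (e \<in> M)))" by (rule sum_edges)
  also have "\<dots> = (\<Sum>e\<in>set es. - (if e \<in> M then w e else 0))"
    by (intro sum.cong) auto
  also have "\<dots> = - sum w M"
    using assms(1) by (simp add: sum_negf sum.inter_restrict[symmetric] Int_absorb1)
  finally show "(\<Sum>a<A. C a * real (F a)) = - sum w M" .
qed

text \<open>A unit from \<open>t\<close> to the auxiliary node does not imply degree
  \<open>h + 1\<close>, but degree \<open>h + 1\<close> forces such a unit, as the direct arc
  carries only \<open>h\<close>. This direction suffices for the bound \<open>r\<close>.\<close>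

lemma matching_of_flow:
  assumes F: "is_flow cap F" and M: "M = {es ! k | k. k < ne \<and> F k \<noteq> 0}"
  shows "M \<subseteq> set es"
    and "\<And>s t t'. (s, t) \<in> M \<Longrightarrow> (s, t') \<in> M \<Longrightarrow> t = t'"
    and "\<And>t. t < m \<Longrightarrow> card {s. (s, t) \<in> M} \<le> Suc h"
    and "card {t. t < m \<and> card {s. (s, t) \<in> M} = Suc h} \<le> r"
    and "(\<Sum>a<A. C a * real (F a)) = - sum w M"
proof -
  have cap: "F a \<le> cap a" if "a < A" for a using F that by (simp add: is_flow_def)
  have net: "net F v = 0" if "v \<noteq> src" "v \<noteq> snk" for v
    using F that by (simp add: is_flow_def)
  show sub: "M \<subseteq> set es" by (auto simp: M)
  have Fk: "F k = of_bool (es ! k \<in> M)" if "k < ne" for k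
  proof -
    have "es ! k \<in> M \<longleftrightarrow> F k \<noteq> 0"
      using that distinct by (auto simp: M nth_eq_iff_index_eq)
    then show ?thesis using cap[of k] that by (auto simp: cap_def A_def)
  qed
  note sums = degree_sums[OF sub Fk]
  show "(\<Sum>a<A. C a * real (F a)) = - sum w M" by (rule sums(3))
  show "t = t'" if "(s, t) \<in> M" "(s, t') \<in> M" for s t t'
  proof -
    have s: "s < n" using that(1) sub edges by auto
    have "int (card {t. (s, t) \<in> M}) = int (F (ne + s))"
      using net[of s] s net_S[OF s, of F] sums(1)[of s] by (simp add: node_defs)
    also have "\<dots> \<le> 1" using cap[of "ne + s"] s by (simp add: cap_def A_def)
    finally have "card {t. (s, t) \<in> M} \<le> Suc 0" by simp
    moreover have "finite {t. (s, t) \<in> M}"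
      by (rule finite_subset[of _ "{..<m}"]) (use sub edges in auto)
    ultimately have "\<forall>x\<in>{t. (s, t) \<in> M}. \<forall>y\<in>{t. (s, t) \<in> M}. x = y"
      by (simp only: card_le_Suc0_iff_eq)
    then show ?thesis using that by simp
  qed
  have deg: "card {s. (s, t) \<in> M} = F (ne + n + t) + F (ne + n + m + t)" if "t < m" for t
    using net[of "n + t"] net_T[OF that, of F] sums(2)[of t] that by (simp add: node_defs)
  have le: "F (ne + n + t) \<le> h" "F (ne + n + m + t) \<le> 1" if "t < m" for t
    using cap[of "ne + n + t"] cap[of "ne + n + m + t"] that by (simp_all add: cap_def A_def)
  show "card {s. (s, t) \<in> M} \<le> Suc h" if "t < m" for t
    using deg[OF that] le[OF that] by simp
  have "card {t. t < m \<and> card {s. (s, t) \<in> M} = Suc h} =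
      (\<Sum>t<m. of_bool (card {s. (s, t) \<in> M} = Suc h))"
    by (auto simp: of_bool_def sum.If_cases intro!: arg_cong[where f = card])
  also have "\<dots> \<le> (\<Sum>t<m. F (ne + n + m + t))"
  proof (intro sum_mono)
    fix t assume "t \<in> {..<m}"
    then show "of_bool (card {s. (s, t) \<in> M} = Suc h) \<le> F (ne + n + m + t)"
      using deg[of t] le[of t] by auto
  qed
  also have "\<dots> = F (ne + n + m + m)"
  proof -
    have "int (\<Sum>t<m. F (ne + n + m + t)) = int (F (ne + n + m + m))"
      using net[of aux] net_aux[of F] by (simp add: node_defs)
    then show ?thesis by (simp only: of_nat_eq_iff)
  qed
  also have "\<dots> \<le> r" using cap[of "ne + n + m + m"] by (simp add: cap_def A_def)
  finally show "card {t. t < m \<and> card {s. (s, t) \<in> M} = Suc h} \<le> r" .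
qed

lemma flow_of_matching:
  assumes sub: "M \<subseteq> set es"
    and unique: "\<And>s t t'. (s, t) \<in> M \<Longrightarrow> (s, t') \<in> M \<Longrightarrow> t = t'"
    and deg: "\<And>t. card {s. (s, t) \<in> M} \<le> Suc h"
    and full: "card {t. card {s. (s, t) \<in> M} = Suc h} \<le> r"
  shows "\<exists>F. is_flow cap F \<and> (\<Sum>a<A. C a * real (F a)) = - sum w M"
proof -
  define c where "c t = card {s. (s, t) \<in> M}" for t
  \<comment> \<open>The direct arc of \<open>t\<close> is filled first and only the excess over
    \<open>h\<close> goes through the auxiliary node, so precisely the nodes of degree
    \<open>h + 1\<close> use it.\<close>
  define F where "F a = (if a < ne then of_bool (es ! a \<in> M)
     else if a < ne + n then card {t. (a - ne, t) \<in> M}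
     else if a < ne + n + m then min h (c (a - (ne + n)))
     else if a < ne + n + m + m then c (a - (ne + n + m)) - h
     else card {t. c t = Suc h})" for a
  have Fk: "F k = of_bool (es ! k \<in> M)" if "k < ne" for k using that by (simp add: F_def)
  note sums = degree_sums[OF sub Fk]
  have c: "c t \<le> Suc h" for t using deg by (simp add: c_def)
  have "is_flow cap F"
    unfolding is_flow_def
  proof (intro conjI allI impI)
    fix a assume "a < A"
    have "card {t. (s, t) \<in> M} \<le> 1" for s
    proof -
      have "finite {t. (s, t) \<in> M}"
        by (rule finite_subset[of _ "{..<m}"]) (use sub edges in auto)
      then show ?thesis using unique by (simp add: card_le_Suc0_iff_eq)
    qed
    then show "F a \<le> cap a" using c[of "a - (ne + n + m)"] full by (auto simp: F_def cap_def c_def)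
  next
    fix v assume v: "v \<noteq> src" "v \<noteq> snk"
    have "v < n \<or> (\<exists>t<m. v = n + t) \<or> v = aux \<or> snk < v"
    proof (cases "n \<le> v \<and> v < n + m")
      case True
      then have "v = n + (v - n)" "v - n < m" by linarith+
      then show ?thesis by blast
    qed (use v in \<open>auto simp: node_defs\<close>)
    then consider "v < n" | t where "v = n + t" "t < m" | "v = aux" | "snk < v" by blast
    then show "net F v = 0"
    proof cases
      case 1
      then show ?thesis using sums(1)[of v] by (simp add: net_S F_def)
    next
      case 2
      have "c t = min h (c t) + (c t - h)" by simp
      then have "int (c t) = int (min h (c t)) + int (c t - h)" by (simp only: of_nat_add[symmetric])
      moreover have "F (ne + n + t) = min h (c t)" "F (ne + n + m + t) = c t - h"
        using 2 by (simp_all add: F_def)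
      ultimately show ?thesis using sums(2)[of t] net_T[OF 2(2), of F] 2(1) by (simp add: c_def)
    next
      case 3
      \<comment> \<open>The count in \<open>full\<close> ranges over all natural numbers; a node of
        positive degree lies below \<open>m\<close>.\<close>
      have small: "t < m" if "c t = Suc h" for t
      proof -
        have "{s. (s, t) \<in> M} \<noteq> {}" using that unfolding c_def by (intro notI) simp
        then show ?thesis using sub edges by auto
      qed
      have "(\<Sum>t<m. F (ne + n + m + t)) = (\<Sum>t<m. of_bool (c t = Suc h))"
      proof (intro sum.cong refl)
        fix t assume "t \<in> {..<m}"
        then show "F (ne + n + m + t) = of_bool (c t = Suc h)"
          using c[of t] by (auto simp: F_def)
      qed
      also have "\<dots> = card {t. c t = Suc h}"
        using small by (auto simp: of_bool_def sum.If_cases intro!: arg_cong[where f = card])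
      also have "\<dots> = F (ne + n + m + m)" by (simp add: F_def)
      finally show ?thesis unfolding 3 net_aux by (simp flip: of_nat_sum)
    next
      case 4
      then show ?thesis by (rule net_outside)
    qed
  qed
  then show ?thesis using sums(3) by blast
qed

lemma cost_le_of_distance_matching:
  assumes opt: "\<And>F'. is_flow cap F' \<Longrightarrow> K \<le> (\<Sum>a<A. C a * real (F' a))"
    and perm: "ss \<in> permutations_of_set {..<n}" and M: "distance_matching d (set es) ss M"
  shows "sum w M \<le> - K"
proof -
  have sub: "M \<subseteq> set es" using M by (simp add: distance_matching_def)
  have "t = t'" if "(s, t) \<in> M" "(s, t') \<in> M" for s t t'
  proof -
    have "s \<in> set ss" using that sub edges perm by (auto simp: permutations_of_set_def)
    then have "card {e \<in> M. fst e = s} \<le> Suc 0" using M by (auto simp: distance_matching_def)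
    moreover have "finite {e \<in> M. fst e = s}"
      by (rule finite_subset[of _ "set es"]) (use sub in auto)
    ultimately have "\<forall>x\<in>{e \<in> M. fst e = s}. \<forall>y\<in>{e \<in> M. fst e = s}. x = y"
      by (simp only: card_le_Suc0_iff_eq)
    then have "(s, t) = (s, t')" using that by simp
    then show ?thesis by simp
  qed
  moreover note distance_matching_degrees[OF n r d perm _ edges _ M]
  ultimately obtain F where "is_flow cap F"
    "(\<Sum>a<A. C a * real (F a)) = - sum w M"
    using flow_of_matching[OF sub] by auto
  then show ?thesis using opt[of F] by simp
qed

text \<open>The costs are negative, so the zero potential is not feasible. For the empty flow, the
  residual arcs leave \<open>S\<close> and the source only along edges of cost \<open>- w e\<close>,
  and a drop by the total weight is enough for each of them. No shortest path computation is
  required.\<close>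

definition initial_potential :: "nat \<Rightarrow> real" where
  "initial_potential v = (if v < n \<or> v = src then 0 else - (\<Sum>k<ne. w (es ! k)))"

lemma w_le_sum: "k < ne \<Longrightarrow> w (es ! k) \<le> (\<Sum>k<ne. w (es ! k))"
  using w by (intro member_le_sum) auto

lemma feasible_initial: "feasible R0 initial_potential"
proof -
  have nonneg: "0 \<le> (\<Sum>k<ne. w (es ! k))" using w by (intro sum_nonneg) auto
  have "initial_potential (head a) \<le> initial_potential (tail a) + cost a" if a: "a < A" for a
  proof -
    consider "a < ne" | "ne \<le> a" "a < ne + n" | "ne + n \<le> a" by linarith
    then show ?thesis
    proof cases
      case 1
      then show ?thesis using edge[OF 1] w_le_sum[OF 1]
        by (simp add: head_def tail_def cost_def initial_potential_def node_defs)
    next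
      case 2
      then show ?thesis by (auto simp: head_def tail_def cost_def initial_potential_def node_defs)
    next
      case 3
      then have "\<not> tail a < n" "tail a \<noteq> src" "\<not> head a < n" "head a \<noteq> src" "cost a = 0"
        by (auto simp: head_def tail_def cost_def node_defs)
      then show ?thesis by (simp add: initial_potential_def)
    qed
  qed
  moreover have "a < A" if "0 < R0 a" for a
    using that by (auto simp: R0_def fill_def split: if_splits)
  moreover have "initial_potential snk \<le> initial_potential src"
    using nonneg by (simp add: initial_potential_def node_defs)
  ultimately show ?thesis by (auto simp: feasible_def arc_simps)
qed

lemma residual_initial: "residual cap R0"
  by (simp add: residual_def arc_simps)

lemma net_initial: "net (flow_of R0) v = 0"
  by (simp add: net_def arc_simps)

lemma cap_src: "(\<Sum>a<A. if U a = src then cap a else 0) = n"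
proof -
  have "(\<Sum>k<ne. if U k = src then cap k else 0) = 0"
  proof (intro sum.neutral ballI)
    fix k assume "k \<in> {..<ne}"
    then show "(if U k = src then cap k else 0) = 0"
      using edge(1)[of k] by (auto simp: arc_simps A_def node_defs tail_def)
  qed
  moreover have "(\<Sum>s<n. if U (ne + s) = src then cap (ne + s) else 0) = (\<Sum>s<n. 1)"
    by (intro sum.cong) (auto simp: arc_simps A_def node_defs tail_def cap_def)
  moreover have "(\<Sum>t<m. if U (ne + n + t) = src then cap (ne + n + t) else 0) = 0"
    by (intro sum.neutral) (auto simp: arc_simps A_def node_defs tail_def)
  moreover have "(\<Sum>t<m. if U (ne + n + m + t) = n + m
      then cap (ne + n + m + t) else 0) = 0"
    by (intro sum.neutral) (auto simp: arc_simps A_def node_defs tail_def)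
  moreover have "U (ne + n + m + m) = aux" by (simp add: arc_simps A_def node_defs tail_def)
  ultimately show ?thesis unfolding sum_arcs by (simp add: node_defs)
qed

end

section \<open>The program\<close>

abbreviation "nV \<equiv> NCell 0 (NConst 0)"
abbreviation "mV \<equiv> NCell 0 (NConst 1)"
abbreviation "eV \<equiv> NCell 0 (NConst 2)"
abbreviation "dV \<equiv> NCell 0 (NConst 3)"

text \<open>Besides the cells of the flow solver: variables 10 and 11 are \<open>h\<close> and \<open>h * d\<close>; 22--24 are tail, head
  and capacity of the current arc, and real variables 4 and 5 its cost and the sum of all weights;
  array 26 holds the degrees \<open>cnt\<close>, 27 the sort keys, 30 the nodes sorted by rank; at position \<open>p\<close>,
  variables 31--33 are \<open>p mod d\<close>, \<open>p div d\<close> and \<open>start (p mod d)\<close>.\<close>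
definition heights :: com where
  "heights = While (NLess (NAdd (var 11) dV) nV)
     (Seq (setv 11 (NAdd (var 11) dV)) (setv 10 (NAdd (var 10) (NConst 1))))"

definition sizes :: com where
  "sizes = Seq (setv 12 (NAdd (NAdd (NAdd (NAdd eV nV) mV) mV) (NConst 1)))
     (Seq (setv 13 (NAdd (NAdd nV mV) (NConst 3)))
     (Seq (setv 14 (NAdd nV mV)) (setv 15 (NAdd (NAdd nV mV) (NConst 2)))))"

definition arc_data :: com where
  "arc_data =
    Cond (NLess (var 16) eV)
      (Seq (setv 22 (NCell 1 (var 16))) (Seq (setv 23 (NAdd nV (NCell 2 (var 16))))
        (Seq (setv 24 (NConst 1)) (Seq (setr 4 (RSub (RConst 0) (RCell 0 (var 16))))
          (setr 5 (RAdd (rvar 5) (RCell 0 (var 16))))))))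
    (Seq (setr 4 (RConst 0))
    (Cond (NLess (var 16) (NAdd eV nV))
      (Seq (setv 22 (NAdd nV mV)) (Seq (setv 23 (NSub (var 16) eV)) (setv 24 (NConst 1))))
    (Cond (NLess (var 16) (NAdd (NAdd eV nV) mV))
      (Seq (setv 22 (NAdd nV (NSub (var 16) (NAdd eV nV))))
        (Seq (setv 23 (NAdd (NAdd nV mV) (NConst 2))) (setv 24 (var 10))))
    (Cond (NLess (var 16) (NAdd (NAdd (NAdd eV nV) mV) mV))
      (Seq (setv 22 (NAdd nV (NSub (var 16) (NAdd (NAdd eV nV) mV))))
        (Seq (setv 23 (NAdd (NAdd nV mV) (NConst 1))) (setv 24 (NConst 1))))
      (Seq (setv 22 (NAdd (NAdd nV mV) (NConst 1)))
        (Seq (setv 23 (NAdd (NAdd nV mV) (NConst 2))) (setv 24 (NSub nV (var 11)))))))))"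

definition store_arc :: com where
  "store_arc =
    Seq (NStore 5 (var 16) (var 22)) (Seq (NStore 6 (var 16) (var 23))
    (Seq (NStore 7 (var 16) (var 24)) (Seq (RStore 1 (var 16) (rvar 4))
    (Seq (NStore 5 (NAdd (var 12) (var 16)) (var 23)) (Seq (NStore 6 (NAdd (var 12) (var 16)) (var 22))
    (Seq (NStore 7 (NAdd (var 12) (var 16)) (NConst 0))
      (RStore 1 (NAdd (var 12) (var 16)) (RSub (RConst 0) (rvar 4)))))))))"

definition arcs :: com where
  "arcs = For 16 (var 12) (Seq arc_data store_arc)"

definition potentials :: com where
  "potentials = For 16 (var 13)
     (Cond (NLess (var 16) nV) Skip
     (Cond (BAnd (BNot (NLess (var 16) (var 14))) (BNot (NLess (var 14) (var 16)))) Skip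
       (RStore 2 (var 16) (RSub (RConst 0) (rvar 5)))))"

text \<open>Array 25: the partner of each \<open>s\<close>, or \<open>m\<close> if it is unmatched.\<close>
definition collect :: com where
  "collect = Seq (For 16 nV (NStore 25 (var 16) mV))
     (For 16 eV (Cond (NLess (NConst 0) (NCell 7 (NAdd (var 12) (var 16))))
       (Seq (NStore 4 (var 16) (NConst 1)) (NStore 25 (NCell 1 (var 16)) (NCell 2 (var 16))))
       Skip))"

definition counts :: com where
  "counts = For 16 nV
     (NStore 26 (NCell 25 (var 16)) (NAdd (NCell 26 (NCell 25 (var 16))) (NConst 1)))"

definition keys :: com where
  "keys = For 16 nV
     (Cond (BAnd (NLess (NCell 25 (var 16)) mV) (NLess (var 10) (NCell 26 (NCell 25 (var 16)))))
       (NStore 27 (var 16) (NCell 25 (var 16)))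
       (NStore 27 (var 16) (NAdd (NAdd (NCell 25 (var 16)) mV) (NConst 1))))"

text \<open>Sorting by comparing all pairs: cell 28 counts the predecessors of a node, and array 30
  becomes the inverse of \<open>rank\<close>.\<close>

definition ranks :: com where
  "ranks = For 16 nV (Seq (setv 28 (NConst 0))
     (Seq (For 29 nV
       (Cond (BAnd (BNot (NLess (NCell 27 (var 29)) (NCell 27 (var 16))))
            (BNot (BAnd (BNot (NLess (NCell 27 (var 16)) (NCell 27 (var 29)))) (NLess (var 29) (var 16)))))
         Skip (setv 28 (NAdd (var 28) (NConst 1)))))
     (NStore 30 (var 28) (var 16))))"

text \<open>Residue and row are updated incrementally, as the machine has no division. Cell 33 is
  moved on to \<open>start (Suc c)\<close> before the lookup, which is the value that
  \<open>idx\<close> refers to, and already serves as \<open>start\<close> of the next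
  class.\<close>

definition positions :: com where
  "positions = For 16 nV
     (Seq (setv 33 (NAdd (var 33) (var 10)))
     (Seq (Cond (NLess (var 31) (NSub nV (var 11))) (setv 33 (NAdd (var 33) (NConst 1))) Skip)
     (Seq (NStore 3 (var 16) (NCell 30 (NSub (NSub (var 33) (NConst 1)) (var 32))))
     (Seq (setv 31 (NAdd (var 31) (NConst 1)))
     (Cond (NLess (var 31) dV) Skip
       (Seq (setv 31 (NConst 0)) (Seq (setv 32 (NAdd (var 32) (NConst 1))) (setv 33 (NConst 0)))))))))"

definition distance_matching_program :: com where
  "distance_matching_program =
     Seq heights (Seq sizes (Seq arcs (Seq potentials (Seq solver
       (Seq collect (Seq counts (Seq keys (Seq ranks positions))))))))"

section \<open>Correctness of the stages before and after the flow solver\<close>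

lemma writes_stages [simp]:
  "nwrites heights = {10, 11}" "rwrites heights = {}"
  "nwrites arc_data = {22, 23, 24}" "rwrites arc_data = {4, 5}"
  "nwrites arcs = {5, 6, 7, 16, 22, 23, 24}" "rwrites arcs = {1, 4, 5}"
  "nwrites potentials = {16}" "rwrites potentials = {2}"
  "nwrites collect = {4, 16, 25}" "rwrites collect = {}"
  "nwrites counts = {16, 26}" "rwrites counts = {}"
  "nwrites keys = {16, 27}" "rwrites keys = {}"
  "nwrites ranks = {16, 28, 29, 30}" "rwrites ranks = {}"
  "nwrites positions = {3, 16, 31, 32, 33}" "rwrites positions = {}"
  by (auto simp: heights_def arc_data_def store_arc_def arcs_def potentials_def collect_def counts_def
      keys_def ranks_def positions_def)

text \<open>The product \<open>h * d\<close> is built by repeated addition, in at most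
  \<open>n\<close> rounds however large \<open>d\<close> is. The strict test stops one round early
  when \<open>d\<close> divides \<open>n\<close>, which gives \<open>r = d\<close> instead of
  \<open>r = 0\<close> for positive \<open>n\<close>.\<close>

lemma wp_heights:
  assumes "nat_arr \<sigma> 0 0 = n" "nat_arr \<sigma> 0 3 = d" "nat_arr \<sigma> 10 0 = 0" "nat_arr \<sigma> 11 0 = 0"
    and "0 < d" "n \<le> B"
    and Q: "\<And>\<tau> h. eqoff {10, 11} {} \<sigma> \<tau> \<Longrightarrow> nat_arr \<tau> 10 0 = h \<Longrightarrow> nat_arr \<tau> 11 0 = h * d \<Longrightarrow>
      h * d \<le> n \<Longrightarrow> n \<le> h * d + d \<Longrightarrow> Q \<tau>"
  shows "wp B heights Q \<sigma>"
  unfolding heights_def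
proof (rule wp_While_inv[where \<mu> = "\<lambda>\<tau>. n - nat_arr \<tau> 11 0"
      and I = "\<lambda>\<tau>. eqoff {10, 11} {} \<sigma> \<tau> \<and> nat_arr \<tau> 11 0 = nat_arr \<tau> 10 0 * d \<and> nat_arr \<tau> 11 0 \<le> n"])
  fix \<tau> assume I: "eqoff {10, 11} {} \<sigma> \<tau> \<and> nat_arr \<tau> 11 0 = nat_arr \<tau> 10 0 * d \<and> nat_arr \<tau> 11 0 \<le> n"
    and b: "bval (NLess (NAdd (var 11) dV) nV) \<tau>"
  then have "nat_arr \<tau> 0 = nat_arr \<sigma> 0" by (simp add: eqoff_def)
  then show "wp B (Seq (setv 11 (NAdd (var 11) dV)) (setv 10 (NAdd (var 10) (NConst 1))))
     (\<lambda>\<tau>'. (eqoff {10, 11} {} \<sigma> \<tau>' \<and> nat_arr \<tau>' 11 0 = nat_arr \<tau>' 10 0 * d \<and> nat_arr \<tau>' 11 0 \<le> n) \<and>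
       n - nat_arr \<tau>' 11 0 < n - nat_arr \<tau> 11 0) \<tau>"
    using I b assms(1,2,5) by (auto simp: eqoff_def)
next
  fix \<tau> assume I: "eqoff {10, 11} {} \<sigma> \<tau> \<and> nat_arr \<tau> 11 0 = nat_arr \<tau> 10 0 * d \<and> nat_arr \<tau> 11 0 \<le> n"
    and b: "\<not> bval (NLess (NAdd (var 11) dV) nV) \<tau>"
  then have "nat_arr \<tau> 0 = nat_arr \<sigma> 0" by (simp add: eqoff_def)
  then show "Q \<tau>" using I b assms(1,2) by (intro Q[of \<tau> "nat_arr \<tau> 10 0"]) auto
qed (use assms in simp_all)

context flow_instance
begin

definition input :: "memory \<Rightarrow> bool" where
  "input \<sigma> \<longleftrightarrow> nat_arr \<sigma> 0 0 = n \<and> nat_arr \<sigma> 0 (Suc 0) = m \<and> nat_arr \<sigma> 0 2 = ne \<and> nat_arr \<sigma> 0 3 = d \<and>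
     nat_arr \<sigma> 10 0 = h \<and> nat_arr \<sigma> 11 0 = h * d \<and>
     (\<forall>k<ne. nat_arr \<sigma> (Suc 0) k = fst (es ! k) \<and> nat_arr \<sigma> 2 k = snd (es ! k) \<and>
       real_arr \<sigma> 0 k = w (es ! k))"

lemma input_eqoff:
  "input \<sigma> \<Longrightarrow> eqoff X Y \<sigma> \<tau> \<Longrightarrow> X \<inter> {0, Suc 0, 2, 10, 11} = {} \<Longrightarrow> 0 \<notin> Y \<Longrightarrow> input \<tau>"
  by (auto simp: input_def eqoff_def)

lemma wp_arc_data:
  assumes i: "input \<tau>" and j: "nat_arr \<tau> 16 0 = j"
    and Q: "\<And>\<tau>'. eqoff {22, 23, 24} {4, 5} \<tau> \<tau>' \<Longrightarrow> nat_arr \<tau>' 22 0 = tail j \<Longrightarrow>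
      nat_arr \<tau>' 23 0 = head j \<Longrightarrow> nat_arr \<tau>' 24 0 = cap j \<Longrightarrow> real_arr \<tau>' 4 0 = cost j \<Longrightarrow>
      real_arr \<tau>' 5 0 = real_arr \<tau> 5 0 + (if j < ne then w (es ! j) else 0) \<Longrightarrow> Q \<tau>'"
  shows "wp B arc_data Q \<tau>"
proof -
  have eq: "nat_arr \<tau> 0 0 = n" "nat_arr \<tau> 0 (Suc 0) = m" "nat_arr \<tau> 0 2 = ne" "nat_arr \<tau> 10 0 = h"
    and b: "nat_arr \<tau> 11 0 = h * d"
    and edge_eq: "k < ne \<Longrightarrow> nat_arr \<tau> (Suc 0) k = fst (es ! k)" "k < ne \<Longrightarrow> nat_arr \<tau> 2 k = snd (es ! k)"
      "k < ne \<Longrightarrow> real_arr \<tau> 0 k = w (es ! k)" for k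
    using i unfolding input_def by simp_all
  have r': "n - nat_arr \<tau> 11 0 = r" unfolding b using n by simp
  show ?thesis
    unfolding arc_data_def
    by (auto simp: j eq r' edge_eq eqoff_def tail_def head_def cap_def cost_def intro!: Q)
qed

lemma wp_arcs:
  assumes i: "input \<sigma>" and A: "nat_arr \<sigma> 12 0 = A" "A \<le> B"
    and zero: "nat_arr \<sigma> 5 = (\<lambda>_. 0)" "nat_arr \<sigma> 6 = (\<lambda>_. 0)" "nat_arr \<sigma> 7 = (\<lambda>_. 0)"
      "real_arr \<sigma> 1 = (\<lambda>_. 0)" "real_arr \<sigma> 5 0 = 0"
    and Q: "\<And>\<tau>. eqoff {5, 6, 7, 16, 22, 23, 24} {1, 4, 5} \<sigma> \<tau> \<Longrightarrow> nat_arr \<tau> 5 = U \<Longrightarrow>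
      nat_arr \<tau> 6 = V \<Longrightarrow> nat_arr \<tau> 7 = R0 \<Longrightarrow> real_arr \<tau> (Suc 0) = C \<Longrightarrow>
      real_arr \<tau> 5 0 = (\<Sum>k<ne. w (es ! k)) \<Longrightarrow> Q \<tau>"
  shows "wp B arcs Q \<sigma>"
  unfolding arcs_def
proof (rule wp_For[where X = "{5, 6, 7, 16, 22, 23, 24}" and Y = "{1, 4, 5}" and N = A
      and I = "\<lambda>j \<tau>. nat_arr \<tau> 5 = fill tail head j \<and> nat_arr \<tau> 6 = fill head tail j \<and>
        nat_arr \<tau> 7 = fill cap (\<lambda>_. 0) j \<and> real_arr \<tau> (Suc 0) = fill cost (\<lambda>a. - cost a) j \<and>
        real_arr \<tau> 5 0 = (\<Sum>k<min j ne. w (es ! k))"])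
  fix j \<tau> assume j: "j < A" "nat_arr \<tau> 16 0 = j"
    and off: "eqoff {5, 6, 7, 16, 22, 23, 24} {1, 4, 5} \<sigma> \<tau>"
    and I: "nat_arr \<tau> 5 = fill tail head j \<and> nat_arr \<tau> 6 = fill head tail j \<and>
        nat_arr \<tau> 7 = fill cap (\<lambda>_. 0) j \<and> real_arr \<tau> (Suc 0) = fill cost (\<lambda>a. - cost a) j \<and>
        real_arr \<tau> 5 0 = (\<Sum>k<min j ne. w (es ! k))"
  have i': "input \<tau>" by (rule input_eqoff[OF i off]) auto
  have A': "nat_arr \<tau> 12 0 = A" using off A by (simp add: eqoff_def)
  have W: "real_arr \<tau> 5 0 + (if j < ne then w (es ! j) else 0) = (\<Sum>k<min (Suc j) ne. w (es ! k))"
    using I by (auto simp: min_def less_Suc_eq)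
  let ?Q = "\<lambda>\<tau>. nat_arr \<tau> 5 = fill tail head (Suc j) \<and> nat_arr \<tau> 6 = fill head tail (Suc j) \<and>
        nat_arr \<tau> 7 = fill cap (\<lambda>_. 0) (Suc j) \<and> real_arr \<tau> (Suc 0) = fill cost (\<lambda>a. - cost a) (Suc j) \<and>
        real_arr \<tau> 5 0 = (\<Sum>k<min (Suc j) ne. w (es ! k))"
  have "wp B arc_data (wp B store_arc (\<lambda>\<tau>. ?Q (nset 16 0 (Suc j) \<tau>))) \<tau>"
  proof (rule wp_arc_data[OF i' j(2)])
    fix \<tau>' assume off': "eqoff {22, 23, 24} {4, 5} \<tau> \<tau>'"
      and vals: "nat_arr \<tau>' 22 0 = tail j" "nat_arr \<tau>' 23 0 = head j" "nat_arr \<tau>' 24 0 = cap j"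
        "real_arr \<tau>' 4 0 = cost j" "real_arr \<tau>' 5 0 = real_arr \<tau> 5 0 + (if j < ne then w (es ! j) else 0)"
    have eq: "nat_arr \<tau>' 5 = fill tail head j" "nat_arr \<tau>' 6 = fill head tail j"
      "nat_arr \<tau>' 7 = fill cap (\<lambda>_. 0) j" "real_arr \<tau>' (Suc 0) = fill cost (\<lambda>a. - cost a) j"
      "nat_arr \<tau>' 12 0 = A" "nat_arr \<tau>' 16 0 = j"
      using off' I A' j(2) by (simp_all add: eqoff_def)
    show "wp B store_arc (\<lambda>\<tau>. ?Q (nset 16 0 (Suc j) \<tau>)) \<tau>'"
      using vals(5) unfolding store_arc_def W
      by (simp add: eq vals(1-4) fill_Suc[OF j(1)])
  qed
  then show "wp B (Seq arc_data store_arc) (\<lambda>\<tau>. ?Q (nset 16 0 (Suc j) \<tau>)) \<tau>" by simp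
next
  fix \<tau> assume "nat_arr \<tau> 5 = fill tail head A \<and> nat_arr \<tau> 6 = fill head tail A \<and>
        nat_arr \<tau> 7 = fill cap (\<lambda>_. 0) A \<and> real_arr \<tau> (Suc 0) = fill cost (\<lambda>a. - cost a) A \<and>
        real_arr \<tau> 5 0 = (\<Sum>k<min A ne. w (es ! k))"
    and off: "eqoff {5, 6, 7, 16, 22, 23, 24} {1, 4, 5} \<sigma> \<tau>"
  then show "Q \<tau>"
    by (intro Q[OF off]) (simp_all add: U_def V_def C_def R0_def A_def)
qed (use assms(2-8) in \<open>auto simp: eqoff_def fill_0 store_arc_def\<close>)

lemma wp_potentials:
  assumes i: "input \<sigma>" and N: "nat_arr \<sigma> 13 0 = N" "nat_arr \<sigma> 14 0 = src" "N \<le> B"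
    and W: "real_arr \<sigma> 5 0 = (\<Sum>k<ne. w (es ! k))" and zero: "real_arr \<sigma> 2 = (\<lambda>_. 0)"
    and Q: "\<And>\<tau>. eqoff {16} {2} \<sigma> \<tau> \<Longrightarrow> (\<And>v. v < N \<Longrightarrow> real_arr \<tau> 2 v = initial_potential v) \<Longrightarrow> Q \<tau>"
  shows "wp B potentials Q \<sigma>"
  unfolding potentials_def
proof (rule wp_For[where X = "{16}" and Y = "{2}" and N = N
      and I = "\<lambda>j \<tau>. \<forall>v. real_arr \<tau> 2 v = (if v < j then initial_potential v else 0)"])
  fix j \<tau> assume j: "j < N" "nat_arr \<tau> 16 0 = j" and off: "eqoff {16} {2} \<sigma> \<tau>"
    and I: "\<forall>v. real_arr \<tau> 2 v = (if v < j then initial_potential v else 0)"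
  have eq: "nat_arr \<tau> 0 0 = n" "nat_arr \<tau> 14 0 = src" "real_arr \<tau> 5 0 = (\<Sum>k<ne. w (es ! k))"
    using off i N W by (simp_all add: eqoff_def input_def)
  show "wp B (Cond (NLess (var 16) nV) Skip
     (Cond (BAnd (BNot (NLess (var 16) (var 14))) (BNot (NLess (var 14) (var 16)))) Skip
       (RStore 2 (var 16) (RSub (RConst 0) (rvar 5)))))
     (\<lambda>\<tau>. \<forall>v. real_arr (nset 16 0 (Suc j) \<tau>) 2 v = (if v < Suc j then initial_potential v else 0)) \<tau>"
    using I by (auto simp: eq j(2) less_Suc_eq initial_potential_def)
qed (use N zero in \<open>auto simp: eqoff_def intro!: Q\<close>)

lemma wp_collect:
  assumes i: "input \<sigma>" and A: "nat_arr \<sigma> 12 0 = A" "ne \<le> B" "n \<le> B"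
    and F: "F = flow_of (nat_arr \<sigma> 7)" and zero: "nat_arr \<sigma> 4 = (\<lambda>_. 0)"
    and M: "M = {es ! k | k. k < ne \<and> F k \<noteq> 0}"
    and unique: "\<And>s t t'. (s, t) \<in> M \<Longrightarrow> (s, t') \<in> M \<Longrightarrow> t = t'"
    and Q: "\<And>\<tau>. eqoff {4, 16, 25} {} \<sigma> \<tau> \<Longrightarrow> output_edges es \<tau> = M \<Longrightarrow>
      (\<And>s t. (s, t) \<in> M \<Longrightarrow> nat_arr \<tau> 25 s = t) \<Longrightarrow>
      (\<And>s. s < n \<Longrightarrow> s \<notin> fst ` M \<Longrightarrow> nat_arr \<tau> 25 s = m) \<Longrightarrow> Q \<tau>"
  shows "wp B collect Q \<sigma>"
proof -
  define mark where "mark = For 16 eV (Cond (NLess (NConst 0) (NCell 7 (NAdd (var 12) (var 16))))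
       (Seq (NStore 4 (var 16) (NConst 1)) (NStore 25 (NCell 1 (var 16)) (NCell 2 (var 16))))
       Skip)"
  define I where "I j \<tau> \<longleftrightarrow> (\<forall>k. nat_arr \<tau> 4 k \<noteq> 0 \<longleftrightarrow> k < j \<and> F k \<noteq> 0) \<and>
    (\<forall>k<j. F k \<noteq> 0 \<longrightarrow> nat_arr \<tau> 25 (fst (es ! k)) = snd (es ! k)) \<and>
    (\<forall>s<n. s \<notin> fst ` M \<longrightarrow> nat_arr \<tau> 25 s = m)" for j and \<tau> :: memory
  \<comment> \<open>Two chosen edges at the same node of \<open>S\<close> agree in their partner, so
    a later store into array 25 cannot spoil an earlier one.\<close>
  have same: "snd (es ! k) = snd (es ! k')"
    if "k < ne" "k' < ne" "F k \<noteq> 0" "F k' \<noteq> 0" "fst (es ! k) = fst (es ! k')" for k k'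
  proof -
    have "es ! k \<in> M" "es ! k' \<in> M" using that by (auto simp: M)
    then have "(fst (es ! k), snd (es ! k)) \<in> M" "(fst (es ! k), snd (es ! k')) \<in> M"
      using that(5) by (metis prod.collapse)+
    then show ?thesis by (rule unique)
  qed
  have "wp B (For 16 nV (NStore 25 (var 16) mV)) (wp B mark Q) \<sigma>"
  proof (rule wp_For[where X = "{4, 16, 25}" and Y = "{}" and N = n
        and I = "\<lambda>j \<tau>. nat_arr \<tau> 4 = (\<lambda>_. 0) \<and> (\<forall>s<j. nat_arr \<tau> 25 s = m)"])
    fix \<sigma>1 assume 1: "nat_arr \<sigma>1 4 = (\<lambda>_. 0) \<and> (\<forall>s<n. nat_arr \<sigma>1 25 s = m)"
      and off1: "eqoff {4, 16, 25} {} \<sigma> \<sigma>1"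
    show "wp B mark Q \<sigma>1"
      unfolding mark_def
    proof (rule wp_For[where X = "{4, 16, 25}" and Y = "{}" and N = ne and I = I])
      show "I 0 (nset 16 0 0 \<sigma>1)" using 1 by (simp add: I_def)
    next
      fix j \<tau> assume j: "j < ne" "nat_arr \<tau> 16 0 = j" and I: "I j \<tau>" and "eqoff {4, 16, 25} {} \<sigma>1 \<tau>"
      then have off: "eqoff {4, 16, 25} {} \<sigma> \<tau>" using off1 eqoff_trans by blast
      have eq: "nat_arr \<tau> 7 (A + j) = F j" "nat_arr \<tau> 12 0 = A" "nat_arr \<tau> (Suc 0) j = fst (es ! j)"
        "nat_arr \<tau> 2 j = snd (es ! j)"
        using off i A j F by (simp_all add: eqoff_def input_def)
      have inM: "fst (es ! j) \<in> fst ` M" if "F j \<noteq> 0" using that j(1) by (auto simp: M)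
      show "wp B (Cond (NLess (NConst 0) (NCell 7 (NAdd (var 12) (var 16))))
       (Seq (NStore 4 (var 16) (NConst 1)) (NStore 25 (NCell 1 (var 16)) (NCell 2 (var 16))))
       Skip) (\<lambda>\<tau>. I (Suc j) (nset 16 0 (Suc j) \<tau>)) \<tau>"
      proof (cases "F j = 0")
        case True
        then show ?thesis using I by (auto simp: I_def j(2) eq less_Suc_eq)
      next
        case False
        have "I (Suc j) (nset 16 0 (Suc j) (nset 25 (fst (es ! j)) (snd (es ! j)) (nset 4 j (Suc 0) \<tau>)))"
          unfolding I_def
        proof (intro conjI allI impI)
          fix k assume k: "k < Suc j" "F k \<noteq> 0"
          show "nat_arr (nset 16 0 (Suc j) (nset 25 (fst (es ! j)) (snd (es ! j)) (nset 4 j (Suc 0) \<tau>)))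
              25 (fst (es ! k)) = snd (es ! k)"
          proof (cases "fst (es ! k) = fst (es ! j)")
            case True
            then show ?thesis using same[of k j] k False j(1) by simp
          next
            case neq: False
            then have "k \<noteq> j" by auto
            then show ?thesis using neq I k by (simp add: I_def)
          qed
        next
          fix s assume "s < n" "s \<notin> fst ` M"
          moreover from this have "s \<noteq> fst (es ! j)" using inM[OF False] by auto
          ultimately show "nat_arr (nset 16 0 (Suc j) (nset 25 (fst (es ! j)) (snd (es ! j))
              (nset 4 j (Suc 0) \<tau>))) 25 s = m"
            using I by (simp add: I_def)
        qed (use I False in \<open>auto simp: I_def less_Suc_eq\<close>)
        then show ?thesis using False by (simp add: j(2) eq)
      qed
    next
      fix \<tau> assume I: "I ne \<tau>" and "eqoff {4, 16, 25} {} \<sigma>1 \<tau>"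
      then have off: "eqoff {4, 16, 25} {} \<sigma> \<tau>" using off1 eqoff_trans by blast
      show "Q \<tau>"
      proof (rule Q[OF off])
        show "output_edges es \<tau> = M" using I by (auto simp: output_edges_def M I_def)
        fix s t assume "(s, t) \<in> M"
        then obtain k where k: "es ! k = (s, t)" "k < ne" "F k \<noteq> 0" unfolding M by auto
        then have "nat_arr \<tau> 25 (fst (es ! k)) = snd (es ! k)" using I unfolding I_def by blast
        then show "nat_arr \<tau> 25 s = t" unfolding k(1) by simp
      qed (use I in \<open>auto simp: I_def\<close>)
    next
      fix \<tau> assume "eqoff {4, 16, 25} {} \<sigma>1 \<tau>"
      then have "eqoff {4, 16, 25} {} \<sigma> \<tau>" using off1 eqoff_trans by blast
      then show "nval eV \<tau> = ne" using i by (simp add: eqoff_def input_def)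
    qed (use A in auto)
  next
    fix j \<tau> assume "j < n" "nat_arr \<tau> 16 0 = j" "eqoff {4, 16, 25} {} \<sigma> \<tau>"
      "nat_arr \<tau> 4 = (\<lambda>_. 0) \<and> (\<forall>s<j. nat_arr \<tau> 25 s = m)"
    then show "wp B (NStore 25 (var 16) mV) (\<lambda>\<tau>. nat_arr (nset 16 0 (Suc j) \<tau>) 4 = (\<lambda>_. 0) \<and>
        (\<forall>s<Suc j. nat_arr (nset 16 0 (Suc j) \<tau>) 25 s = m)) \<tau>"
      using i by (simp add: eqoff_def input_def less_Suc_eq)
  qed (use i A zero in \<open>auto simp: eqoff_def input_def\<close>)
  then show ?thesis by (simp add: collect_def mark_def)
qed

end

section \<open>Correctness of the ordering stages\<close>

context arrangement
begin

definition params :: "memory \<Rightarrow> bool" where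
  "params \<sigma> \<longleftrightarrow> nat_arr \<sigma> 0 0 = n \<and> nat_arr \<sigma> 0 (Suc 0) = m \<and> nat_arr \<sigma> 0 3 = d \<and>
     nat_arr \<sigma> 10 0 = h \<and> nat_arr \<sigma> 11 0 = h * d \<and> nat_arr \<sigma> 25 = mt"

lemma params_eqoff:
  "params \<sigma> \<Longrightarrow> eqoff X Y \<sigma> \<tau> \<Longrightarrow> X \<inter> {0, 10, 11, 25} = {} \<Longrightarrow> params \<tau>"
  by (auto simp: params_def eqoff_def)

lemma card_less_Suc:
  "card {x. x < Suc j \<and> P x} = card {x. x < j \<and> P x} + (if P j then 1 else 0)"
proof -
  have "{x. x < Suc j \<and> P x} = (if P j then insert j {x. x < j \<and> P x} else {x. x < j \<and> P x})"
    by (auto simp: less_Suc_eq)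
  then show ?thesis by simp
qed

lemma wp_counts:
  assumes "params \<sigma>" "n \<le> B" "nat_arr \<sigma> 26 = (\<lambda>_. 0)"
    and Q: "\<And>\<tau>. eqoff {16, 26} {} \<sigma> \<tau> \<Longrightarrow> nat_arr \<tau> 26 = cnt \<Longrightarrow> Q \<tau>"
  shows "wp B counts Q \<sigma>"
  unfolding counts_def
proof (rule wp_For[where X = "{16, 26}" and Y = "{}" and N = n
      and I = "\<lambda>j \<tau>. nat_arr \<tau> 26 = (\<lambda>t. card {s. s < j \<and> mt s = t})"])
  fix j \<tau> assume j: "nat_arr \<tau> 16 0 = j" and off: "eqoff {16, 26} {} \<sigma> \<tau>"
    and I: "nat_arr \<tau> 26 = (\<lambda>t. card {s. s < j \<and> mt s = t})"
  have "nat_arr \<tau> 25 = mt" using params_eqoff[OF assms(1) off] by (simp add: params_def)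
  then show "wp B (NStore 26 (NCell 25 (var 16)) (NAdd (NCell 26 (NCell 25 (var 16))) (NConst 1)))
     (\<lambda>\<tau>. nat_arr (nset 16 0 (Suc j) \<tau>) 26 = (\<lambda>t. card {s. s < Suc j \<and> mt s = t})) \<tau>"
    using I by (auto simp: j card_less_Suc fun_eq_iff)
next
  fix \<tau> assume "nat_arr \<tau> 26 = (\<lambda>t. card {s. s < n \<and> mt s = t})" "eqoff {16, 26} {} \<sigma> \<tau>"
  then show "Q \<tau>" by (intro Q) (auto simp: cnt_def)
qed (use assms(1-3) in \<open>auto simp: eqoff_def params_def\<close>)

lemma wp_keys:
  assumes "params \<sigma>" "n \<le> B" "nat_arr \<sigma> 26 = cnt"
    and Q: "\<And>\<tau>. eqoff {16, 27} {} \<sigma> \<tau> \<Longrightarrow> (\<And>s. s < n \<Longrightarrow> nat_arr \<tau> 27 s = key s) \<Longrightarrow> Q \<tau>"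
  shows "wp B keys Q \<sigma>"
  unfolding keys_def
proof (rule wp_For[where X = "{16, 27}" and Y = "{}" and N = n
      and I = "\<lambda>j \<tau>. \<forall>s<j. nat_arr \<tau> 27 s = key s"])
  fix j \<tau> assume j: "nat_arr \<tau> 16 0 = j" and off: "eqoff {16, 27} {} \<sigma> \<tau>"
    and I: "\<forall>s<j. nat_arr \<tau> 27 s = key s"
  have eq: "nat_arr \<tau> 25 = mt" "nat_arr \<tau> 0 (Suc 0) = m" "nat_arr \<tau> 10 0 = h" "nat_arr \<tau> 26 = cnt"
    using off assms(1,3) by (simp_all add: params_def eqoff_def)
  show "wp B (Cond (BAnd (NLess (NCell 25 (var 16)) mV) (NLess (var 10) (NCell 26 (NCell 25 (var 16)))))
       (NStore 27 (var 16) (NCell 25 (var 16)))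
       (NStore 27 (var 16) (NAdd (NAdd (NCell 25 (var 16)) mV) (NConst 1))))
     (\<lambda>\<tau>. \<forall>s<Suc j. nat_arr (nset 16 0 (Suc j) \<tau>) 27 s = key s) \<tau>"
    using I by (auto simp: j eq less_Suc_eq key_def)
qed (use assms(1,2) in \<open>auto simp: eqoff_def params_def intro!: Q\<close>)

lemma wp_ranks:
  assumes "params \<sigma>" "n \<le> B" "\<And>s. s < n \<Longrightarrow> nat_arr \<sigma> 27 s = key s"
    and Q: "\<And>\<tau>. eqoff {16, 28, 29, 30} {} \<sigma> \<tau> \<Longrightarrow> (\<And>s. s < n \<Longrightarrow> nat_arr \<tau> 30 (rank s) = s) \<Longrightarrow> Q \<tau>"
  shows "wp B ranks Q \<sigma>"
  unfolding ranks_def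
proof (rule wp_For[where X = "{16, 28, 29, 30}" and Y = "{}" and N = n
      and I = "\<lambda>j \<tau>. \<forall>s<j. nat_arr \<tau> 30 (rank s) = s"])
  fix s \<tau> assume s: "s < n" "nat_arr \<tau> 16 0 = s" and off: "eqoff {16, 28, 29, 30} {} \<sigma> \<tau>"
    and I: "\<forall>s'<s. nat_arr \<tau> 30 (rank s') = s'"
  let ?Q = "\<lambda>\<tau>. \<forall>s'<Suc s. nat_arr (nset 16 0 (Suc s) \<tau>) 30 (rank s') = s'"
  have "wp B (For 29 nV
       (Cond (BAnd (BNot (NLess (NCell 27 (var 29)) (NCell 27 (var 16))))
            (BNot (BAnd (BNot (NLess (NCell 27 (var 16)) (NCell 27 (var 29)))) (NLess (var 29) (var 16)))))
         Skip (setv 28 (NAdd (var 28) (NConst 1)))))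
     (wp B (NStore 30 (var 28) (var 16)) ?Q) (nset 28 0 0 \<tau>)"
  proof (rule wp_For[where X = "{28, 29}" and Y = "{}" and N = n
        and I = "\<lambda>j \<tau>. nat_arr \<tau> 28 0 = card {x. x < j \<and> before x s}"])
    fix j \<tau>' assume j: "j < n" "nat_arr \<tau>' 29 0 = j" and off': "eqoff {28, 29} {} (nset 28 0 0 \<tau>) \<tau>'"
      and I': "nat_arr \<tau>' 28 0 = card {x. x < j \<and> before x s}"
    have eq: "nat_arr \<tau>' 27 j = key j" "nat_arr \<tau>' 27 s = key s" "nat_arr \<tau>' 16 0 = s"
      using off off' j s assms(3) by (simp_all add: eqoff_def)
    have "before j s \<longleftrightarrow> key j < key s \<or> \<not> key s < key j \<and> j < s" by (auto simp: before_def)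
    then show "wp B (Cond (BAnd (BNot (NLess (NCell 27 (var 29)) (NCell 27 (var 16))))
            (BNot (BAnd (BNot (NLess (NCell 27 (var 16)) (NCell 27 (var 29)))) (NLess (var 29) (var 16)))))
         Skip (setv 28 (NAdd (var 28) (NConst 1))))
       (\<lambda>\<tau>. nat_arr (nset 29 0 (Suc j) \<tau>) 28 0 = card {x. x < Suc j \<and> before x s}) \<tau>'"
      using I' by (auto simp: j(2) eq card_less_Suc)
  next
    fix \<tau>' assume "nat_arr \<tau>' 28 0 = card {x. x < n \<and> before x s}"
      and off': "eqoff {28, 29} {} (nset 28 0 0 \<tau>) \<tau>'"
    then have "nat_arr \<tau>' 28 0 = rank s" "nat_arr \<tau>' 16 0 = s" "nat_arr \<tau>' 30 = nat_arr \<tau> 30"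
      using s by (simp_all add: rank_def eqoff_def)
    \<comment> \<open>Ranks are distinct, so the entries written in earlier rounds survive.\<close>
    moreover have "rank s' \<noteq> rank s" if "s' < s" for s'
      using that s(1) inj_on_rank by (auto simp: inj_on_def)
    ultimately show "wp B (NStore 30 (var 28) (var 16)) ?Q \<tau>'"
      using I by (auto simp: less_Suc_eq)
  qed (use assms(1,2) off in \<open>auto simp: eqoff_def params_def\<close>)
  then show "wp B (Seq (setv 28 (NConst 0))
     (Seq (For 29 nV
       (Cond (BAnd (BNot (NLess (NCell 27 (var 29)) (NCell 27 (var 16))))
            (BNot (BAnd (BNot (NLess (NCell 27 (var 16)) (NCell 27 (var 29)))) (NLess (var 29) (var 16)))))
         Skip (setv 28 (NAdd (var 28) (NConst 1)))))
     (NStore 30 (var 28) (var 16)))) ?Q \<tau>" by simp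
qed (use assms(1,2) in \<open>auto simp: eqoff_def params_def intro!: Q\<close>)

lemma start_Suc: "start (Suc c) = start c + h + (if c < r then 1 else 0)"
  by (auto simp: start_def)

lemma wp_positions:
  assumes "params \<sigma>" "n \<le> B" "nat_arr \<sigma> 31 0 = 0" "nat_arr \<sigma> 32 0 = 0" "nat_arr \<sigma> 33 0 = 0"
    and Q: "\<And>\<tau>. eqoff {3, 16, 31, 32, 33} {} \<sigma> \<tau> \<Longrightarrow>
      (\<And>p. p < n \<Longrightarrow> nat_arr \<tau> 3 p = nat_arr \<sigma> 30 (idx p)) \<Longrightarrow> Q \<tau>"
  shows "wp B positions Q \<sigma>"
  unfolding positions_def
proof (rule wp_For[where X = "{3, 16, 31, 32, 33}" and Y = "{}" and N = n
      and I = "\<lambda>j \<tau>. nat_arr \<tau> 31 0 = j mod d \<and> nat_arr \<tau> 32 0 = j div d \<and>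
        nat_arr \<tau> 33 0 = start (j mod d) \<and> (\<forall>p<j. nat_arr \<tau> 3 p = nat_arr \<sigma> 30 (idx p))"])
  fix j \<tau> assume j: "nat_arr \<tau> 16 0 = j" and off: "eqoff {3, 16, 31, 32, 33} {} \<sigma> \<tau>"
    and I: "nat_arr \<tau> 31 0 = j mod d \<and> nat_arr \<tau> 32 0 = j div d \<and>
        nat_arr \<tau> 33 0 = start (j mod d) \<and> (\<forall>p<j. nat_arr \<tau> 3 p = nat_arr \<sigma> 30 (idx p))"
  have eq: "nat_arr \<tau> 0 0 = n" "nat_arr \<tau> 0 3 = d" "nat_arr \<tau> 10 0 = h" "nat_arr \<tau> 11 0 = h * d"
    "nat_arr \<tau> 30 = nat_arr \<sigma> 30"
    using off assms(1) by (simp_all add: params_def eqoff_def)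
  have r': "n - h * d = r" unfolding n by simp
  have I': "nat_arr \<tau> 31 0 = j mod d" "nat_arr \<tau> 32 0 = j div d" "nat_arr \<tau> 33 0 = start (j mod d)"
    "\<And>p. p < j \<Longrightarrow> nat_arr \<tau> 3 p = nat_arr \<sigma> 30 (idx p)"
    using I by auto
  have idx: "idx j = start (j mod d) + h + (if j mod d < r then 1 else 0) - Suc 0 - j div d"
    by (simp add: idx_def start_Suc)
  have "j mod d < d" using d by simp
  \<comment> \<open>Either the next position is in the next class of the same row, or the row is
    complete and the next one begins with class 0.\<close>
  then consider "Suc (j mod d) < d" "Suc j mod d = Suc (j mod d)" "Suc j div d = j div d"
    | "Suc (j mod d) = d" "Suc j mod d = 0" "Suc j div d = Suc (j div d)"
    by (cases "Suc (j mod d) = d") (auto simp: mod_Suc div_Suc)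
  then show "wp B (Seq (setv 33 (NAdd (var 33) (var 10)))
     (Seq (Cond (NLess (var 31) (NSub nV (var 11))) (setv 33 (NAdd (var 33) (NConst 1))) Skip)
     (Seq (NStore 3 (var 16) (NCell 30 (NSub (NSub (var 33) (NConst 1)) (var 32))))
     (Seq (setv 31 (NAdd (var 31) (NConst 1)))
     (Cond (NLess (var 31) dV) Skip
       (Seq (setv 31 (NConst 0)) (Seq (setv 32 (NAdd (var 32) (NConst 1))) (setv 33 (NConst 0)))))))))
     (\<lambda>\<tau>. nat_arr (nset 16 0 (Suc j) \<tau>) 31 0 = Suc j mod d \<and>
        nat_arr (nset 16 0 (Suc j) \<tau>) 32 0 = Suc j div d \<and>
        nat_arr (nset 16 0 (Suc j) \<tau>) 33 0 = start (Suc j mod d) \<and>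
        (\<forall>p<Suc j. nat_arr (nset 16 0 (Suc j) \<tau>) 3 p = nat_arr \<sigma> 30 (idx p))) \<tau>"
  proof cases
    case 1
    then show ?thesis by (auto simp: j eq r' I' less_Suc_eq start_Suc idx)
  next
    case 2
    then show ?thesis by (auto simp: j eq r' I' less_Suc_eq start_Suc idx start_def[of 0])
  qed
qed (use assms(1-5) in \<open>auto simp: eqoff_def params_def start_def intro!: Q\<close>)

lemma wp_ordering:
  assumes "params \<sigma>" "n \<le> B" "nat_arr \<sigma> 26 = (\<lambda>_. 0)"
    and "nat_arr \<sigma> 31 0 = 0" "nat_arr \<sigma> 32 0 = 0" "nat_arr \<sigma> 33 0 = 0"
    and le: "\<And>t. t < m \<Longrightarrow> cnt t \<le> Suc h"
    and full: "card {t. t < m \<and> cnt t = Suc h} \<le> r"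
    and Q: "\<And>\<tau>. nat_arr \<tau> 4 = nat_arr \<sigma> 4 \<Longrightarrow> output_ordering n \<tau> \<in> permutations_of_set {..<n} \<Longrightarrow>
      (\<And>p p'. p < n \<Longrightarrow> p' < n \<Longrightarrow> p \<noteq> p' \<Longrightarrow>
        mt (output_ordering n \<tau> ! p) = mt (output_ordering n \<tau> ! p') \<Longrightarrow>
        mt (output_ordering n \<tau> ! p) < m \<Longrightarrow> int d \<le> \<bar>int p - int p'\<bar>) \<Longrightarrow> Q \<tau>"
  shows "wp B (Seq counts (Seq keys (Seq ranks positions))) Q \<sigma>"
proof -
  have "wp B counts (wp B keys (wp B ranks (wp B positions Q))) \<sigma>"
  proof (rule wp_counts[OF assms(1-3)])
    fix \<sigma>1 assume 1: "eqoff {16, 26} {} \<sigma> \<sigma>1" "nat_arr \<sigma>1 26 = cnt"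
    have p1: "params \<sigma>1" by (rule params_eqoff[OF assms(1) 1(1)]) simp
    show "wp B keys (wp B ranks (wp B positions Q)) \<sigma>1"
    proof (rule wp_keys[OF p1 assms(2) 1(2)])
      fix \<sigma>2 assume 2: "eqoff {16, 27} {} \<sigma>1 \<sigma>2" "\<And>s. s < n \<Longrightarrow> nat_arr \<sigma>2 27 s = key s"
      have p2: "params \<sigma>2" by (rule params_eqoff[OF p1 2(1)]) simp
      show "wp B ranks (wp B positions Q) \<sigma>2"
      proof (rule wp_ranks[OF p2 assms(2) 2(2)])
        fix \<sigma>3 assume 3: "eqoff {16, 28, 29, 30} {} \<sigma>2 \<sigma>3"
          "\<And>s. s < n \<Longrightarrow> nat_arr \<sigma>3 30 (rank s) = s"
        have p3: "params \<sigma>3" by (rule params_eqoff[OF p2 3(1)]) simp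
        have zero: "nat_arr \<sigma>3 31 0 = 0" "nat_arr \<sigma>3 32 0 = 0" "nat_arr \<sigma>3 33 0 = 0"
          using 1(1) 2(1) 3(1) assms(4-6) by (simp_all add: eqoff_def)
        show "wp B positions Q \<sigma>3"
        proof (rule wp_positions[OF p3 assms(2) zero])
          fix \<tau> assume 4: "eqoff {3, 16, 31, 32, 33} {} \<sigma>3 \<tau>"
            "\<And>p. p < n \<Longrightarrow> nat_arr \<tau> 3 p = nat_arr \<sigma>3 30 (idx p)"
          have ss: "output_ordering n \<tau> ! p < n" "rank (output_ordering n \<tau> ! p) = idx p"
            if "p < n" for p
          proof -
            \<comment> \<open>Array 30 inverts \<open>rank\<close>, so position \<open>p\<close>
              receives the node whose rank is \<open>idx p\<close>.\<close>
            obtain s where "s < n" "rank s = idx p" using rank_surj idx_less \<open>p < n\<close> by blast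
            then show "output_ordering n \<tau> ! p < n" "rank (output_ordering n \<tau> ! p) = idx p"
              using 3(2)[of s] 4(2) that by (simp_all add: output_ordering_def)
          qed
          have "length (output_ordering n \<tau>) = n" by (simp add: output_ordering_def)
          note arranged[OF le full this ss]
          moreover have "nat_arr \<tau> 4 = nat_arr \<sigma> 4"
            using 1(1) 2(1) 3(1) 4(1) by (simp add: eqoff_def)
          ultimately show "Q \<tau>" by (intro Q)
        qed
      qed
    qed
  qed
  then show ?thesis by simp
qed

end

section \<open>Composition of the stages and the time bound\<close>

context flow_instance
begin

lemma wp_program:
  assumes i: "input \<sigma>" and B: "B = 4 * (n + m + ne) + 4"
    and zero: "\<And>a. a \<notin> {0, 1, 2, 10, 11} \<Longrightarrow> nat_arr \<sigma> a = (\<lambda>_. 0)"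
      "\<And>a. a \<noteq> 0 \<Longrightarrow> real_arr \<sigma> a = (\<lambda>_. 0)"
    and Q: "\<And>\<tau>. output_ordering n \<tau> \<in> permutations_of_set {..<n} \<Longrightarrow>
      distance_matching d (set es) (output_ordering n \<tau>) (output_edges es \<tau>) \<Longrightarrow>
      (\<And>ss M. ss \<in> permutations_of_set {..<n} \<Longrightarrow> distance_matching d (set es) ss M \<Longrightarrow>
        sum w M \<le> sum w (output_edges es \<tau>)) \<Longrightarrow> Q \<tau>"
  shows "wp B (Seq sizes (Seq arcs (Seq potentials (Seq solver
       (Seq collect (Seq counts (Seq keys (Seq ranks positions)))))))) Q \<sigma>"
proof -
  \<comment> \<open>The factor 4 in \<open>B\<close> is there for \<open>A + A\<close>, in which
    \<open>m\<close> occurs four times; the summand 4 covers the constant in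
    \<open>N\<close>.\<close>
  have le: "N \<le> B" "A \<le> B" "A + A \<le> B" "ne \<le> B" "n \<le> B" "n < B"
    by (simp_all add: B N_def A_def)
  define rest where "rest = Seq counts (Seq keys (Seq ranks positions))"
  define \<sigma>1 where "\<sigma>1 = nset 15 0 snk (nset 14 0 src (nset 13 0 N (nset 12 0 A \<sigma>)))"
  have off1: "eqoff {12, 13, 14, 15} {} \<sigma> \<sigma>1" by (simp add: \<sigma>1_def eqoff_def)
  have i1: "input \<sigma>1" by (rule input_eqoff[OF i off1]) auto
  have A1: "nat_arr \<sigma>1 12 0 = A" by (simp add: \<sigma>1_def)
  have z1: "nat_arr \<sigma>1 5 = (\<lambda>_. 0)" "nat_arr \<sigma>1 6 = (\<lambda>_. 0)" "nat_arr \<sigma>1 7 = (\<lambda>_. 0)"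
    "real_arr \<sigma>1 1 = (\<lambda>_. 0)" "real_arr \<sigma>1 5 0 = 0"
    using zero by (simp_all add: \<sigma>1_def)
  have "wp B arcs (wp B potentials (wp B solver (wp B collect (wp B rest Q)))) \<sigma>1"
  proof (rule wp_arcs[OF i1 A1 le(2) z1])
    fix \<sigma>2 assume off2: "eqoff {5, 6, 7, 16, 22, 23, 24} {1, 4, 5} \<sigma>1 \<sigma>2" and
      net2: "nat_arr \<sigma>2 5 = U" "nat_arr \<sigma>2 6 = V" "nat_arr \<sigma>2 7 = R0" "real_arr \<sigma>2 (Suc 0) = C" and
      W: "real_arr \<sigma>2 5 0 = (\<Sum>k<ne. w (es ! k))"
    have i2: "input \<sigma>2" by (rule input_eqoff[OF i1 off2]) auto
    have eq2: "nat_arr \<sigma>2 12 0 = A" "nat_arr \<sigma>2 13 0 = N" "nat_arr \<sigma>2 14 0 = src" "nat_arr \<sigma>2 15 0 = snk"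
      "real_arr \<sigma>2 2 = (\<lambda>_. 0)"
      using off2 zero by (simp_all add: eqoff_def \<sigma>1_def)
    show "wp B potentials (wp B solver (wp B collect (wp B rest Q))) \<sigma>2"
    proof (rule wp_potentials[OF i2 eq2(2,3) le(1) W eq2(5)])
      fix \<sigma>3 assume off3: "eqoff {16} {2} \<sigma>2 \<sigma>3"
        and \<pi>: "\<And>v. v < N \<Longrightarrow> real_arr \<sigma>3 2 v = initial_potential v"
      have i3: "input \<sigma>3" by (rule input_eqoff[OF i2 off3]) auto
      have st: "stored \<sigma>3" and R0: "R0 = nat_arr \<sigma>3 7"
        using net2 eq2 off3 by (simp_all add: stored_def eqoff_def)
      have run3: "nat_arr \<sigma>3 18 0 = 0"
        using zero(1)[of 18] off1 off2 off3 by (simp add: eqoff_def)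
      have feas: "feasible R0 (real_arr \<sigma>3 2)"
        using feasible_initial feasible_cong[of "real_arr \<sigma>3 2" initial_potential R0] \<pi> by blast
      have src: "(\<Sum>a<A. if U a = src then cap a else 0) < B" using cap_src le by simp
      show "wp B solver (wp B collect (wp B rest Q)) \<sigma>3"
      proof (rule wp_solver[OF st le(1,3) src R0 run3 residual_initial feas net_initial])
        fix \<sigma>4 F assume off4: "eqoff {7, 8, 9, 16, 17, 18, 19, 20, 21} {2, 3} \<sigma>3 \<sigma>4"
          and F: "F = flow_of (nat_arr \<sigma>4 7)" "is_flow cap F"
          and opt: "\<And>F'. is_flow cap F' \<Longrightarrow> (\<Sum>a<A. C a * real (F a)) \<le> (\<Sum>a<A. C a * real (F' a))"
        have i4: "input \<sigma>4" by (rule input_eqoff[OF i3 off4]) auto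
        define M where "M = {es ! k | k. k < ne \<and> F k \<noteq> 0}"
        note M = matching_of_flow[OF F(2) M_def]
        have eq4: "nat_arr \<sigma>4 12 0 = A" "nat_arr \<sigma>4 4 = (\<lambda>_. 0)"
          using zero(1)[of 4] eq2 off1 off2 off3 off4 by (simp_all add: eqoff_def)
        show "wp B collect (wp B rest Q) \<sigma>4"
        proof (rule wp_collect[OF i4 eq4(1) le(4,5) F(1) eq4(2) M_def M(2)])
          fix \<sigma>5 assume off5: "eqoff {4, 16, 25} {} \<sigma>4 \<sigma>5" and out: "output_edges es \<sigma>5 = M"
            and mt: "\<And>s t. (s, t) \<in> M \<Longrightarrow> nat_arr \<sigma>5 25 s = t"
              "\<And>s. s < n \<Longrightarrow> s \<notin> fst ` M \<Longrightarrow> nat_arr \<sigma>5 25 s = m"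
          have i5: "input \<sigma>5" by (rule input_eqoff[OF i4 off5]) auto
          interpret arr: arrangement n m d h r "nat_arr \<sigma>5 25"
            using n r d by unfold_locales
          \<comment> \<open>An unmatched node has the entry \<open>m\<close>, so an entry below
            \<open>m\<close> always comes from an edge of \<open>M\<close>.\<close>
          have cnt: "arr.cnt t = card {s. (s, t) \<in> M}" if "t < m" for t
          proof -
            have "s < n \<and> nat_arr \<sigma>5 25 s = t \<longleftrightarrow> (s, t) \<in> M" for s
            proof
              assume s: "s < n \<and> nat_arr \<sigma>5 25 s = t"
              then have "s \<in> fst ` M" using mt(2)[of s] that by auto
              then obtain t' where "(s, t') \<in> M" by auto
              with mt(1)[OF this] s show "(s, t) \<in> M" by simp
            next
              assume "(s, t) \<in> M"
              then show "s < n \<and> nat_arr \<sigma>5 25 s = t" using mt(1) M(1) edges by auto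
            qed
            then show ?thesis by (simp add: arr.cnt_def)
          qed
          have p5: "arr.params \<sigma>5" using i5 by (simp add: arr.params_def input_def)
          have zero5: "nat_arr \<sigma>5 26 = (\<lambda>_. 0)" "nat_arr \<sigma>5 31 0 = 0" "nat_arr \<sigma>5 32 0 = 0"
            "nat_arr \<sigma>5 33 0 = 0"
            using zero(1)[of 26] zero(1)[of 31] zero(1)[of 32] zero(1)[of 33] off1 off2 off3 off4 off5
            by (simp_all add: eqoff_def)
          have "{t. t < m \<and> arr.cnt t = Suc h} = {t. t < m \<and> card {s. (s, t) \<in> M} = Suc h}"
            using cnt by auto
          then have full: "card {t. t < m \<and> arr.cnt t = Suc h} \<le> r" using M(4) by simp
          show "wp B rest Q \<sigma>5"
            unfolding rest_def
          proof (rule arr.wp_ordering[OF p5 le(5) zero5 _ full])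
            fix t assume "t < m"
            then show "arr.cnt t \<le> Suc h" using cnt M(3) by simp
          next
            fix \<tau> assume \<tau>: "nat_arr \<tau> 4 = nat_arr \<sigma>5 4"
              "output_ordering n \<tau> \<in> permutations_of_set {..<n}"
              "\<And>p p'. p < n \<Longrightarrow> p' < n \<Longrightarrow> p \<noteq> p' \<Longrightarrow>
                nat_arr \<sigma>5 25 (output_ordering n \<tau> ! p) = nat_arr \<sigma>5 25 (output_ordering n \<tau> ! p') \<Longrightarrow>
                nat_arr \<sigma>5 25 (output_ordering n \<tau> ! p) < m \<Longrightarrow> int d \<le> \<bar>int p - int p'\<bar>"
            have out': "output_edges es \<tau> = M" using out \<tau>(1) by (simp add: output_edges_def)
            show "Q \<tau>"
            proof (rule Q[OF \<tau>(2)])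
              show "distance_matching d (set es) (output_ordering n \<tau>) (output_edges es \<tau>)"
                unfolding distance_matching_def out'
              proof (intro conjI allI impI ballI)
                fix s
                have "e = e'" if "e \<in> {e \<in> M. fst e = s}" "e' \<in> {e \<in> M. fst e = s}" for e e'
                  using that M(2)[of s "snd e" "snd e'"] by (cases e; cases e') auto
                moreover have "finite {e \<in> M. fst e = s}"
                  by (rule finite_subset[of _ "set es"]) (use M(1) in auto)
                ultimately show "card {e \<in> M. fst e = s} \<le> 1"
                  unfolding One_nat_def by (subst card_le_Suc0_iff_eq) blast+
              next
                fix t p p'
                assume "p < length (output_ordering n \<tau>)" "p' < length (output_ordering n \<tau>)"
                  and st: "(output_ordering n \<tau> ! p, t) \<in> M \<and> (output_ordering n \<tau> ! p', t) \<in> M \<and> p \<noteq> p'"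
                then have "p < n" "p' < n" by (simp_all add: output_ordering_def)
                moreover have "t < m" using st M(1) edges by auto
                ultimately show "int d \<le> \<bar>int p - int p'\<bar>"
                  using st mt(1) by (intro \<tau>(3)) auto
              qed (rule M(1))
            next
              fix ss M' assume "ss \<in> permutations_of_set {..<n}" "distance_matching d (set es) ss M'"
              from cost_le_of_distance_matching[OF opt this] show "sum w M' \<le> sum w (output_edges es \<tau>)"
                by (simp add: out' M(5))
            qed
          qed
        qed
      qed
    qed
  qed
  moreover have "nat_arr \<sigma> 0 0 = n" "nat_arr \<sigma> 0 (Suc 0) = m" "nat_arr \<sigma> 0 2 = ne"
    using i by (simp_all add: input_def)
  then have "wp B sizes P \<sigma> = P \<sigma>1" for P
    by (simp add: sizes_def \<sigma>1_def A_def node_defs)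
  ultimately show ?thesis by (simp add: rest_def)
qed

end

theorem theorem5:
  "\<exists>(P :: com) (p :: nat poly).
     \<forall>(n :: nat) (m :: nat) (es :: (nat \<times> nat) list) (w :: nat \<times> nat \<Rightarrow> real) (d :: nat).
       bipartite_graph {..<n} {..<m} (set es) \<and> distinct es \<and>
       (\<forall>e\<in>set es. 0 \<le> w e) \<and> 0 < d \<longrightarrow>
       (\<exists>k \<tau> ss M.
          run P (input_memory n m es w d) k \<tau> \<and>
          k \<le> poly p (n + m + length es) \<and>
          ss = output_ordering n \<tau> \<and>
          M = output_edges es \<tau> \<and>
          ss \<in> permutations_of_set {..<n} \<and>
          distance_matching d (set es) ss M \<and>
          (\<forall>ss' M'. ss' \<in> permutations_of_set {..<n} \<and> distance_matching d (set es) ss' M' \<longrightarrow>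
             sum w M' \<le> sum w M))"
proof -
  \<comment> \<open>\<open>[:4, 4:]\<close> is the loop bound of \<open>wp_program\<close> as a
    polynomial in the size of the graph; neither \<open>d\<close> nor the weights enter it.\<close>
  obtain p where p: "\<And>x. tm distance_matching_program (poly [:4, 4:] x) = poly p x"
    using tm_poly by blast
  show ?thesis
  proof (intro exI[of _ distance_matching_program] exI[of _ p] allI impI)
    fix n m d :: nat and es :: "(nat \<times> nat) list" and w :: "nat \<times> nat \<Rightarrow> real"
    assume *: "bipartite_graph {..<n} {..<m} (set es) \<and> distinct es \<and> (\<forall>e\<in>set es. 0 \<le> w e) \<and> 0 < d"
    define B where "B = 4 * (n + m + length es) + 4"
    define \<sigma> where "\<sigma> = input_memory n m es w d"
    define Q where "Q \<tau> \<longleftrightarrow> output_ordering n \<tau> \<in> permutations_of_set {..<n} \<and>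
      distance_matching d (set es) (output_ordering n \<tau>) (output_edges es \<tau>) \<and>
      (\<forall>ss' M'. ss' \<in> permutations_of_set {..<n} \<and> distance_matching d (set es) ss' M' \<longrightarrow>
         sum w M' \<le> sum w (output_edges es \<tau>))" for \<tau>
    define rest where "rest = Seq sizes (Seq arcs (Seq potentials (Seq solver
       (Seq collect (Seq counts (Seq keys (Seq ranks positions)))))))"
    have init: "nat_arr \<sigma> 0 0 = n" "nat_arr \<sigma> 0 (Suc 0) = m" "nat_arr \<sigma> 0 2 = length es" "nat_arr \<sigma> 0 3 = d"
      "nat_arr \<sigma> 10 0 = 0" "nat_arr \<sigma> 11 0 = 0"
      by (simp_all add: \<sigma>_def input_memory_def cells_def)
    have "wp B heights (wp B rest Q) \<sigma>"
    proof (rule wp_heights[OF init(1,4,5,6)])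
      fix \<tau> h assume off: "eqoff {10, 11} {} \<sigma> \<tau>" and h: "nat_arr \<tau> 10 0 = h" "nat_arr \<tau> 11 0 = h * d"
        and "h * d \<le> n" "n \<le> h * d + d"
      \<comment> \<open>The value of \<open>h\<close> is known only after \<open>heights\<close> has
        run, so the locale is instantiated inside its postcondition, with \<open>n - h * d\<close>
        as \<open>r\<close>.\<close>
      then interpret flow_instance n m d h "n - h * d" es w
        using * by unfold_locales (auto simp: bipartite_graph_def)
      have "input \<tau>"
        using off init h unfolding input_def eqoff_def
        by (auto simp: \<sigma>_def input_memory_def cells_def)
      moreover have "nat_arr \<tau> a = (\<lambda>_. 0)" if "a \<notin> {0, 1, 2, 10, 11}" for a
        using that off by (simp add: eqoff_def \<sigma>_def input_memory_def)
      moreover have "real_arr \<tau> a = (\<lambda>_. 0)" if "a \<noteq> 0" for a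
        using that off by (simp add: eqoff_def \<sigma>_def input_memory_def)
      ultimately show "wp B rest Q \<tau>"
        unfolding rest_def
      proof (rule wp_program[OF _ B_def])
        fix \<tau>'
        assume *: "output_ordering n \<tau>' \<in> permutations_of_set {..<n}"
          "distance_matching d (set es) (output_ordering n \<tau>') (output_edges es \<tau>')"
          "\<And>ss M. ss \<in> permutations_of_set {..<n} \<Longrightarrow> distance_matching d (set es) ss M \<Longrightarrow>
            sum w M \<le> sum w (output_edges es \<tau>')"
        have "sum w M' \<le> sum w (output_edges es \<tau>')"
          if "ss' \<in> permutations_of_set {..<n} \<and> distance_matching d (set es) ss' M'" for ss' M'
          by (rule *(3)[of ss' M']) (use that in simp_all)
        then show "Q \<tau>'" unfolding Q_def using *(1,2) by simp
      qed
    qed (use * in \<open>simp_all add: B_def\<close>)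
    then have "wp B distance_matching_program Q \<sigma>"
      by (simp add: distance_matching_program_def rest_def)
    from wp_run[OF this] obtain k \<tau> where
      run: "run distance_matching_program \<sigma> k \<tau>" "k \<le> tm distance_matching_program B" "Q \<tau>" by blast
    have "B = poly [:4, 4:] (n + m + length es)" by (simp add: B_def)
    then have "k \<le> poly p (n + m + length es)" using run(2) p by metis
    then show "\<exists>k \<tau> ss M.
          run distance_matching_program (input_memory n m es w d) k \<tau> \<and>
          k \<le> poly p (n + m + length es) \<and>
          ss = output_ordering n \<tau> \<and>
          M = output_edges es \<tau> \<and>
          ss \<in> permutations_of_set {..<n} \<and>
          distance_matching d (set es) ss M \<and>
          (\<forall>ss' M'. ss' \<in> permutations_of_set {..<n} \<and> distance_matching d (set es) ss' M' \<longrightarrow>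
             sum w M' \<le> sum w M)"
      using run(1,3) unfolding Q_def \<sigma>_def by blast
  qed
qed

end
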